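(* Let $d\ge 1$, $\lambda>0$, and let $V,\psi:\mathbb{R}^d\to\mathbb{R}$ satisfy assumptions (V1)–(V4) and ($\psi$1)–($\psi$3) listed in the context. If a probability density $\rho_\infty\in L^1(\mathbb{R}^{2d})\cap L^\infty(\mathbb{R}^{2d})$ is a solution of the stationary Vlasov-Fokker-Planck equation $\mathsf{K}[\rho_\infty](\rho_\infty)=0$, then $$\rho_\infty(q,p)=Z_\lambda^{-1}\exp\Big[-\frac1\lambda\Big(\frac{|p|^2}{2}+V(q)+\psi\ast\rho_\infty(q)\Big)\Big],\qquad (\ast)$$ where $Z_\lambda$ is the normalizing constant $$Z_\lambda=\int_{\mathbb{R}^{2d}}\exp\Big[-\frac1\lambda\Big(\frac{|p|^2}{2}+V(q)+\psi\ast\rho_\infty(q)\Big)\Big]\,dq\,dp .$$ Conversely, any probability measure whose density $\rho_\infty$ satisfies $(\ast)$ is invariant for the Vlasov-Fokker-Planck equation, i.e. satisfies $\mathsf{K}[\rho_\infty](\rho_\infty)=0$.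
   Context: Coordinates on $\mathbb{R}^{2d}$ are $(q,p)\in\mathbb{R}^d\times\mathbb{R}^d$; subscripts on differential operators indicate the variables on which they act. The convolution is $(\psi\ast\mu)(q)=\int_{\mathbb{R}^{2d}}\psi(q-q')\mu(q',p')\,dq'dp'$. The (dimensionless) Vlasov-Fokker-Planck equation is $$\partial_t\rho=-\mathrm{div}_q(\rho p)+\mathrm{div}_p\big(\rho(\nabla_qV+\nabla_q\psi\ast\rho+p)\big)+\lambda\Delta_p\rho,$$ and for given $\mu$, $$\mathsf{K}[\mu](\rho):=-\mathrm{div}_q(\rho p)+\mathrm{div}_p\big(\rho(\nabla_qV+\nabla_q\psi\ast\mu+p)\big)+\lambda\Delta_p\rho .$$ A solution $\rho$ of $\mathsf{K}[\rho](\rho)=0$ is a probability density for which $\psi\ast\rho$ and $\nabla\psi\ast\rho$ are well defined. Assumptions on $V$: (V1) $V$ is smooth and there exist an integer $m\ge1$ and $C_{2m}>0$ with $\lim_{|x|\to\infty}V(x)/|x|^{2m}=C_{2m}$. (V2) $\nabla V(x)=0$ has finitely many solutions. (V3) There are $C_2,C_4>0$ with $V(x)\ge C_4|x|^4-C_2|x|^2$ for all $x\in\mathbb{R}^d$. (V4) $\mathrm{Hess}\,V(x)\to+\infty$ as $|x|\to\infty$ (i.e. its smallest eigenvalue tends to $+\infty$), and $\mathrm{Hess}\,V(x)>0$ for all $x\notin K$, where $K\subset\mathbb{R}^d$ is a compact set containing all critical points of $V$. Assumptions on $\psi$: ($\psi$1) $\psi(x)=G(|x|)$ for an even polynomial $G$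 on $\mathbb{R}$ with $\deg G=:2n\ge2$. ($\psi$2) $G$ and $G''$ are convex. ($\psi$3) $G(0)=0$. *)

theory Defs
  imports "HOL-Analysis.Analysis" "HOL-Computational_Algebra.Polynomial"
begin

primrec Ck :: "nat \<Rightarrow> ('a::real_normed_vector \<Rightarrow> 'b::real_normed_vector) \<Rightarrow> bool" where
  "Ck 0 f \<longleftrightarrow> continuous_on UNIV f"
| "Ck (Suc k) f \<longleftrightarrow> (\<forall>x. f differentiable (at x)) \<and>
     (\<forall>v. Ck k (\<lambda>x. frechet_derivative f (at x) v))"

definition smooth :: "('a::real_normed_vector \<Rightarrow> 'b::real_normed_vector) \<Rightarrow> bool" where
  "smooth f \<longleftrightarrow> (\<forall>k. Ck k f)"

definition grad :: "(real^'d \<Rightarrow> real) \<Rightarrow> real^'d \<Rightarrow> real^'d" where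
  "grad f x = (\<chi> i. frechet_derivative f (at x) (axis i 1))"

definition hess :: "(real^'d \<Rightarrow> real) \<Rightarrow> real^'d \<Rightarrow> real^'d^'d" where
  "hess f x = jacobian (grad f) (at x)"

definition laplacian :: "(real^'d \<Rightarrow> real) \<Rightarrow> real^'d \<Rightarrow> real" where
  "laplacian f x = trace (hess f x)"

text \<open>For a symmetric matrix the set below is finite and nonempty, so that \<^const>\<open>Min\<close> is
  meaningful; the definition is only applied to Hessians of smooth functions.\<close>

definition min_eigenvalue :: "real^'d^'d \<Rightarrow> real" where
  "min_eigenvalue A = Min {c. \<exists>v. v \<noteq> 0 \<and> A *v v = c *\<^sub>R v}"

definition pos_def :: "real^'d^'d \<Rightarrow> bool" where
  "pos_def A \<longleftrightarrow> (\<forall>v. v \<noteq> 0 \<longrightarrow> 0 < v \<bullet> (A *v v))"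

definition V1 :: "(real^'d \<Rightarrow> real) \<Rightarrow> bool" where
  "V1 V \<longleftrightarrow> smooth V \<and>
     (\<exists>m\<ge>1. \<exists>C>0. ((\<lambda>x. V x / norm x ^ (2 * m)) \<longlongrightarrow> C) at_infinity)"

definition V2 :: "(real^'d \<Rightarrow> real) \<Rightarrow> bool" where
  "V2 V \<longleftrightarrow> finite {x. grad V x = 0}"

definition V3 :: "(real^'d \<Rightarrow> real) \<Rightarrow> bool" where
  "V3 V \<longleftrightarrow> (\<exists>C2>0. \<exists>C4>0. \<forall>x. V x \<ge> C4 * norm x ^ 4 - C2 * norm x ^ 2)"

definition V4 :: "(real^'d \<Rightarrow> real) \<Rightarrow> bool" where
  "V4 V \<longleftrightarrow> filterlim (\<lambda>x. min_eigenvalue (hess V x)) at_top at_infinity \<and>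
     (\<exists>K. compact K \<and> {x. grad V x = 0} \<subseteq> K \<and> (\<forall>x. x \<notin> K \<longrightarrow> pos_def (hess V x)))"

definition psi1 :: "real poly \<Rightarrow> (real^'d \<Rightarrow> real) \<Rightarrow> bool" where
  "psi1 G \<psi> \<longleftrightarrow> (\<forall>x. \<psi> x = poly G (norm x)) \<and>
     (\<forall>r. poly G (- r) = poly G r) \<and> (\<exists>n\<ge>1. degree G = 2 * n)"

definition psi2 :: "real poly \<Rightarrow> bool" where
  "psi2 G \<longleftrightarrow> convex_on UNIV (poly G) \<and> convex_on UNIV (poly (pderiv (pderiv G)))"

definition psi3 :: "real poly \<Rightarrow> bool" where
  "psi3 G \<longleftrightarrow> poly G 0 = 0"

definition interaction_potential :: "(real^'d \<Rightarrow> real) \<Rightarrow> bool" where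
  "interaction_potential \<psi> \<longleftrightarrow> (\<exists>G. psi1 G \<psi> \<and> psi2 G \<and> psi3 G)"

text \<open>Points of phase space are pairs \<open>(q, p)\<close>. Densities are representatives of classes
  modulo Lebesgue null sets, so all pointwise statements about them hold almost everywhere.\<close>

type_synonym 'd phase = "(real^'d) \<times> (real^'d)"

definition prob_density :: "('d::finite phase \<Rightarrow> real) \<Rightarrow> bool" where
  "prob_density \<rho> \<longleftrightarrow> (AE z in lborel. 0 \<le> \<rho> z) \<and> has_bochner_integral lborel \<rho> 1"

definition in_L1 :: "('d::finite phase \<Rightarrow> real) \<Rightarrow> bool" where
  "in_L1 \<rho> \<longleftrightarrow> integrable lborel \<rho>"

definition in_Linfty :: "('d::finite phase \<Rightarrow> real) \<Rightarrow> bool" where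
  "in_Linfty \<rho> \<longleftrightarrow> \<rho> \<in> borel_measurable lborel \<and> (\<exists>C. AE z in lborel. \<bar>\<rho> z\<bar> \<le> C)"

text \<open>The function \<open>f\<close> lives on position space and is real-valued (\<open>\<psi>\<close>) or
  vector-valued (\<open>\<nabla>\<psi>\<close>); the convolution is with the position marginal of \<open>\<mu>\<close>.\<close>

definition conv ::
  "(real^'d \<Rightarrow> 'b::{banach, second_countable_topology}) \<Rightarrow> ('d::finite phase \<Rightarrow> real) \<Rightarrow> real^'d \<Rightarrow> 'b"
  where "conv f \<mu> q = (LINT z|lborel. \<mu> z *\<^sub>R f (q - fst z))"

definition conv_defined ::
  "(real^'d \<Rightarrow> 'b::{banach, second_countable_topology}) \<Rightarrow> ('d::finite phase \<Rightarrow> real) \<Rightarrow> bool"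
  where "conv_defined f \<mu> \<longleftrightarrow> (\<forall>q. integrable lborel (\<lambda>z. \<mu> z *\<^sub>R f (q - fst z)))"

text \<open>Densities are merely integrable, so the differential operators applied to them are taken
  in the sense of distributions: each one yields a functional on test functions \<open>\<phi>\<close>,
  namely \<open>\<langle>div\<^sub>q F, \<phi>\<rangle> = - \<integral> F \<bullet> \<nabla>\<^sub>q \<phi>\<close>,
  \<open>\<langle>div\<^sub>p F, \<phi>\<rangle> = - \<integral> F \<bullet> \<nabla>\<^sub>p \<phi>\<close> and
  \<open>\<langle>\<Delta>\<^sub>p f, \<phi>\<rangle> = \<integral> f \<Delta>\<^sub>p \<phi>\<close>.\<close>

definition test_function :: "('d::finite phase \<Rightarrow> real) \<Rightarrow> bool" where
  "test_function \<phi> \<longleftrightarrow> smooth \<phi> \<and> compact (closure {z. \<phi> z \<noteq> 0})"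

definition grad_q :: "('d::finite phase \<Rightarrow> real) \<Rightarrow> 'd phase \<Rightarrow> real^'d" where
  "grad_q \<phi> = (\<lambda>(q, p). grad (\<lambda>x. \<phi> (x, p)) q)"

definition grad_p :: "('d::finite phase \<Rightarrow> real) \<Rightarrow> 'd phase \<Rightarrow> real^'d" where
  "grad_p \<phi> = (\<lambda>(q, p). grad (\<lambda>y. \<phi> (q, y)) p)"

definition laplacian_p :: "('d::finite phase \<Rightarrow> real) \<Rightarrow> 'd phase \<Rightarrow> real" where
  "laplacian_p \<phi> = (\<lambda>(q, p). laplacian (\<lambda>y. \<phi> (q, y)) p)"

definition distr_div_q :: "('d::finite phase \<Rightarrow> real^'d) \<Rightarrow> ('d phase \<Rightarrow> real) \<Rightarrow> real" where
  "distr_div_q F \<phi> = - (LINT z|lborel. F z \<bullet> grad_q \<phi> z)"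

definition distr_div_p :: "('d::finite phase \<Rightarrow> real^'d) \<Rightarrow> ('d phase \<Rightarrow> real) \<Rightarrow> real" where
  "distr_div_p F \<phi> = - (LINT z|lborel. F z \<bullet> grad_p \<phi> z)"

definition distr_laplacian_p :: "('d::finite phase \<Rightarrow> real) \<Rightarrow> ('d phase \<Rightarrow> real) \<Rightarrow> real" where
  "distr_laplacian_p f \<phi> = (LINT z|lborel. f z * laplacian_p \<phi> z)"

definition vfp_op ::
  "real \<Rightarrow> (real^'d \<Rightarrow> real) \<Rightarrow> (real^'d \<Rightarrow> real) \<Rightarrow> ('d::finite phase \<Rightarrow> real) \<Rightarrow>
   ('d phase \<Rightarrow> real) \<Rightarrow> ('d phase \<Rightarrow> real) \<Rightarrow> real" where
  "vfp_op lam V \<psi> \<mu> \<rho> \<phi> =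
     - distr_div_q (\<lambda>(q, p). \<rho> (q, p) *\<^sub>R p) \<phi>
     + distr_div_p (\<lambda>(q, p). \<rho> (q, p) *\<^sub>R (grad V q + conv (grad \<psi>) \<mu> q + p)) \<phi>
     + lam * distr_laplacian_p \<rho> \<phi>"

definition vfp_stationary ::
  "real \<Rightarrow> (real^'d \<Rightarrow> real) \<Rightarrow> (real^'d \<Rightarrow> real) \<Rightarrow> ('d::finite phase \<Rightarrow> real) \<Rightarrow> bool" where
  "vfp_stationary lam V \<psi> \<rho> \<longleftrightarrow>
     prob_density \<rho> \<and> conv_defined \<psi> \<rho> \<and> conv_defined (grad \<psi>) \<rho> \<and>
     (\<forall>\<phi>. test_function \<phi> \<longrightarrow> vfp_op lam V \<psi> \<rho> \<rho> \<phi> = 0)"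

definition gibbs_weight ::
  "real \<Rightarrow> (real^'d \<Rightarrow> real) \<Rightarrow> (real^'d \<Rightarrow> real) \<Rightarrow> ('d::finite phase \<Rightarrow> real) \<Rightarrow> 'd phase \<Rightarrow> real" where
  "gibbs_weight lam V \<psi> \<rho> =
     (\<lambda>(q, p). exp (- (1 / lam) * ((norm p)\<^sup>2 / 2 + V q + conv \<psi> \<rho> q)))"

definition partition_function ::
  "real \<Rightarrow> (real^'d \<Rightarrow> real) \<Rightarrow> (real^'d \<Rightarrow> real) \<Rightarrow> ('d::finite phase \<Rightarrow> real) \<Rightarrow> real" where
  "partition_function lam V \<psi> \<rho> = (LINT z|lborel. gibbs_weight lam V \<psi> \<rho> z)"

text \<open>The first two conjuncts say that the convolution and the normalizing constant occurring in
  the equation exist; without them the Bochner integrals would default to \<open>0\<close>.\<close>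

definition self_consistent ::
  "real \<Rightarrow> (real^'d \<Rightarrow> real) \<Rightarrow> (real^'d \<Rightarrow> real) \<Rightarrow> ('d::finite phase \<Rightarrow> real) \<Rightarrow> bool" where
  "self_consistent lam V \<psi> \<rho> \<longleftrightarrow>
     conv_defined \<psi> \<rho> \<and> integrable lborel (gibbs_weight lam V \<psi> \<rho>) \<and>
     (AE z in lborel. \<rho> z = inverse (partition_function lam V \<psi> \<rho>) * gibbs_weight lam V \<psi> \<rho> z)"

end

theory Submission
  imports Defs
begin

text \<open>
Fix a solution \<open>\<rho>\<close> and put \<open>U = V + \<psi> * \<rho>\<close>, \<open>H(q,p) = |p|^2/2 + U(q)\<close>, \<open>M = exp (- H / lam)\<close>. With
\<open>\<rho>\<close> frozen inside \<open>U\<close>, the equation is the linear kinetic Fokker-Planck equation with dual operator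
\<open>L = T - p \<cdot> \<nabla>_p + lam \<Delta>_p\<close>, where \<open>T = p \<cdot> \<nabla>_q - \<nabla>U \<cdot> \<nabla>_p\<close> is antisymmetric with respect to \<open>M\<close> and
\<open>M (lam \<Delta>_p - p \<cdot> \<nabla>_p) = lam div_p (M \<nabla>_p)\<close>. Hence \<open>\<integral> M L\<phi> = 0\<close>, which is the converse half
(\<open>integral_maxwell_gen\<close>). For the other half one has to show that \<open>\<rho>\<close> is a multiple of \<open>M\<close>; integrating
\<open>\<rho>\<close> then identifies the factor as the inverse of \<open>Z = \<integral> M\<close>.

Formally, \<open>f = \<rho>/M\<close> satisfies \<open>- M T f + lam div_p (M \<nabla>_p f) = 0\<close>. Multiplying by \<open>\<beta>'(f)\<close> with \<open>\<beta>\<close>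
convex removes the transport term and leaves \<open>lam \<integral> M |\<nabla>_p f|^2 \<beta>''(f) = 0\<close>, so \<open>f\<close> does not depend
on \<open>p\<close>. What remains of the equation is \<open>p \<cdot> \<nabla>_q f = 0\<close> for all \<open>p\<close>, so \<open>f\<close> is constant. Three points
make this rigorous for a density \<open>\<rho>\<close> that is merely bounded and integrable.

Regularity. \<open>\<rho>\<close> is mollified on a scale \<open>\<epsilon>\<close> in \<open>q\<close> and a far smaller scale \<open>\<delta>\<close> in \<open>p\<close>. The
commutator with \<open>p \<cdot> \<nabla>_q\<close> is then of size \<open>\<delta>/\<epsilon>\<close>, while the commutator with force and friction is of the form
\<open>div_p g\<close> with \<open>g\<close> of size \<open>\<epsilon>\<close> on compact sets, which the dissipation absorbs (\<open>mollified_equation\<close>,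
\<open>energy_inequality\<close>).

Infinity. The cutoff \<open>\<zeta>\<close> is a function of \<open>H/N\<close>. Thus \<open>T\<zeta> = 0\<close>, and \<open>L\<zeta>\<close> is bounded uniformly in \<open>N\<close> and
tends to \<open>0\<close> pointwise, because \<open>|p|^2\<close> is at most of order \<open>N\<close> on the support of \<open>\<zeta>\<close>. With
\<open>\<beta>(s) = s^2/(1+s) \<le> s\<close> the cutoff error is at most \<open>\<integral> \<rho> |L\<zeta>|\<close>, which vanishes as \<open>N\<close> grows since \<open>\<rho>\<close> is
integrable (\<open>gen_cutoff_integral_tendsto_0\<close>). The bound on \<open>\<rho>\<close> keeps \<open>\<beta>''(f)\<close> away from \<open>0\<close> on compact
sets, so that vanishing dissipation forces the distributional gradient \<open>\<nabla>_p (\<rho>/M)\<close> to vanish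
(\<open>weak_momentum_derivative_zero\<close>).

Constancy. A function with vanishing distributional derivative in a direction is invariant under
translations in that direction, when tested against test functions. Translating the test function in
\<open>\<integral> f p \<cdot> \<nabla>_q \<psi> = 0\<close> by the \<open>i\<close>-th momentum unit vector isolates \<open>\<integral> f \<partial>\<psi>/\<partial>q_i = 0\<close>
(\<open>weak_position_derivative_zero\<close>), and a nonnegative \<open>f\<close> whose functional on test functions is
translation invariant is constant (\<open>weak_gradient_zero_imp_constant\<close>).
\<close>

section \<open>Smooth functions and directional derivatives\<close>

definition dd :: "'a::real_normed_vector \<Rightarrow> ('a \<Rightarrow> real) \<Rightarrow> 'a \<Rightarrow> real" where
  "dd v f x = frechet_derivative f (at x) v"

lemma has_derivative_dd:
  "f differentiable at x \<Longrightarrow> (f has_derivative (\<lambda>v. dd v f x)) (at x)"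
  unfolding dd_def by (simp add: frechet_derivative_works[symmetric])

lemma dd_eqI: "(f has_derivative f') (at x) \<Longrightarrow> dd v f x = f' v"
  unfolding dd_def by (metis frechet_derivative_at)

lemma Ck_Suc_dd: "Ck (Suc k) (f :: 'a::real_normed_vector \<Rightarrow> real) \<longleftrightarrow> (\<forall>x. f differentiable at x) \<and> (\<forall>v. Ck k (dd v f))"
  by (simp add: dd_def[abs_def])

declare Ck.simps(2) [simp del]

text \<open>Reduces the closure properties of \<open>Ck\<close> to inductions on \<open>k\<close>: it suffices to exhibit the derivative and to show that
each of its directional components is in \<open>Ck k\<close>.\<close>
lemma Ck_SucI:
  fixes f :: "'a::real_normed_vector \<Rightarrow> real"
  assumes "\<And>x. (f has_derivative f' x) (at x)" "\<And>v. Ck k (\<lambda>x. f' x v)"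
  shows "Ck (Suc k) f"
proof -
  have "dd v f = (\<lambda>x. f' x v)" for v using dd_eqI[OF assms(1)] by blast
  then show ?thesis unfolding Ck_Suc_dd using assms differentiable_def by metis
qed

lemma Ck_Suc_has_derivative: "Ck (Suc k) f \<Longrightarrow> (f has_derivative (\<lambda>v. dd v f x)) (at x)"
  using Ck_Suc_dd has_derivative_dd by metis

lemma Ck_SucD: "Ck (Suc k) f \<Longrightarrow> Ck k (f :: 'a::real_normed_vector \<Rightarrow> real)"
proof (induction k arbitrary: f)
  case 0
  then have "f differentiable at x" for x by (simp only: Ck_Suc_dd)
  then show ?case
    by (simp add: continuous_on_eq_continuous_at differentiable_imp_continuous_within)
next
  case (Suc k)
  from Suc.prems have "\<forall>x. f differentiable at x" and "\<forall>v. Ck (Suc k) (dd v f)"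
    unfolding Ck_Suc_dd[of "Suc k"] by blast+
  with Suc.IH show ?case unfolding Ck_Suc_dd by blast
qed

lemma Ck_const: "Ck k (\<lambda>_. c :: real)"
proof (induction k arbitrary: c)
  case (Suc k)
  then show ?case by (intro Ck_SucI[where f'="\<lambda>_ _. 0"] has_derivative_const)
qed simp

lemma Ck_bounded_linear: "bounded_linear f \<Longrightarrow> Ck k (f :: 'a::real_normed_vector \<Rightarrow> real)"
proof (cases k)
  case (Suc j)
  assume "bounded_linear f"
  then show ?thesis unfolding Suc
    by (intro Ck_SucI[where f'="\<lambda>x. f"] Ck_const bounded_linear_imp_has_derivative)
qed (simp add: linear_continuous_on)

lemma Ck_add: "Ck k f \<Longrightarrow> Ck k g \<Longrightarrow> Ck k (\<lambda>x. f x + g x :: real)"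
proof (induction k arbitrary: f g)
  case (Suc k)
  have "Ck k (\<lambda>x. dd v f x + dd v g x)" for v
    by (intro Suc.IH) (use Suc.prems in \<open>auto simp only: Ck_Suc_dd\<close>)
  with has_derivative_add[OF Suc.prems[THEN Ck_Suc_has_derivative]] show ?case
    by (rule Ck_SucI)
qed (simp add: continuous_on_add)

lemma Ck_mult: "Ck k f \<Longrightarrow> Ck k g \<Longrightarrow> Ck k (\<lambda>x. f x * g x :: real)"
proof (induction k arbitrary: f g)
  case (Suc k)
  have "Ck k f" "Ck k g" "Ck k (dd v f)" "Ck k (dd v g)" for v
    using Suc.prems by (auto intro: Ck_SucD simp only: Ck_Suc_dd[of k])
  then have "Ck k (\<lambda>x. f x * dd v g x + dd v f x * g x)" for v
    by (intro Ck_add Suc.IH)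
  with has_derivative_mult[OF Suc.prems[THEN Ck_Suc_has_derivative]] show ?case
    by (rule Ck_SucI)
qed (simp add: continuous_on_mult)

lemma Ck_compose_affine:
  assumes A: "bounded_linear A"
  shows "Ck k f \<Longrightarrow> Ck k (\<lambda>x. f (A x + c) :: real)"
proof (induction k arbitrary: f)
  case 0
  then show ?case
    using continuous_on_compose2[of UNIV f UNIV "\<lambda>x. A x + c"]
      continuous_on_add[OF linear_continuous_on[OF A] continuous_on_const] by simp
next
  case (Suc k)
  have "((\<lambda>x. A x + c) has_derivative A) (at x)" for x
    using bounded_linear_imp_has_derivative[OF A]
    by (auto intro!: derivative_eq_intros)
  then have "((\<lambda>x. f (A x + c)) has_derivative (\<lambda>v. dd (A v) f (A x + c))) (at x)" for x
    using has_derivative_compose[OF _ Ck_Suc_has_derivative[OF Suc.prems]] by fast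
  moreover have "Ck k (\<lambda>x. dd (A v) f (A x + c))" for v
    using Suc by (simp only: Ck_Suc_dd)
  ultimately show ?case by (rule Ck_SucI)
qed

text \<open>The induction goes through because the derivative of the real function \<open>h\<close> in direction \<open>w\<close> is \<open>w\<close> times the
one in direction \<open>1\<close>, so the chain rule produces a product of a composition and a \<open>Ck k\<close> function.\<close>
lemma Ck_compose_real:
  fixes h :: "real \<Rightarrow> real"
  shows "Ck k h \<Longrightarrow> Ck k f \<Longrightarrow> Ck k (\<lambda>x. h (f x))"
proof (induction k arbitrary: h)
  case 0
  then show ?case using continuous_on_compose2[of UNIV h UNIV f] by simp
next
  case (Suc k)
  have "linear (\<lambda>v. dd v h y)" for y
    using has_derivative_linear[OF Ck_Suc_has_derivative[OF Suc.prems(1)]] .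
  then have lin: "dd w h y = w * dd 1 h y" for w y
    using linear_cmul[of "\<lambda>v. dd v h y" w 1] by simp
  have "((\<lambda>x. h (f x)) has_derivative (\<lambda>v. dd (dd v f x) h (f x))) (at x)" for x
    using has_derivative_compose[OF Ck_Suc_has_derivative[OF Suc.prems(2)]
       Ck_Suc_has_derivative[OF Suc.prems(1)]] by simp
  moreover have "(\<lambda>v. dd (dd v f x) h (f x)) = (\<lambda>v. dd v f x * dd 1 h (f x))" for x
    using lin by blast
  ultimately have *: "((\<lambda>x. h (f x)) has_derivative (\<lambda>v. dd v f x * dd 1 h (f x))) (at x)" for x
    by metis
  have "Ck k f" "Ck k (dd v f)" "Ck k (dd 1 h)" for v
    using Suc.prems by (auto intro: Ck_SucD simp only: Ck_Suc_dd[of k])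
  then have "Ck k (\<lambda>x. dd v f x * dd 1 h (f x))" for v
    using Ck_mult Suc.IH by blast
  then show ?case by (rule Ck_SucI[OF *])
qed

lemma Ck_exp: "Ck k (exp :: real \<Rightarrow> real)"
proof (induction k)
  case (Suc k)
  then show ?case
    by (intro Ck_SucI[where f'="\<lambda>x v. exp x * v"] Ck_mult Ck_const)
       (simp_all flip: has_field_derivative_def)
qed (auto intro!: continuous_intros)

lemma Ck_inverse:
  fixes f :: "'a::real_normed_vector \<Rightarrow> real"
  assumes "\<And>x. f x \<noteq> 0"
  shows "Ck k f \<Longrightarrow> Ck k (\<lambda>x. inverse (f x))"
proof (induction k)
  case (Suc k)
  have *: "((\<lambda>x. inverse (f x)) has_derivative
      (\<lambda>v. (-1) * (inverse (f x) * dd v f x * inverse (f x)))) (at x)" for x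
    using Deriv.has_derivative_inverse[OF assms Ck_Suc_has_derivative[OF Suc.prems], of x] by simp
  from Suc.prems have f: "Ck k f" and df: "Ck k (dd v f)" for v
    by (rule Ck_SucD, simp only: Ck_Suc_dd[of k])
  show ?case
    by (intro Ck_SucI[OF *] Ck_mult Ck_const Suc.IH f df)
qed (auto intro!: continuous_intros simp: assms)

named_theorems smooth_intros

lemma smooth_dd [smooth_intros]: "smooth f \<Longrightarrow> smooth (dd v f)"
  unfolding smooth_def using Ck_Suc_dd by blast

lemma smooth_has_derivative: "smooth f \<Longrightarrow> (f has_derivative (\<lambda>v. dd v f x)) (at x)"
  unfolding smooth_def using Ck_Suc_has_derivative by blast

lemma smooth_continuous_on: "smooth f \<Longrightarrow> continuous_on S f"
  unfolding smooth_def using Ck.simps(1) continuous_on_subset by blast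

lemma smooth_measurable: "smooth f \<Longrightarrow> (f :: 'a::euclidean_space \<Rightarrow> real) \<in> borel_measurable borel"
  by (simp add: smooth_continuous_on borel_measurable_continuous_onI)

lemma smooth_const [smooth_intros]: "smooth (\<lambda>_. c :: real)"
  by (simp add: smooth_def Ck_const)
lemma smooth_bounded_linear: "bounded_linear f \<Longrightarrow> smooth (f :: 'a::real_normed_vector \<Rightarrow> real)"
  by (simp add: smooth_def Ck_bounded_linear)
lemma smooth_add [smooth_intros]: "smooth f \<Longrightarrow> smooth g \<Longrightarrow> smooth (\<lambda>x. f x + g x :: real)"
  by (simp add: smooth_def Ck_add)
lemma smooth_mult [smooth_intros]: "smooth f \<Longrightarrow> smooth g \<Longrightarrow> smooth (\<lambda>x. f x * g x :: real)"
  by (simp add: smooth_def Ck_mult)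
lemma smooth_minus [smooth_intros]: "smooth f \<Longrightarrow> smooth (\<lambda>x. - f x :: real)"
  using smooth_mult[OF smooth_const[of "-1"]] by simp
lemma smooth_diff [smooth_intros]: "smooth f \<Longrightarrow> smooth g \<Longrightarrow> smooth (\<lambda>x. f x - g x :: real)"
  using smooth_add[OF _ smooth_minus, of f g] by simp
lemma smooth_divide_const [smooth_intros]: "smooth f \<Longrightarrow> smooth (\<lambda>x. f x / c :: real)"
  using smooth_mult[OF _ smooth_const, of f "inverse c"] by (simp add: divide_inverse)
lemma smooth_sum [smooth_intros]:
  "(\<And>i. i \<in> I \<Longrightarrow> smooth (f i)) \<Longrightarrow> smooth (\<lambda>x. \<Sum>i\<in>I. f i x :: real)"
  by (induction I rule: infinite_finite_induct) (auto intro!: smooth_intros)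
lemma smooth_prod [smooth_intros]:
  "(\<And>i. i \<in> I \<Longrightarrow> smooth (f i)) \<Longrightarrow> smooth (\<lambda>x. \<Prod>i\<in>I. f i x :: real)"
  by (induction I rule: infinite_finite_induct) (auto intro!: smooth_intros)
lemma smooth_power [smooth_intros]: "smooth f \<Longrightarrow> smooth (\<lambda>x. f x ^ n :: real)"
  by (induction n) (auto intro!: smooth_intros)
lemma smooth_compose_real: "smooth h \<Longrightarrow> smooth f \<Longrightarrow> smooth (\<lambda>x. h (f x) :: real)"
  for h :: "real \<Rightarrow> real"
  by (simp add: smooth_def Ck_compose_real)
lemma smooth_exp [smooth_intros]: "smooth f \<Longrightarrow> smooth (\<lambda>x. exp (f x) :: real)"
  by (simp add: smooth_def Ck_compose_real Ck_exp)
lemma smooth_inverse [smooth_intros]: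
  "smooth f \<Longrightarrow> (\<And>x. f x \<noteq> 0) \<Longrightarrow> smooth (\<lambda>x. inverse (f x) :: real)"
  by (simp add: smooth_def Ck_inverse)
lemma smooth_compose_affine:
  "bounded_linear A \<Longrightarrow> smooth f \<Longrightarrow> smooth (\<lambda>x. f (A x + c) :: real)"
  by (simp add: smooth_def Ck_compose_affine)

lemma smooth_inner [smooth_intros]: "smooth (\<lambda>x. x \<bullet> (a :: 'a::real_inner))"
  by (intro smooth_bounded_linear bounded_linear_inner_left)
lemma smooth_snd_component [smooth_intros]: "smooth (\<lambda>z :: 'd::finite phase. snd z $ i)"
  by (intro smooth_bounded_linear bounded_linear_compose[OF bounded_linear_vec_nth bounded_linear_snd])
lemma smooth_norm_square [smooth_intros]: "smooth (\<lambda>x :: 'a::euclidean_space. (norm x)\<^sup>2)"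
proof -
  have "(\<lambda>x :: 'a. (norm x)\<^sup>2) = (\<lambda>x. \<Sum>b\<in>Basis. (x \<bullet> b) * (x \<bullet> b))"
    by (simp add: power2_norm_eq_inner flip: euclidean_inner)
  then show ?thesis by (simp only:) (intro smooth_intros)
qed
lemma smooth_compose_fst: "smooth f \<Longrightarrow> smooth (\<lambda>z. f (fst z) :: real)"
  using smooth_compose_affine[OF bounded_linear_fst, of f 0] by simp
lemma smooth_compose_snd: "smooth f \<Longrightarrow> smooth (\<lambda>z. f (snd z) :: real)"
  using smooth_compose_affine[OF bounded_linear_snd, of f 0] by simp
lemma smooth_translate: "smooth f \<Longrightarrow> smooth (\<lambda>x. f (x + c) :: real)"
  using smooth_compose_affine[OF bounded_linear_ident, of f c] by simp
lemma smooth_reflect: "smooth f \<Longrightarrow> smooth (\<lambda>x. f (c - x) :: real)"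
  using smooth_compose_affine[OF bounded_linear_minus[OF bounded_linear_ident], of f c] by simp

lemma dd_const [simp]: "dd v (\<lambda>_. c) x = 0"
  by (simp add: dd_def)
lemma dd_add: "smooth f \<Longrightarrow> smooth g \<Longrightarrow> dd v (\<lambda>x. f x + g x) x = dd v f x + dd v g x"
  by (rule dd_eqI[OF has_derivative_add[OF smooth_has_derivative smooth_has_derivative]])
lemma dd_minus: "smooth f \<Longrightarrow> dd v (\<lambda>x. - f x) x = - dd v f x"
  by (rule dd_eqI[OF has_derivative_minus[OF smooth_has_derivative]])
lemma dd_diff: "smooth f \<Longrightarrow> smooth g \<Longrightarrow> dd v (\<lambda>x. f x - g x) x = dd v f x - dd v g x"
  by (rule dd_eqI[OF has_derivative_diff[OF smooth_has_derivative smooth_has_derivative]])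
lemma dd_mult: "smooth f \<Longrightarrow> smooth g \<Longrightarrow> dd v (\<lambda>x. f x * g x) x = f x * dd v g x + dd v f x * g x"
  by (rule dd_eqI[OF has_derivative_mult[OF smooth_has_derivative smooth_has_derivative]])
lemma dd_divide_const: "smooth f \<Longrightarrow> dd v (\<lambda>x. f x / c) x = dd v f x / c"
  using dd_mult[OF _ smooth_const, of f v "inverse c" x] by (simp add: divide_inverse)
lemma dd_exp: "smooth f \<Longrightarrow> dd v (\<lambda>x. exp (f x)) x = exp (f x) * dd v f x"
  using dd_eqI[OF has_derivative_exp[OF smooth_has_derivative]] by fastforce
lemma dd_inverse:
  "smooth f \<Longrightarrow> f x \<noteq> 0 \<Longrightarrow> dd v (\<lambda>x. inverse (f x)) x = - (inverse (f x) * dd v f x * inverse (f x))"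
  using dd_eqI[OF Deriv.has_derivative_inverse[OF _ smooth_has_derivative]] by fastforce
lemma dd_bounded_linear: "bounded_linear f \<Longrightarrow> dd v f x = f v"
  by (rule dd_eqI[OF bounded_linear_imp_has_derivative])
lemma dd_scaleR: "smooth f \<Longrightarrow> dd (c *\<^sub>R v) f x = c * dd v f x"
  using linear_cmul[OF bounded_linear.linear[OF has_derivative_bounded_linear[OF smooth_has_derivative]]]
  by fastforce
lemma dd_compose_affine:
  assumes "bounded_linear A" "smooth f"
  shows "dd v (\<lambda>x. f (A x + c)) x = dd (A v) f (A x + c)"
proof (rule dd_eqI)
  have "((\<lambda>x. A x + c) has_derivative A) (at x)"
    using bounded_linear_imp_has_derivative[OF assms(1)]
    by (auto intro!: derivative_eq_intros)
  then show "((\<lambda>x. f (A x + c)) has_derivative (\<lambda>v. dd (A v) f (A x + c))) (at x)"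
    using has_derivative_compose[OF _ smooth_has_derivative[OF assms(2)]] by fast
qed
lemma dd_compose_real:
  fixes h :: "real \<Rightarrow> real"
  assumes "smooth h" "smooth f"
  shows "dd v (\<lambda>x. h (f x)) x = dd 1 h (f x) * dd v f x"
proof -
  have "dd v (\<lambda>x. h (f x)) x = dd (dd v f x) h (f x)"
    by (rule dd_eqI[OF has_derivative_compose[OF smooth_has_derivative smooth_has_derivative]])
       (rule assms)+
  then show ?thesis using dd_scaleR[OF assms(1), of "dd v f x" 1] by simp
qed
lemma dd_reflect: "smooth f \<Longrightarrow> dd v (\<lambda>x. f (c - x)) x = - dd v f (c - x)"
  using dd_compose_affine[OF bounded_linear_minus[OF bounded_linear_ident], of f v c x]
    dd_scaleR[of f "-1" v] by simp
lemma dd_translate: "smooth f \<Longrightarrow> dd v (\<lambda>x. f (x + c)) x = dd v f (x + c)"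
  using dd_compose_affine[OF bounded_linear_ident, of f v c x] by simp
lemma dd_compose_fst: "smooth f \<Longrightarrow> dd v (\<lambda>z. f (fst z)) z = dd (fst v) f (fst z)"
  using dd_compose_affine[OF bounded_linear_fst, of f v 0 z] by simp
lemma dd_compose_snd: "smooth f \<Longrightarrow> dd v (\<lambda>z. f (snd z)) z = dd (snd v) f (snd z)"
  using dd_compose_affine[OF bounded_linear_snd, of f v 0 z] by simp

section \<open>The bump function\<close>

text \<open>The case \<open>n = 0\<close> is the classical smooth function \<open>exp (- 1/t)\<close>, extended by \<open>0\<close>. The powers of \<open>1/t\<close> make the
family closed under differentiation, which reduces smoothness to differentiability.\<close>
definition bump :: "nat \<Rightarrow> real \<Rightarrow> real" where
  "bump n t = (if 0 < t then inverse t ^ n * exp (- inverse t) else 0)"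

lemma bump_nonneg: "0 \<le> bump n t" and bump_eq_0_iff: "bump n t = 0 \<longleftrightarrow> t \<le> 0"
  by (auto simp: bump_def)

lemma bump_has_field_derivative:
  "(bump n has_field_derivative bump (n + 2) t - real n * bump (Suc n) t) (at t)"
proof (cases t "0 :: real" rule: linorder_cases)
  case less
  have "((\<lambda>_. 0) has_field_derivative 0) (at t)" by simp
  then have "(bump n has_field_derivative 0) (at t)"
    by (rule has_field_derivative_transform_within_open[where S="{..<0}"])
       (use less in \<open>auto simp: bump_def\<close>)
  with less show ?thesis by (simp add: bump_def)
next
  case greater
  have "((\<lambda>t. inverse t ^ n * exp (- inverse t)) has_field_derivative
      bump (n + 2) t - real n * bump (Suc n) t) (at t)"
    using greater
    by (cases n) (auto intro!: derivative_eq_intros simp: bump_def algebra_simps simp del: power_inverse,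
         metis power_eq_if One_nat_def)
  then show ?thesis
    by (rule has_field_derivative_transform_within_open[where S="{0<..}"])
       (use greater in \<open>auto simp: bump_def\<close>)
next
  case equal
  have "((\<lambda>t. inverse t ^ Suc n / exp (inverse t)) \<longlongrightarrow> 0) (at_right (0 :: real))"
    by (rule filterlim_compose[OF tendsto_power_div_exp_0 filterlim_inverse_at_top_right])
  then have "((\<lambda>t. bump n t / t) \<longlongrightarrow> 0) (at_right 0)"
    by (rule Lim_transform_eventually)
       (auto simp: eventually_at_right_less bump_def exp_minus field_simps
         intro!: eventually_mono[OF eventually_at_right_less])
  moreover have "((\<lambda>t. bump n t / t) \<longlongrightarrow> 0) (at_left 0)"
    by (rule tendsto_eventually) (auto simp: bump_def eventually_at_filter)
  ultimately have "((\<lambda>t. bump n t / t) \<longlongrightarrow> 0) (at 0)"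
    by (simp add: filterlim_split_at)
  then show ?thesis using equal by (simp add: has_field_derivative_iff bump_def)
qed

lemma Ck_bump: "Ck k (bump n)"
proof (induction k arbitrary: n)
  case 0
  show ?case
    using bump_has_field_derivative[of n] by (auto intro!: DERIV_continuous_on)
next
  case (Suc k)
  have "(bump n has_derivative (\<lambda>v. (bump (n + 2) t + (- real n) * bump (Suc n) t) * v)) (at t)" for t
    using bump_has_field_derivative[of n t] by (simp add: has_field_derivative_def)
  then show ?case by (rule Ck_SucI) (intro Ck_mult Ck_add Ck_const Suc)
qed

lemma smooth_bump: "smooth (bump n)"
  by (simp add: smooth_def Ck_bump)

lemma smooth_bump_compose [smooth_intros]: "smooth f \<Longrightarrow> smooth (\<lambda>x. bump n (f x))"
  by (rule smooth_compose_real[OF smooth_bump])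

lemma dd_bump_compose:
  "smooth f \<Longrightarrow> dd v (\<lambda>x. bump n (f x)) x = (bump (n + 2) (f x) - real n * bump (Suc n) (f x)) * dd v f x"
  using dd_compose_real[OF smooth_bump, of f v n x]
    dd_eqI[OF has_field_derivative_imp_has_derivative[OF bump_has_field_derivative[of n "f x"]], of 1]
  by simp

lemma bump_bounded: "\<exists>B\<ge>0. \<forall>t\<le>T. bump n t \<le> B"
proof -
  have "bounded (bump n ` {0..T})"
    by (intro compact_imp_bounded compact_continuous_image smooth_continuous_on smooth_bump compact_Icc)
  then obtain B where "\<forall>t\<in>{0..T}. bump n t \<le> B"
    unfolding bounded_iff by (metis abs_le_D1 image_eqI real_norm_def)
  then have "bump n t \<le> max 0 B" if "t \<le> T" for t
    using that by (cases "0 \<le> t") (auto simp: bump_def le_max_iff_disj)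
  then show ?thesis by (meson max.cobounded1)
qed

section \<open>Differentiation under the integral sign\<close>

text \<open>The derivative along \<open>h\<close> is a combination of the partial derivatives, which is why a bound on these suffices.\<close>
lemma mean_value_bound:
  fixes f :: "'a::euclidean_space \<Rightarrow> real" and B :: real
  assumes df: "\<And>y. f differentiable at y"
    and B: "\<And>b y. b \<in> Basis \<Longrightarrow> norm (y - x) \<le> norm h \<Longrightarrow> \<bar>dd b f y\<bar> \<le> B"
  shows "\<bar>f (x + h) - f x\<bar> \<le> DIM('a) * B * norm h" "\<bar>dd h f x\<bar> \<le> DIM('a) * B * norm h"
proof -
  have lin: "linear (\<lambda>v. dd v f y)" for y
    using has_derivative_linear[OF has_derivative_dd[OF df]] .
  have *: "\<bar>dd h f y\<bar> \<le> DIM('a) * B * norm h" if y: "norm (y - x) \<le> norm h" for y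
  proof -
    have "dd h f y = dd (\<Sum>b\<in>Basis. (h \<bullet> b) *\<^sub>R b) f y"
      by (simp add: euclidean_representation)
    also have "\<dots> = (\<Sum>b\<in>Basis. (h \<bullet> b) * dd b f y)"
      by (simp add: linear_sum[OF lin] linear_cmul[OF lin])
    also have "\<bar>\<dots>\<bar> \<le> (\<Sum>b\<in>(Basis::'a set). norm h * B)"
      by (intro sum_abs[THEN order_trans] sum_mono)
         (auto simp: abs_mult intro!: mult_mono Basis_le_norm B y)
    finally show ?thesis by (simp add: mult_ac)
  qed
  show "\<bar>dd h f x\<bar> \<le> DIM('a) * B * norm h" by (rule *) simp
  have "((\<lambda>t. f (x + t *\<^sub>R h)) has_derivative (\<lambda>s. dd (s *\<^sub>R h) f (x + t *\<^sub>R h))) (at t within {0..1})" for t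
    by (rule has_derivative_compose[where f="\<lambda>t. x + t *\<^sub>R h", OF _ has_derivative_dd[OF df]])
       (auto intro!: derivative_eq_intros)
  from mvt_very_simple[OF zero_le_one this] obtain t :: real
    where "t \<in> {0..1}" "f (x + h) - f x = dd h f (x + t *\<^sub>R h)" by auto
  then show "\<bar>f (x + h) - f x\<bar> \<le> DIM('a) * B * norm h"
    using *[of "x + t *\<^sub>R h"] by (auto simp: mult_left_le_one_le)
qed

text \<open>\<open>Ck k\<close> with derivatives up to order \<open>k\<close> of polynomial growth of order \<open>N\<close>. This covers the two kernels that are
convolved with densities: compactly supported ones (\<open>N = 0\<close>) and the polynomial interaction potential, where
\<open>N\<close> is its degree and the density has finite moments of order \<open>N\<close>.\<close>
primrec tame :: "nat \<Rightarrow> nat \<Rightarrow> ('a::euclidean_space \<Rightarrow> real) \<Rightarrow> bool" where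
  "tame N 0 f \<longleftrightarrow> continuous_on UNIV f \<and> (\<exists>C. \<forall>x. \<bar>f x\<bar> \<le> C * (1 + norm x) ^ N)"
| "tame N (Suc k) f \<longleftrightarrow> (\<forall>x. f differentiable at x) \<and>
     (\<exists>C. \<forall>x. \<bar>f x\<bar> \<le> C * (1 + norm x) ^ N) \<and> (\<forall>v. tame N k (dd v f))"

lemma tame_bound: "tame N k f \<Longrightarrow> \<exists>C. \<forall>x. \<bar>f x\<bar> \<le> C * (1 + norm x) ^ N"
  by (cases k) auto

lemma tame_imp_Ck: "tame N k f \<Longrightarrow> Ck k f"
  by (induction k arbitrary: f) (auto simp: Ck_Suc_dd)

declare tame.simps(2) [simp del]

lemma tame_imp_tame_0: "tame N k f \<Longrightarrow> tame N 0 f"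
proof -
  assume f: "tame N k f"
  have "Ck k f \<Longrightarrow> Ck 0 f" by (induction k) (blast dest: Ck_SucD)+
  with f tame_bound[OF f] tame_imp_Ck[OF f] show ?thesis by simp
qed

lemma tame_imp_tame_1:
  assumes "tame N (Suc k) f" shows "tame N (Suc 0) f"
  using assms tame_imp_tame_0 unfolding tame.simps(2) by blast

lemma one_plus_norm_diff_le: "1 + norm (x - y) \<le> (1 + norm x) * (1 + norm (y :: 'a::real_normed_vector))"
proof -
  have "(1 + norm x) * (1 + norm y) = 1 + norm x + norm y + norm x * norm y"
    by (simp add: algebra_simps)
  moreover have "0 \<le> norm x * norm y" by simp
  ultimately show ?thesis using norm_triangle_ineq4[of x y] by linarith
qed

text \<open>The shift \<open>T\<close> is the identity for convolutions on phase space and the position projection for convolutions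
with the position marginal. Since \<open>1 + |x - y| \<le> (1 + |x|) (1 + |y|)\<close>, the moment assumption dominates the shifted
kernel and its derivatives, locally uniformly in \<open>x\<close>.\<close>
context
  fixes M :: "'b measure" and T :: "'b \<Rightarrow> 'a::euclidean_space" and \<rho> :: "'b \<Rightarrow> real" and N :: nat
  assumes T [measurable]: "T \<in> borel_measurable M" and \<rho> [measurable]: "\<rho> \<in> borel_measurable M"
    and moment: "integrable M (\<lambda>z. \<rho> z * (1 + norm (T z)) ^ N)"
begin

lemma integrable_shifted_kernel:
  assumes "tame N 0 f"
  shows "integrable M (\<lambda>z. \<rho> z * f (x - T z))"
proof -
  from assms obtain C where C: "\<And>y. \<bar>f y\<bar> \<le> C * (1 + norm y) ^ N" by auto
  have "0 \<le> C" using C[of 0] by simp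
  have [measurable]: "f \<in> borel_measurable borel"
    using assms by (simp add: borel_measurable_continuous_onI)
  show ?thesis
  proof (rule Bochner_Integration.integrable_bound)
    show "integrable M (\<lambda>z. C * (1 + norm x) ^ N * (\<rho> z * (1 + norm (T z)) ^ N))"
      by (intro integrable_mult_right moment)
    have "(1 + norm (x - T z)) ^ N \<le> (1 + norm x) ^ N * (1 + norm (T z)) ^ N" for z
      unfolding power_mult_distrib[symmetric] by (intro power_mono one_plus_norm_diff_le) auto
    then have "\<bar>f (x - T z)\<bar> \<le> C * ((1 + norm x) ^ N * (1 + norm (T z)) ^ N)" for z
      using C[of "x - T z"] \<open>0 \<le> C\<close> by (meson mult_left_mono order_trans)
    from mult_left_mono[OF this abs_ge_zero[of "\<rho> z" for z]]
    show "AE z in M. norm (\<rho> z * f (x - T z)) \<le> norm (C * (1 + norm x) ^ N * (\<rho> z * (1 + norm (T z)) ^ N))"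
      using \<open>0 \<le> C\<close> by (simp add: abs_mult mult_ac power_abs)
  qed measurable
qed

lemma has_derivative_shifted_kernel:
  assumes f: "tame N (Suc 0) f"
  shows "((\<lambda>x. LINT z|M. \<rho> z * f (x - T z)) has_derivative
          (\<lambda>v. LINT z|M. \<rho> z * dd v f (x - T z))) (at x)"
proof -
  from f have diff: "f differentiable at y" and tdd: "tame N 0 (dd v f)" for y v
    unfolding tame.simps(2) by blast+
  from tame_imp_tame_0[OF f] have f0: "tame N 0 f" .
  have "\<forall>b. \<exists>C. \<forall>y. \<bar>dd b f y\<bar> \<le> C * (1 + norm y) ^ N"
    using tdd by auto
  then obtain C where C: "\<And>b y. \<bar>dd b f y\<bar> \<le> C b * (1 + norm y) ^ N" by metis
  define K where "K = (\<Sum>b\<in>(Basis::'a set). \<bar>C b\<bar>)"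
  have K: "\<bar>dd b f y\<bar> \<le> K * (1 + norm y) ^ N" if "b \<in> Basis" for b y
  proof -
    have "\<bar>C b\<bar> \<le> K" unfolding K_def by (rule member_le_sum) (use that in auto)
    then show ?thesis using C[of b y]
      by (meson abs_ge_self mult_right_mono norm_ge_zero order_trans zero_le_power add_nonneg_nonneg zero_le_one)
  qed
  have "0 \<le> K" by (simp add: K_def sum_nonneg)
  \<comment> \<open>The factor \<open>2 + norm x\<close> leaves room for increments \<open>h\<close> of norm at most \<open>1\<close>.\<close>
  define W where "W z = 2 * DIM('a) * (K * (2 + norm x) ^ N * (1 + norm (T z)) ^ N)" for z
  let ?I = "\<lambda>v. LINT z|M. \<rho> z * dd v f (x - T z)"
  let ?E = "\<lambda>h z. f (x + h - T z) - f (x - T z) - dd h f (x - T z)"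
  \<comment> \<open>The remainder is cut off at \<open>norm h \<le> 1\<close>, so that it is dominated for every \<open>h\<close>.\<close>
  let ?R = "\<lambda>h z. if norm h \<le> 1 then \<rho> z * (?E h z / norm h) else 0"
  have lin: "linear (\<lambda>v. dd v f y)" for y
    using has_derivative_linear[OF has_derivative_dd[OF diff]] .
  have [measurable]: "f \<in> borel_measurable borel" "dd v f \<in> borel_measurable borel" for v
    using f0 tdd by (auto simp: borel_measurable_continuous_onI)
  have bound: "\<bar>?E h z\<bar> \<le> W z * norm h" if h: "norm h \<le> 1" for h z
  proof -
    have "\<bar>dd b f y\<bar> \<le> K * (2 + norm x) ^ N * (1 + norm (T z)) ^ N"
      if b: "b \<in> Basis" and y: "norm (y - (x - T z)) \<le> norm h" for b y
    proof -
      have "norm y \<le> norm (x - T z) + 1"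
        using y h norm_triangle_ineq2[of y "x - T z"] by linarith
      moreover have "(2 + norm x) * (1 + norm (T z)) = (1 + norm x) * (1 + norm (T z)) + 1 + norm (T z)"
        by (simp add: algebra_simps)
      ultimately have "1 + norm y \<le> (2 + norm x) * (1 + norm (T z))"
        using one_plus_norm_diff_le[of x "T z"] norm_ge_zero[of "T z"] by linarith
      then have "(1 + norm y) ^ N \<le> (2 + norm x) ^ N * (1 + norm (T z)) ^ N"
        unfolding power_mult_distrib[symmetric] by (intro power_mono) auto
      then show ?thesis
        using K[OF b, of y] \<open>0 \<le> K\<close> by (metis mult.assoc mult_left_mono order_trans)
    qed
    from mean_value_bound[OF diff this, where x="x - T z" and h=h] show ?thesis
      by (simp add: W_def algebra_simps)
  qed
  have Wint: "integrable M (\<lambda>z. \<bar>\<rho> z\<bar> * W z)"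
  proof -
    have "integrable M (\<lambda>z. 2 * DIM('a) * (K * (2 + norm x) ^ N) * \<bar>\<rho> z * (1 + norm (T z)) ^ N\<bar>)"
      by (intro integrable_mult_right integrable_abs moment)
    then show ?thesis by (simp add: W_def abs_mult mult_ac power_abs)
  qed
  have W0: "0 \<le> W z" for z using \<open>0 \<le> K\<close> by (simp add: W_def)
  have "((\<lambda>h. LINT z|M. ?R h z) \<longlongrightarrow> (LINT z|M. 0)) (at 0)"
    unfolding tendsto_at_iff_sequentially comp_def
  proof (intro allI impI)
    fix X :: "nat \<Rightarrow> 'a" assume X: "\<forall>n. X n \<in> UNIV - {0}" "X \<longlonglongrightarrow> 0"
    show "(\<lambda>n. LINT z|M. ?R (X n) z) \<longlonglongrightarrow> (LINT z|M. 0)"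
    proof (rule integral_dominated_convergence[OF _ _ Wint])
      show "AE z in M. (\<lambda>n. ?R (X n) z) \<longlonglongrightarrow> 0"
      proof (rule AE_I2)
        fix z
        have "((\<lambda>h. norm (f (x - T z + h) - f (x - T z) - dd h f (x - T z)) / norm h) \<longlongrightarrow> 0) (at 0)"
          using has_derivative_dd[OF diff, of "x - T z"] unfolding has_derivative_at by blast
        with X have "(\<lambda>n. norm (f (x - T z + X n) - f (x - T z) - dd (X n) f (x - T z)) / norm (X n)) \<longlonglongrightarrow> 0"
          unfolding tendsto_at_iff_sequentially comp_def by blast
        then have "(\<lambda>n. \<bar>?E (X n) z / norm (X n)\<bar>) \<longlonglongrightarrow> 0"
          by (simp add: algebra_simps)
        then have "(\<lambda>n. ?E (X n) z / norm (X n)) \<longlonglongrightarrow> 0" by (simp only: tendsto_rabs_zero_iff)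
        then have "(\<lambda>n. \<rho> z * (?E (X n) z / norm (X n))) \<longlonglongrightarrow> 0" by (rule tendsto_mult_right_zero)
        moreover have "\<forall>\<^sub>F n in sequentially. norm (X n) < 1"
          using X(2) unfolding tendsto_iff by (auto dest!: spec[of _ 1])
        ultimately show "(\<lambda>n. ?R (X n) z) \<longlonglongrightarrow> 0"
          by (auto elim!: Lim_transform_eventually eventually_mono)
      qed
      have "norm (?R h z) \<le> \<bar>\<rho> z\<bar> * W z" for h z
      proof (cases "h \<noteq> 0 \<and> norm h \<le> 1")
        case True
        then have "\<bar>?E h z\<bar> / norm h \<le> W z" using bound[of h z] by (simp add: pos_divide_le_eq)
        then show ?thesis using True mult_left_mono[of "\<bar>?E h z\<bar> / norm h" "W z" "\<bar>\<rho> z\<bar>"]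
          by (simp add: abs_mult)
      qed (use W0 in auto)
      then show "AE z in M. norm (?R (X n) z) \<le> \<bar>\<rho> z\<bar> * W z" for n by blast
    qed measurable
  qed
  then have lim: "((\<lambda>h. \<bar>LINT z|M. ?R h z\<bar>) \<longlongrightarrow> 0) (at 0)"
    by (simp add: tendsto_rabs_zero_iff)
  have I: "integrable M (\<lambda>z. \<rho> z * f (y - T z))" "integrable M (\<lambda>z. \<rho> z * dd v f (y - T z))" for y v
    by (intro integrable_shifted_kernel f0 tdd)+
  have blin: "bounded_linear ?I"
    unfolding linear_conv_bounded_linear[symmetric]
    by (rule linearI) (simp_all add: linear_add[OF lin] linear_cmul[OF lin] distrib_left I mult_ac)
  have "\<bar>LINT z|M. ?R h z\<bar> = norm ((LINT z|M. \<rho> z * f (x + h - T z)) - (LINT z|M. \<rho> z * f (x - T z)) - ?I h) / norm h"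
    if "norm h \<le> 1" for h
  proof -
    have "(LINT z|M. ?R h z) = (LINT z|M. (\<rho> z * f (x + h - T z) - \<rho> z * f (x - T z) - \<rho> z * dd h f (x - T z)) / norm h)"
      using that by (intro Bochner_Integration.integral_cong) (auto simp: algebra_simps diff_divide_distrib)
    also have "\<dots> = ((LINT z|M. \<rho> z * f (x + h - T z)) - (LINT z|M. \<rho> z * f (x - T z)) - ?I h) / norm h"
      by (simp add: I Bochner_Integration.integral_diff)
    finally show ?thesis by simp
  qed
  note eq = this
  have "\<forall>\<^sub>F h :: 'a in at 0. norm h \<le> 1" unfolding eventually_at by (intro exI[of _ 1]) auto
  then have "\<forall>\<^sub>F h in at 0. \<bar>LINT z|M. ?R h z\<bar> =
      norm ((LINT z|M. \<rho> z * f (x + h - T z)) - (LINT z|M. \<rho> z * f (x - T z)) - ?I h) / norm h"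
    by (rule eventually_mono) (rule eq)
  from Lim_transform_eventually[OF lim this] blin show ?thesis
    unfolding has_derivative_at by blast
qed

lemma Ck_shifted_kernel:
  "tame N (Suc k) f \<Longrightarrow> Ck k (\<lambda>x. LINT z|M. \<rho> z * f (x - T z))"
proof (induction k arbitrary: f)
  case 0
  show ?case
    unfolding Ck.simps
    by (rule has_derivative_continuous_on, rule has_derivative_shifted_kernel[OF 0])
next
  case (Suc k)
  have "tame N (Suc k) (dd v f)" for v
    using Suc.prems unfolding tame.simps(2)[of N "Suc k"] by blast
  from has_derivative_shifted_kernel[OF tame_imp_tame_1[OF Suc.prems]] Suc.IH[OF this] show ?case
    by (rule Ck_SucI)
qed

lemma smooth_shifted_kernel:
  assumes "\<And>k. tame N k f"
  shows "smooth (\<lambda>x. LINT z|M. \<rho> z * f (x - T z))"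
    "dd v (\<lambda>x. LINT z|M. \<rho> z * f (x - T z)) = (\<lambda>x. LINT z|M. \<rho> z * dd v f (x - T z))"
  unfolding smooth_def
  using Ck_shifted_kernel[OF assms] dd_eqI[OF has_derivative_shifted_kernel[OF assms]] by blast+

end

lemma tame_SucD: "tame N (Suc k) f \<Longrightarrow> tame N k f"
proof (induction k arbitrary: f)
  case 0
  then show ?case by (rule tame_imp_tame_0)
next
  case (Suc k)
  then show ?case unfolding tame.simps(2)[of N "Suc k"] tame.simps(2)[of N k f] by blast
qed

lemma tame_const: "tame N k (\<lambda>_ :: 'a::euclidean_space. c)"
proof (induction k arbitrary: c)
  case 0
  have "\<bar>c\<bar> * 1 \<le> \<bar>c\<bar> * (1 + norm x) ^ N" for x :: 'a
    by (intro mult_left_mono one_le_power) auto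
  then show ?case by auto
next
  case (Suc k)
  have "dd v (\<lambda>_ :: 'a. c) = (\<lambda>_. 0)" for v by auto
  then show ?case using Suc[of 0] tame_bound[OF Suc[of c]] by (simp add: tame.simps(2))
qed

lemma tame_add:
  fixes f g :: "'a::euclidean_space \<Rightarrow> real"
  shows "tame N k f \<Longrightarrow> tame N k g \<Longrightarrow> tame N k (\<lambda>x. f x + g x)"
proof (induction k arbitrary: f g)
  have bound: "\<exists>C. \<forall>x. \<bar>f x + g x\<bar> \<le> C * (1 + norm x) ^ N"
    if f: "tame N k f" and g: "tame N k g" for f g :: "'a \<Rightarrow> real" and k
  proof -
    from tame_bound[OF f] tame_bound[OF g] obtain C D
      where CD: "\<And>x. \<bar>f x\<bar> \<le> C * (1 + norm x) ^ N" "\<And>x. \<bar>g x\<bar> \<le> D * (1 + norm x) ^ N" by blast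
    have "\<bar>f x + g x\<bar> \<le> (C + D) * (1 + norm x) ^ N" for x
      using abs_triangle_ineq[of "f x" "g x"] CD[of x] by (simp add: distrib_right)
    then show ?thesis by blast
  qed
  {
    case 0
    with bound[OF this] show ?case by (simp add: continuous_on_add)
  next
    case (Suc k)
    then have d: "f differentiable at x" "g differentiable at x"
      and t: "tame N k (dd v f)" "tame N k (dd v g)" for x v
      unfolding tame.simps(2) by blast+
    have "dd v (\<lambda>x. f x + g x) = (\<lambda>x. dd v f x + dd v g x)" for v
      using dd_eqI[OF has_derivative_add[OF has_derivative_dd has_derivative_dd]] d by blast
    with bound[OF Suc.prems] Suc.IH[OF t] d show ?case by (simp add: tame.simps(2))
  }
qed

lemma tame_mult:
  fixes f g :: "'a::euclidean_space \<Rightarrow> real"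
  shows "tame N k f \<Longrightarrow> tame L k g \<Longrightarrow> tame (N + L) k (\<lambda>x. f x * g x)"
proof (induction k arbitrary: f g)
  have bound: "\<exists>C. \<forall>x. \<bar>f x * g x\<bar> \<le> C * (1 + norm x) ^ (N + L)"
    if f: "tame N k f" and g: "tame L k g" for f g :: "'a \<Rightarrow> real" and k
  proof -
    from tame_bound[OF f] tame_bound[OF g] obtain C D
      where CD: "\<And>x. \<bar>f x\<bar> \<le> C * (1 + norm x) ^ N" "\<And>x. \<bar>g x\<bar> \<le> D * (1 + norm x) ^ L" by blast
    have "\<bar>f x * g x\<bar> \<le> (C * D) * (1 + norm x) ^ (N + L)" for x
      using mult_mono'[OF CD(1)[of x] CD(2)[of x]] by (simp add: abs_mult power_add mult_ac)
    then show ?thesis by blast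
  qed
  {
    case 0
    with bound[OF this] show ?case by (simp add: continuous_on_mult)
  next
    case (Suc k)
    then have d: "f differentiable at x" "g differentiable at x"
      and t: "tame N k (dd v f)" "tame L k (dd v g)" for x v
      unfolding tame.simps(2) by blast+
    have eq: "dd v (\<lambda>x. f x * g x) = (\<lambda>x. f x * dd v g x + dd v f x * g x)" for v
      using dd_eqI[OF has_derivative_mult[OF has_derivative_dd has_derivative_dd]] d by blast
    have "tame (N + L) k (dd v (\<lambda>x. f x * g x))" for v
      unfolding eq by (intro tame_add Suc.IH t Suc.prems[THEN tame_SucD])
    with bound[OF Suc.prems] d show ?case by (simp add: tame.simps(2))
  }
qed

section \<open>Compactly supported smooth functions\<close>

definition Cc_smooth :: "('a::real_normed_vector \<Rightarrow> real) \<Rightarrow> bool" where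
  "Cc_smooth f \<longleftrightarrow> smooth f \<and> bounded {x. f x \<noteq> 0}"

lemma test_function_iff_Cc_smooth: "test_function \<phi> \<longleftrightarrow> Cc_smooth \<phi>"
  by (simp add: test_function_def Cc_smooth_def)

lemma Cc_smoothD: "Cc_smooth f \<Longrightarrow> smooth f"
  by (simp add: Cc_smooth_def)

lemma Cc_smooth_support:
  assumes "Cc_smooth f" obtains R where "\<And>x. R < norm x \<Longrightarrow> f x = 0"
  using assms unfolding Cc_smooth_def bounded_iff by (metis (mono_tags) mem_Collect_eq not_less)

lemma Cc_smoothI:
  assumes "smooth f" "\<And>x. R < norm x \<Longrightarrow> f x = 0" shows "Cc_smooth f"
  unfolding Cc_smooth_def bounded_iff using assms by (auto intro!: exI[of _ R] simp: not_less[symmetric])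

lemma Cc_smooth_mult_left:
  assumes "smooth g" "Cc_smooth f" shows "Cc_smooth (\<lambda>x. g x * f x)"
  using assms unfolding Cc_smooth_def by (auto intro!: smooth_intros elim!: bounded_subset)

lemma Cc_smooth_mult_right:
  assumes "Cc_smooth f" "smooth g" shows "Cc_smooth (\<lambda>x. f x * g x)"
  using Cc_smooth_mult_left[OF assms(2,1)] by (simp add: mult.commute)

lemma Cc_smooth_add:
  assumes "Cc_smooth f" "Cc_smooth g" shows "Cc_smooth (\<lambda>x. f x + g x)"
proof -
  have "bounded ({x. f x \<noteq> 0} \<union> {x. g x \<noteq> 0})" using assms by (simp add: Cc_smooth_def)
  then have "bounded {x. f x + g x \<noteq> 0}" by (rule bounded_subset) auto
  with assms show ?thesis by (simp add: Cc_smooth_def smooth_intros)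
qed

lemma Cc_smooth_zero: "Cc_smooth (\<lambda>_. 0)"
  by (simp add: Cc_smooth_def smooth_intros)

lemma Cc_smooth_sum:
  "(\<And>i. i \<in> I \<Longrightarrow> Cc_smooth (f i)) \<Longrightarrow> Cc_smooth (\<lambda>x. \<Sum>i\<in>I. f i x)"
  by (induction I rule: infinite_finite_induct) (auto intro!: Cc_smooth_add Cc_smooth_zero)

lemma Cc_smooth_diff:
  "Cc_smooth f \<Longrightarrow> Cc_smooth g \<Longrightarrow> Cc_smooth (\<lambda>x. f x - g x)"
  using Cc_smooth_add[OF _ Cc_smooth_mult_left[OF smooth_const[of "-1"]], of f g] by simp

lemma dd_eq_0_outside:
  assumes f: "\<And>x. R < norm x \<Longrightarrow> f x = 0" and x: "R < norm x"
  shows "dd v f x = 0"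
proof (rule dd_eqI)
  show "(f has_derivative (\<lambda>_. 0)) (at x)"
  proof (rule has_derivative_transform_within_open[where f="\<lambda>_. 0" and s="{x. R < norm x}"])
    show "open {x :: 'a. R < norm x}" by (intro open_Collect_less continuous_intros)
  qed (use x f in auto)
qed

lemma Cc_smooth_dd:
  assumes "Cc_smooth f" shows "Cc_smooth (dd v f)"
proof -
  obtain R where R: "\<And>x. R < norm x \<Longrightarrow> f x = 0"
    using Cc_smooth_support[OF assms] by blast
  show ?thesis
    by (rule Cc_smoothI[OF smooth_dd[OF Cc_smoothD[OF assms]] dd_eq_0_outside[OF R]])
qed

lemma Cc_smooth_translate:
  assumes "Cc_smooth f" shows "Cc_smooth (\<lambda>x. f (x + c))"
proof -
  obtain R where R: "\<And>x. R < norm x \<Longrightarrow> f x = 0"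
    using Cc_smooth_support[OF assms] by blast
  have "f (x + c) = 0" if "R + norm c < norm x" for x
    using norm_triangle_ineq4[of "x + c" c] that by (intro R) simp
  then show ?thesis by (rule Cc_smoothI[OF smooth_translate[OF Cc_smoothD[OF assms]]])
qed

lemma Cc_smooth_reflect:
  assumes "Cc_smooth f" shows "Cc_smooth (\<lambda>x. f (c - x))"
proof -
  obtain R where R: "\<And>x. R < norm x \<Longrightarrow> f x = 0"
    using Cc_smooth_support[OF assms] by blast
  have "f (c - x) = 0" if "R + norm c < norm x" for x
    using norm_triangle_ineq2[of x c] that by (intro R) (simp add: norm_minus_commute)
  then show ?thesis by (rule Cc_smoothI[OF smooth_reflect[OF Cc_smoothD[OF assms]]])
qed

lemma continuous_bounded_on_cball:
  fixes g :: "'a::euclidean_space \<Rightarrow> real"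
  assumes "continuous_on UNIV g"
  shows "\<exists>B. \<forall>x. norm x \<le> R \<longrightarrow> \<bar>g x\<bar> \<le> B"
proof -
  have "bounded (g ` cball 0 R)"
    using assms by (intro compact_imp_bounded compact_continuous_image compact_cball) (rule continuous_on_subset, auto)
  then show ?thesis unfolding bounded_iff by (metis image_eqI mem_cball_0 real_norm_def)
qed

lemma Cc_smooth_bounded:
  fixes f :: "'a::euclidean_space \<Rightarrow> real"
  assumes "Cc_smooth f" shows "\<exists>B\<ge>0. \<forall>x. \<bar>f x\<bar> \<le> B"
proof -
  obtain R where R: "\<And>x. R < norm x \<Longrightarrow> f x = 0"
    using Cc_smooth_support[OF assms] by blast
  obtain B where B: "\<And>x. norm x \<le> R \<Longrightarrow> \<bar>f x\<bar> \<le> B"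
    using continuous_bounded_on_cball[OF smooth_continuous_on[OF Cc_smoothD[OF assms]]] by blast
  have "\<bar>f x\<bar> \<le> max 0 B" for x
    using B[of x] R[of x] by (cases "norm x \<le> R") auto
  then show ?thesis by (meson max.cobounded1)
qed

lemma Cc_smooth_integrable:
  fixes f :: "'a::euclidean_space \<Rightarrow> real"
  assumes "Cc_smooth f" shows "integrable lborel f"
proof -
  obtain R where R: "\<And>x. R < norm x \<Longrightarrow> f x = 0"
    using Cc_smooth_support[OF assms] by blast
  have "integrable lborel (\<lambda>x. indicator (cball 0 R) x *\<^sub>R f x)"
    by (intro borel_integrable_compact compact_cball smooth_continuous_on Cc_smoothD assms)
  moreover have "(\<lambda>x. indicator (cball 0 R) x *\<^sub>R f x) = f"
    using R by (fastforce simp: indicator_def not_le)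
  ultimately show ?thesis by simp
qed

text \<open>A bounded function has growth of every order, since \<open>1 + norm x\<close> is at least \<open>1\<close>.\<close>
lemma Cc_smooth_tame: "Cc_smooth f \<Longrightarrow> tame N k f"
proof (induction k arbitrary: f)
  have bound: "\<exists>C. \<forall>x. \<bar>f x\<bar> \<le> C * (1 + norm x) ^ N" if f: "Cc_smooth f" for f :: "'a \<Rightarrow> real"
  proof -
    from Cc_smooth_bounded[OF f] obtain B where B: "0 \<le> B" "\<And>x. \<bar>f x\<bar> \<le> B" by blast
    have "B * 1 \<le> B * (1 + norm x) ^ N" for x :: 'a
      by (intro mult_left_mono one_le_power B(1)) simp
    with B(2) show ?thesis by (metis mult.right_neutral order_trans)
  qed
  {
    case 0
    with bound show ?case by (simp add: smooth_continuous_on Cc_smoothD)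
  next
    case (Suc k)
    then show ?case unfolding tame.simps(2)
      using bound Cc_smooth_dd differentiableI[OF smooth_has_derivative[OF Cc_smoothD]] by blast
  }
qed

section \<open>Convolution and integration by parts\<close>
definition locally_integrable :: "('a::euclidean_space \<Rightarrow> real) \<Rightarrow> bool" where
  "locally_integrable F \<longleftrightarrow> F \<in> borel_measurable borel \<and>
     (\<forall>R. integrable lborel (\<lambda>z. indicator (cball 0 R) z * F z))"

lemma locally_integrable_mult_continuous:
  assumes F: "locally_integrable F" and g: "continuous_on UNIV g"
  shows "locally_integrable (\<lambda>z. F z * g z)"
  unfolding locally_integrable_def
proof (intro conjI allI)
  have [measurable]: "F \<in> borel_measurable borel" "g \<in> borel_measurable borel"
    using F g by (auto simp: locally_integrable_def borel_measurable_continuous_onI)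
  have [measurable]: "cball (0::'a) R \<in> sets borel" for R by simp
  show "(\<lambda>z. F z * g z) \<in> borel_measurable borel" by measurable
  fix R
  obtain B where B: "\<And>x. norm x \<le> R \<Longrightarrow> \<bar>g x\<bar> \<le> B"
    using continuous_bounded_on_cball[OF g] by blast
  show "integrable lborel (\<lambda>z. indicator (cball 0 R) z * (F z * g z))"
  proof (rule Bochner_Integration.integrable_bound)
    show "integrable lborel (\<lambda>z. B * (indicator (cball 0 R) z * F z))"
      using F unfolding locally_integrable_def by (intro integrable_mult_right) blast
    have "\<bar>g z\<bar> * \<bar>F z\<bar> \<le> \<bar>B\<bar> * \<bar>F z\<bar>" if "norm z \<le> R" for z
      using B[OF that] by (intro mult_right_mono) auto
    then show "AE z in lborel. norm (indicator (cball 0 R) z * (F z * g z))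
        \<le> norm (B * (indicator (cball 0 R) z * F z))"
      by (auto simp: indicator_def abs_mult mult_ac)
  qed simp
qed

lemma locally_integrable_Cc_mult:
  assumes F: "locally_integrable F" and f: "Cc_smooth f"
  shows "integrable lborel (\<lambda>z. F z * f z)"
proof -
  obtain R where R: "\<And>x. R < norm x \<Longrightarrow> f x = 0"
    using Cc_smooth_support[OF f] by blast
  have "integrable lborel (\<lambda>z. indicator (cball 0 R) z * (F z * f z))"
    using locally_integrable_mult_continuous[OF F smooth_continuous_on[OF Cc_smoothD[OF f]]]
    unfolding locally_integrable_def by blast
  moreover have "(\<lambda>z. indicator (cball 0 R) z * (F z * f z)) = (\<lambda>z. F z * f z)"
    using R by (fastforce simp: indicator_def not_le)
  ultimately show ?thesis by simp
qed

definition convol :: "('a::euclidean_space \<Rightarrow> real) \<Rightarrow> ('a \<Rightarrow> real) \<Rightarrow> 'a \<Rightarrow> real" where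
  "convol F k = (\<lambda>x. LINT z|lborel. F z * k (x - z))"

text \<open>Near \<open>x\<close> only the values of \<open>F\<close> on a fixed ball enter the convolution with a compactly supported kernel, so \<open>F\<close>
may be replaced by an integrable function.\<close>
lemma has_derivative_convolution:
  fixes F :: "'a::euclidean_space \<Rightarrow> real"
  assumes F: "locally_integrable F" and k: "Cc_smooth k"
  shows "(convol F k has_derivative (\<lambda>v. convol F (dd v k) x)) (at x)"
proof -
  obtain R where R: "\<And>y. R < norm y \<Longrightarrow> k y = 0"
    using Cc_smooth_support[OF k] by blast
  define S where "S = R + norm x + 1"
  define G where "G z = indicator (cball 0 S) z * F z" for z
  have "integrable lborel G" using F by (simp add: locally_integrable_def G_def[abs_def])
  then have "G \<in> borel_measurable lborel" and "integrable lborel (\<lambda>z. G z * (1 + norm z) ^ 0)"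
    by simp_all
  from has_derivative_shifted_kernel[OF _ this Cc_smooth_tame[OF k]]
  have *: "((\<lambda>x. LINT z|lborel. G z * k (x - z)) has_derivative
          (\<lambda>v. LINT z|lborel. G z * dd v k (x - z))) (at x)" by simp
  have cut: "G z * k (y - z) = F z * k (y - z)" if "y \<in> ball x 1" for y z
  proof (cases "norm z \<le> S")
    case False
    have "norm (y - z) > R"
      using False that norm_triangle_ineq2[of z y] norm_triangle_ineq2[of y x]
      by (simp add: S_def dist_norm norm_minus_commute)
    with R show ?thesis by simp
  qed (simp add: G_def)
  have cut': "G z * dd v k (x - z) = F z * dd v k (x - z)" for v z
  proof (cases "norm z \<le> S")
    case False
    have "norm (x - z) > R"
      using False norm_triangle_ineq2[of z x] by (simp add: S_def norm_minus_commute)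
    with dd_eq_0_outside[of R k, OF R] show ?thesis by simp
  qed (simp add: G_def)
  from * have "((\<lambda>x. LINT z|lborel. F z * k (x - z)) has_derivative
          (\<lambda>v. LINT z|lborel. G z * dd v k (x - z))) (at x)"
    by (rule has_derivative_transform_within_open[OF _ open_ball[of x 1]])
       (auto intro!: Bochner_Integration.integral_cong simp: cut)
  then show ?thesis by (simp add: cut' convol_def)
qed

lemma smooth_convolution:
  assumes F: "locally_integrable F" and k: "Cc_smooth k"
  shows "smooth (convol F k)"
  unfolding smooth_def
proof
  fix n
  show "Ck n (convol F k)"
    using k
  proof (induction n arbitrary: k)
    case 0
    show ?case unfolding Ck.simps
      by (rule has_derivative_continuous_on, rule has_derivative_convolution[OF F 0])
  next
    case (Suc n)
    from has_derivative_convolution[OF F Suc.prems] show ?case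
      by (rule Ck_SucI) (intro Suc.IH Cc_smooth_dd Suc.prems)
  qed
qed

lemma dd_convolution:
  assumes "locally_integrable F" "Cc_smooth k"
  shows "dd v (convol F k) = convol F (dd v k)"
  using dd_eqI[OF has_derivative_convolution[OF assms]] by blast

lemma lborel_integral_shift: "(LINT z|lborel. f (z + c)) = (LINT z|lborel. f (z :: 'a::euclidean_space) :: real)"
proof (cases "f \<in> borel_measurable borel")
  case True
  then have [measurable]: "f \<in> borel_measurable borel" .
  have "(LINT z|lborel. f z) = (LINT z|distr lborel borel ((+) c). f z)"
    by (simp add: lborel_distr_plus)
  also have "\<dots> = (LINT z|lborel. f (c + z))" by (subst integral_distr) auto
  finally show ?thesis by (simp add: add.commute)
next
  case False
  moreover have "(\<lambda>z. f (z + c)) \<notin> borel_measurable borel"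
  proof
    assume [measurable]: "(\<lambda>z. f (z + c)) \<in> borel_measurable borel"
    have "(\<lambda>z. (\<lambda>z. f (z + c)) (z - c)) \<in> borel_measurable borel" by measurable
    with False show False by simp
  qed
  ultimately show ?thesis
    by (metis borel_measurable_integrable measurable_lborel2 not_integrable_integral_eq)
qed

lemma locally_integrable_const: "locally_integrable (\<lambda>_. c)"
  unfolding locally_integrable_def
  using borel_integrable_compact[OF compact_cball continuous_on_const[of _ c]]
  by (auto simp: mult.commute)

text \<open>For a product \<open>F\<close> this is integration by parts. The integral of a translate of \<open>F\<close> does not depend on the translation;
differentiating it gives the claim.\<close>
lemma integral_dd_eq_0:
  fixes F :: "'a::euclidean_space \<Rightarrow> real"
  assumes F: "Cc_smooth F"
  shows "(LINT z|lborel. dd v F z) = 0"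
proof -
  have k: "Cc_smooth (\<lambda>y. F (0 - y))" by (rule Cc_smooth_reflect[OF F])
  have "(\<lambda>x. LINT z|lborel. 1 * F (0 - (x - z))) = (\<lambda>x. LINT z|lborel. F z)"
    using lborel_integral_shift[of F "- x" for x] by (simp add: algebra_simps)
  then have "dd v (convol (\<lambda>_. 1) (\<lambda>y. F (0 - y))) 0 = 0" by (simp add: convol_def)
  then show ?thesis
    using dd_convolution[OF locally_integrable_const k, of v 1]
    by (simp add: convol_def dd_reflect[OF Cc_smoothD[OF F], of v 0, simplified])
qed

text \<open>As a function of \<open>t\<close>, the left-hand side has derivative \<open>\<integral> F \<partial>_v \<psi>(z + t v) dz\<close>, where the translated function is
again a test function.\<close>
lemma weak_derivative_zero_translate:
  fixes F :: "'a::euclidean_space \<Rightarrow> real"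
  assumes F: "locally_integrable F"
    and zero: "\<And>\<psi>. Cc_smooth \<psi> \<Longrightarrow> (LINT z|lborel. F z * dd v \<psi> z) = 0"
    and \<psi>: "Cc_smooth \<psi>"
  shows "(LINT z|lborel. F z * \<psi> (z + t *\<^sub>R v)) = (LINT z|lborel. F z * \<psi> z)"
proof -
  let ?k = "\<lambda>y. \<psi> (0 - y)"
  have k: "Cc_smooth ?k" by (rule Cc_smooth_reflect[OF \<psi>])
  define g where "g s = (LINT z|lborel. F z * ?k ((- s) *\<^sub>R v - z))" for s :: real
  have "(g has_derivative (\<lambda>r. LINT z|lborel. F z * dd ((- r) *\<^sub>R v) ?k ((- s) *\<^sub>R v - z))) (at s)" for s
    unfolding g_def
    by (rule has_derivative_compose[OF _ has_derivative_convolution[OF F k, unfolded convol_def], where f="\<lambda>s. (- s) *\<^sub>R v"])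
       (auto intro!: derivative_eq_intros)
  moreover have "dd ((- r) *\<^sub>R v) ?k ((- s) *\<^sub>R v - z) = r * dd v (\<lambda>z. \<psi> (z + s *\<^sub>R v)) z" for r s z
    using Cc_smoothD[OF \<psi>] dd_reflect[of \<psi> v 0] dd_scaleR[OF Cc_smoothD[OF k], of "-r" v]
      dd_translate[of \<psi> v "s *\<^sub>R v" z]
    by (simp add: algebra_simps)
  moreover have "(LINT z|lborel. F z * (r * dd v (\<lambda>z. \<psi> (z + s *\<^sub>R v)) z)) = 0" for r s
    using zero[OF Cc_smooth_translate[OF \<psi>]] by (simp add: mult.left_commute[of _ r])
  ultimately have "(g has_derivative (\<lambda>r. 0)) (at s)" for s by simp
  then have "g t = g 0"
    using has_derivative_zero_unique[of UNIV g t 0] by (auto simp: has_derivative_at_withinI)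
  then show ?thesis by (simp add: g_def algebra_simps)
qed

section \<open>Mollifiers\<close>
lemma lborel_integral_reflect:
  fixes f :: "'a::euclidean_space \<Rightarrow> real"
  assumes [measurable]: "f \<in> borel_measurable borel"
  shows "(LINT z|lborel. f (c - z)) = (LINT z|lborel. f z)"
proof -
  have "(lborel :: 'a measure) = distr lborel borel (\<lambda>x. c - x)"
    using lborel_affine[of "-1" c] by (simp add: density_1)
  then have "(LINT z|lborel. f z) = (LINT z|distr lborel borel (\<lambda>x. c - x). f z)" by simp
  also have "\<dots> = (LINT z|lborel. f (c - z))" by (subst integral_distr) auto
  finally show ?thesis by simp
qed

lemma
  fixes f :: "'a::euclidean_space \<Rightarrow> real" and g :: "'b::euclidean_space \<Rightarrow> real"
  assumes f: "integrable lborel f" and g: "integrable lborel g"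
  shows integrable_lborel_product: "integrable (lborel \<Otimes>\<^sub>M lborel) (\<lambda>(x, y). f x * g y)"
    and integral_lborel_product:
      "(LINT z|lborel. f (fst z) * g (snd z)) = (LINT x|lborel. f x) * (LINT y|lborel. g y)"
proof -
  have [measurable]: "f \<in> borel_measurable borel" "g \<in> borel_measurable borel" using f g by auto
  show *: "integrable (lborel \<Otimes>\<^sub>M lborel) (\<lambda>(x, y). f x * g y)"
    by (rule lborel_pair.Fubini_integrable) (use f g in \<open>auto simp: abs_mult\<close>)
  show "(LINT z|lborel. f (fst z) * g (snd z)) = (LINT x|lborel. f x) * (LINT y|lborel. g y)"
    using lborel_pair.integral_fst'[OF *] by (simp add: lborel_prod case_prod_unfold)
qed

abbreviation qdir :: "'d::finite \<Rightarrow> 'd phase" where "qdir i \<equiv> (axis i 1, 0)"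
abbreviation pdir :: "'d::finite \<Rightarrow> 'd phase" where "pdir i \<equiv> (0, axis i 1)"

lemma normalized_bump:
  assumes "0 < e"
  obtains A :: "'a::euclidean_space \<Rightarrow> real" where "Cc_smooth A" "\<And>x. 0 \<le> A x"
    "\<And>x. A x \<noteq> 0 \<Longrightarrow> norm x \<le> e" "(LINT x|lborel. A x) = 1"
proof -
  define b where "b x = bump 0 (e\<^sup>2 - (norm x)\<^sup>2)" for x :: 'a
  have nz: "b x \<noteq> 0 \<longleftrightarrow> norm x < e" for x
    using assms abs_le_square_iff[of e "norm x"] by (auto simp: b_def bump_eq_0_iff not_le)
  have b: "Cc_smooth b"
  proof (rule Cc_smoothI)
    show "smooth b" unfolding b_def by (intro smooth_intros)
    show "b x = 0" if "e < norm x" for x using nz[of x] that by auto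
  qed
  have b0: "0 \<le> b x" for x by (simp add: b_def bump_nonneg)
  define I where "I = (LINT x|lborel. b x)"
  have "I \<noteq> 0"
  proof
    assume "I = 0"
    then have "AE x in lborel. b x = 0"
      unfolding I_def using integral_nonneg_eq_0_iff_AE[OF Cc_smooth_integrable[OF b]] b0 by simp
    moreover have "b x = 0 \<longleftrightarrow> x \<notin> ball 0 e" for x using nz[of x] by auto
    ultimately have "AE x in lborel. x \<notin> ball (0::'a) e" by (simp only:)
    then have "ball (0::'a) e \<in> null_sets lborel" using AE_iff_null_sets[of "ball (0::'a) e" lborel] by simp
    then have "measure lborel (ball (0::'a) e) = 0" by (auto simp: measure_def)
    then show False using content_ball_pos[OF assms, of "0::'a"] by simp
  qed
  moreover have "0 \<le> I" unfolding I_def by (rule integral_nonneg_AE) (simp add: b0)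
  ultimately have I: "0 < I" by simp
  show ?thesis
  proof
    show "Cc_smooth (\<lambda>x. inverse I * b x)" by (intro Cc_smooth_mult_left smooth_intros b)
    show "(LINT x|lborel. inverse I * b x) = 1" using I by (simp add: I_def[symmetric])
    show "0 \<le> inverse I * b x" for x using I b0 by simp
    show "norm x \<le> e" if "inverse I * b x \<noteq> 0" for x using nz[of x] that by auto
  qed
qed

text \<open>The last condition bounds the commutator of mollification with the free transport \<open>p \<cdot> \<nabla>_q\<close>: the convolution
kernel of that commutator is \<open>p_i \<partial>\<eta>/\<partial>q_i\<close>. It excludes isotropic rescalings of a single bump, for which this
integral does not become small.\<close>
definition mollifier :: "real \<Rightarrow> ('d::finite phase \<Rightarrow> real) \<Rightarrow> bool" where
  "mollifier e \<eta> \<longleftrightarrow> Cc_smooth \<eta> \<and> (\<forall>z. 0 \<le> \<eta> z) \<and> (\<forall>z. \<eta> z \<noteq> 0 \<longrightarrow> norm z \<le> e) \<and>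
     (LINT z|lborel. \<eta> z) = 1 \<and> (\<forall>i. (LINT z|lborel. \<bar>snd z $ i * dd (qdir i) \<eta> z\<bar>) \<le> e)"

text \<open>A product of a bump \<open>A\<close> in \<open>q\<close> of width \<open>e/2\<close> and a bump \<open>B\<close> in \<open>p\<close> of width \<open>\<delta>\<close>. The commutator kernel has integral
at most \<open>\<delta> \<integral> |\<partial>A/\<partial>q_i|\<close>, where the last factor depends on \<open>e\<close> only.\<close>
lemma mollifier_exists:
  assumes e: "0 < e"
  shows "\<exists>\<eta> :: 'd::finite phase \<Rightarrow> real. mollifier e \<eta>"
proof -
  obtain A :: "real^'d \<Rightarrow> real" where A: "Cc_smooth A" "\<And>x. 0 \<le> A x"
    "\<And>x. A x \<noteq> 0 \<Longrightarrow> norm x \<le> e / 2" "(LINT x|lborel. A x) = 1"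
    using normalized_bump[of "e / 2"] e by (metis half_gt_zero)
  define K where "K = (\<Sum>i\<in>UNIV. LINT x|lborel. \<bar>dd (axis i 1) A x\<bar>)"
  have "0 \<le> K" unfolding K_def by (intro sum_nonneg integral_nonneg_AE) simp
  define \<delta> where "\<delta> = min (e / 2) (e / (K + 1))"
  have \<delta>: "0 < \<delta>" "\<delta> \<le> e / 2" "\<delta> * K \<le> e"
  proof -
    show "0 < \<delta>" using e \<open>0 \<le> K\<close> by (simp add: \<delta>_def)
    show "\<delta> \<le> e / 2" unfolding \<delta>_def by (rule min.cobounded1)
    have "\<delta> * K \<le> e / (K + 1) * (K + 1)"
      using e \<open>0 \<le> K\<close> \<open>0 < \<delta>\<close> by (intro mult_mono) (auto simp: \<delta>_def)
    then show "\<delta> * K \<le> e" using \<open>0 \<le> K\<close> by simp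
  qed
  obtain B :: "real^'d \<Rightarrow> real" where B: "Cc_smooth B" "\<And>x. 0 \<le> B x"
    "\<And>x. B x \<noteq> 0 \<Longrightarrow> norm x \<le> \<delta>" "(LINT x|lborel. B x) = 1"
    using normalized_bump[OF \<delta>(1)] by metis
  define \<eta> where "\<eta> z = A (fst z) * B (snd z)" for z :: "'d phase"
  have sm: "smooth (\<lambda>z. A (fst z))" "smooth (\<lambda>z. B (snd z))"
    by (rule smooth_compose_fst[OF Cc_smoothD[OF A(1)]], rule smooth_compose_snd[OF Cc_smoothD[OF B(1)]])
  have supp: "norm z \<le> e" if "\<eta> z \<noteq> 0" for z
    using that A(3)[of "fst z"] B(3)[of "snd z"] norm_Pair_le[of "fst z" "snd z"] \<delta>(2)
    by (auto simp: \<eta>_def)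
  have \<eta>: "Cc_smooth \<eta>"
    using supp unfolding \<eta>_def by (intro Cc_smoothI[where R=e] smooth_mult sm) fastforce
  have dq: "dd (qdir i) \<eta> z = dd (axis i 1) A (fst z) * B (snd z)" for i z
  proof -
    have "dd (qdir i) \<eta> z = A (fst z) * dd (qdir i) (\<lambda>z. B (snd z)) z + dd (qdir i) (\<lambda>z. A (fst z)) z * B (snd z)"
      unfolding \<eta>_def[abs_def] by (rule dd_mult[OF sm])
    moreover have "dd 0 B x = 0" for x
      using dd_scaleR[OF Cc_smoothD[OF B(1)], of 0 0] by simp
    ultimately show ?thesis
      using dd_compose_fst[OF Cc_smoothD[OF A(1)], of "qdir i" z] dd_compose_snd[OF Cc_smoothD[OF B(1)], of "qdir i" z]
      by simp
  qed
  have "(LINT z|lborel. \<bar>snd z $ i * dd (qdir i) \<eta> z\<bar>) \<le> e" for i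
  proof -
    let ?a = "\<lambda>x. \<bar>dd (axis i 1) A x\<bar>"
    have a: "integrable lborel ?a" by (intro integrable_abs Cc_smooth_integrable Cc_smooth_dd A(1))
    have "(LINT z|lborel. \<bar>snd z $ i * dd (qdir i) \<eta> z\<bar>) \<le> (LINT z|lborel. \<delta> * (?a (fst z) * B (snd z)))"
    proof (rule integral_mono_AE)
      show "integrable lborel (\<lambda>z. \<bar>snd z $ i * dd (qdir i) \<eta> z\<bar>)"
        by (intro integrable_abs Cc_smooth_integrable Cc_smooth_mult_left Cc_smooth_dd \<eta> smooth_intros)
      show "integrable lborel (\<lambda>z. \<delta> * (?a (fst z) * B (snd z)))"
        using integrable_lborel_product[OF a Cc_smooth_integrable[OF B(1)]]
        by (intro integrable_mult_right) (simp add: lborel_prod case_prod_unfold)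
      have "\<bar>snd z $ i * dd (qdir i) \<eta> z\<bar> \<le> \<delta> * (?a (fst z) * B (snd z))" for z
      proof (cases "B (snd z) = 0")
        case False
        then have "\<bar>snd z $ i\<bar> \<le> \<delta>" using B(3) component_le_norm_cart order_trans by blast
        then show ?thesis unfolding dq abs_mult using B(2)[of "snd z"] \<delta>(1)
          by (intro mult_mono) auto
      qed (simp add: dq)
      then show "AE z in lborel. \<bar>snd z $ i * dd (qdir i) \<eta> z\<bar> \<le> \<delta> * (?a (fst z) * B (snd z))" by simp
    qed
    also have "\<dots> = \<delta> * (LINT x|lborel. ?a x)"
      by (simp add: integral_lborel_product[OF a Cc_smooth_integrable[OF B(1)]] B(4))
    also have "\<dots> \<le> \<delta> * K"
      unfolding K_def using \<delta>(1)
      by (intro mult_left_mono member_le_sum) (auto intro!: integral_nonneg_AE)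
    finally show ?thesis using \<delta>(3) by simp
  qed
  moreover have "(LINT z|lborel. \<eta> z) = 1"
    using integral_lborel_product[OF Cc_smooth_integrable[OF A(1)] Cc_smooth_integrable[OF B(1)]]
    by (simp add: \<eta>_def[abs_def] A(4) B(4))
  ultimately have "mollifier e \<eta>"
    unfolding mollifier_def using \<eta> supp A(2) B(2) by (auto simp: \<eta>_def[abs_def])
  then show ?thesis by blast
qed

lemma abs_convol_le:
  assumes \<rho>: "\<rho> \<in> borel_measurable borel" "\<And>z. \<bar>\<rho> z\<bar> \<le> C" and k: "Cc_smooth k"
  shows "\<bar>convol \<rho> k x\<bar> \<le> C * (LINT z|lborel. \<bar>k z\<bar>)"
proof -
  note [measurable] = \<rho>(1) smooth_measurable[OF Cc_smoothD[OF k]]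
  have k': "integrable lborel (\<lambda>z. \<bar>k (x - z)\<bar>)"
    by (intro integrable_abs Cc_smooth_integrable Cc_smooth_reflect k)
  have "\<bar>convol \<rho> k x\<bar> \<le> (LINT z|lborel. C * \<bar>k (x - z)\<bar>)"
    unfolding convol_def
  proof (rule order_trans[OF integral_abs_bound], rule integral_mono_AE)
    show "integrable lborel (\<lambda>z. C * \<bar>k (x - z)\<bar>)" using k' by simp
    have *: "\<bar>\<rho> z * k (x - z)\<bar> \<le> C * \<bar>k (x - z)\<bar>" for z
      unfolding abs_mult by (intro mult_right_mono \<rho>(2)) simp
    then show "AE z in lborel. \<bar>\<rho> z * k (x - z)\<bar> \<le> C * \<bar>k (x - z)\<bar>" by simp
    from * show "integrable lborel (\<lambda>z. \<bar>\<rho> z * k (x - z)\<bar>)"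
      by (intro Bochner_Integration.integrable_bound[OF \<open>integrable lborel (\<lambda>z. C * \<bar>k (x - z)\<bar>)\<close>])
         (auto intro: order_trans[OF _ abs_ge_self])
  qed
  also have "\<dots> = C * (LINT z|lborel. \<bar>k z\<bar>)"
    using lborel_integral_reflect[of "\<lambda>z. \<bar>k z\<bar>" x] by simp
  finally show ?thesis .
qed

lemma uniformly_continuous_compact_support:
  fixes \<theta> :: "'a::euclidean_space \<Rightarrow> real"
  assumes cont: "continuous_on UNIV \<theta>" and R: "\<And>z. R < norm z \<Longrightarrow> \<theta> z = 0" and s: "0 < s"
  shows "\<exists>e>0. \<forall>z z'. norm (z - z') \<le> e \<longrightarrow> \<bar>\<theta> z - \<theta> z'\<bar> \<le> s"
proof -
  have "uniformly_continuous_on (cball 0 (R + 1)) \<theta>"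
    by (intro compact_uniformly_continuous compact_cball continuous_on_subset[OF cont]) simp
  then obtain d where d: "d > 0" "\<And>z z'. norm z \<le> R + 1 \<Longrightarrow> norm z' \<le> R + 1 \<Longrightarrow> dist z' z < d \<Longrightarrow> \<bar>\<theta> z - \<theta> z'\<bar> < s"
    unfolding uniformly_continuous_on_def using s by (metis dist_commute dist_real_def mem_cball_0)
  show ?thesis
  proof (intro exI[of _ "min 1 (d / 2)"] conjI allI impI)
    fix z z' :: 'a assume zz: "norm (z - z') \<le> min 1 (d / 2)"
    show "\<bar>\<theta> z - \<theta> z'\<bar> \<le> s"
    proof (cases "norm z \<le> R + 1 \<and> norm z' \<le> R + 1")
      case True
      with zz d(1) have "dist z' z < d" by (simp add: dist_norm norm_minus_commute)
      with d(2) True show ?thesis by (meson less_imp_le)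
    next
      case False
      then have "R < norm z" "R < norm z'"
        using zz norm_triangle_ineq2[of z z'] norm_triangle_ineq2[of z' z]
        by (auto simp: norm_minus_commute)
      with R s show ?thesis by simp
    qed
  qed (use d in simp)
qed

text \<open>By Fubini, the mollifier can be moved from \<open>\<rho>\<close> to the uniformly continuous function \<open>\<theta>\<close>, where it changes the values
by at most \<open>s\<close>.\<close>
lemma convol_weak_approx:
  fixes \<rho> :: "'d::finite phase \<Rightarrow> real"
  assumes \<rho>: "integrable lborel \<rho>"
    and \<theta>: "continuous_on UNIV \<theta>" "\<And>z. R < norm z \<Longrightarrow> \<theta> z = 0"
    and unif: "\<And>z z'. norm (z - z') \<le> e \<Longrightarrow> \<bar>\<theta> z - \<theta> z'\<bar> \<le> s" and m: "mollifier e \<eta>"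
  shows "\<bar>(LINT z|lborel. convol \<rho> \<eta> z * \<theta> z) - (LINT z|lborel. \<rho> z * \<theta> z)\<bar> \<le> s * (LINT z|lborel. \<bar>\<rho> z\<bar>)"
proof -
  from m have \<eta>: "Cc_smooth \<eta>" "\<And>z. 0 \<le> \<eta> z" "\<And>z. \<eta> z \<noteq> 0 \<Longrightarrow> norm z \<le> e" "(LINT z|lborel. \<eta> z) = 1"
    by (auto simp: mollifier_def)
  note [measurable] = smooth_measurable[OF Cc_smoothD[OF \<eta>(1)]]
  have [measurable]: "\<rho> \<in> borel_measurable borel" "\<theta> \<in> borel_measurable borel"
    using \<rho> \<theta> by (auto simp: borel_measurable_continuous_onI)
  obtain Bn where Bn: "\<And>z. \<bar>\<eta> z\<bar> \<le> Bn" using Cc_smooth_bounded[OF \<eta>(1)] by blast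
  have \<theta>i: "integrable lborel \<theta>"
  proof -
    have "integrable lborel (\<lambda>x. indicator (cball 0 R) x *\<^sub>R \<theta> x)"
      by (intro borel_integrable_compact compact_cball continuous_on_subset[OF \<theta>(1)]) simp
    moreover have "(\<lambda>x. indicator (cball 0 R) x *\<^sub>R \<theta> x) = \<theta>"
      using \<theta>(2) by (fastforce simp: indicator_def not_le)
    ultimately show ?thesis by simp
  qed
  have joint: "integrable (lborel \<Otimes>\<^sub>M lborel) (\<lambda>(z, z'). \<rho> z' * \<eta> (z - z') * \<theta> z)"
  proof (rule Bochner_Integration.integrable_bound)
    show "integrable (lborel \<Otimes>\<^sub>M lborel) (\<lambda>(z, z'). (Bn * \<theta> z) * \<rho> z')"
      by (rule integrable_lborel_product) (use \<theta>i \<rho> in auto)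
    have "\<bar>\<rho> z' * \<eta> (z - z') * \<theta> z\<bar> \<le> \<bar>(Bn * \<theta> z) * \<rho> z'\<bar>" for z z'
      using mult_left_mono[OF order_trans[OF Bn[of "z - z'"] abs_ge_self], of "\<bar>\<rho> z'\<bar> * \<bar>\<theta> z\<bar>"]
      by (simp add: abs_mult mult_ac)
    then show "AE x in lborel \<Otimes>\<^sub>M lborel. norm (case x of (z, z') \<Rightarrow> \<rho> z' * \<eta> (z - z') * \<theta> z)
        \<le> norm (case x of (z, z') \<Rightarrow> (Bn * \<theta> z) * \<rho> z')" by auto
  qed measurable
  have "(LINT z|lborel. convol \<rho> \<eta> z * \<theta> z) = (LINT z|lborel. LINT z'|lborel. \<rho> z' * \<eta> (z - z') * \<theta> z)"
    unfolding convol_def by (simp add: integral_mult_left_zero)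
  also have "\<dots> = (LINT z'|lborel. LINT z|lborel. \<rho> z' * \<eta> (z - z') * \<theta> z)"
    using lborel_pair.Fubini_integral[OF joint] by simp
  finally have 1: "(LINT z|lborel. convol \<rho> \<eta> z * \<theta> z)
      = (LINT z'|lborel. LINT z|lborel. \<rho> z' * \<eta> (z - z') * \<theta> z)" .
  have int1: "integrable lborel (\<lambda>z'. LINT z|lborel. \<rho> z' * \<eta> (z - z') * \<theta> z)"
    using lborel_pair.integrable_snd[OF joint] by simp
  have shift: "integrable lborel (\<lambda>z. \<eta> (z - z'))" "(LINT z|lborel. \<eta> (z - z')) = 1" for z'
    using Cc_smooth_integrable[OF Cc_smooth_translate[OF \<eta>(1), of "- z'"]]
      lborel_integral_shift[of \<eta> "- z'"] \<eta>(4) by simp_all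
  have etheta: "integrable lborel (\<lambda>z. \<eta> (z - z') * \<theta> z)" for z'
  proof (rule Bochner_Integration.integrable_bound)
    show "integrable lborel (\<lambda>z. Bn * \<theta> z)" using \<theta>i by simp
    show "AE z in lborel. norm (\<eta> (z - z') * \<theta> z) \<le> norm (Bn * \<theta> z)"
      unfolding real_norm_def abs_mult
      by (intro AE_I2 mult_right_mono order_trans[OF Bn abs_ge_self] abs_ge_zero)
  qed measurable
  have pt: "\<bar>(LINT z|lborel. \<rho> z' * \<eta> (z - z') * \<theta> z) - \<rho> z' * \<theta> z'\<bar> \<le> s * \<bar>\<rho> z'\<bar>" for z'
  proof -
    have int: "integrable lborel (\<lambda>z. \<eta> (z - z') * (\<theta> z - \<theta> z'))"
      using etheta[of z'] shift(1)[of z'] by (simp add: right_diff_distrib)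
    have "(LINT z|lborel. \<eta> (z - z') * \<theta> z) - \<theta> z' = (LINT z|lborel. \<eta> (z - z') * (\<theta> z - \<theta> z'))"
      using etheta[of z'] shift[of z'] by (simp add: right_diff_distrib)
    also have "\<bar>\<dots>\<bar> \<le> (LINT z|lborel. s * \<eta> (z - z'))"
    proof (rule order_trans[OF integral_abs_bound], rule integral_mono_AE)
      have "\<bar>\<eta> (z - z') * (\<theta> z - \<theta> z')\<bar> \<le> s * \<eta> (z - z')" for z
      proof (cases "\<eta> (z - z') = 0")
        case False
        then show ?thesis using unif[OF \<eta>(3)[OF False]] \<eta>(2)[of "z - z'"]
          mult_left_mono[of "\<bar>\<theta> z - \<theta> z'\<bar>" s "\<eta> (z - z')"] by (simp add: abs_mult mult_ac)
      qed simp
      then show "AE z in lborel. \<bar>\<eta> (z - z') * (\<theta> z - \<theta> z')\<bar> \<le> s * \<eta> (z - z')" by simp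
    qed (use int shift in auto)
    also have "\<dots> = s" using shift by simp
    finally have "\<bar>\<rho> z'\<bar> * \<bar>(LINT z|lborel. \<eta> (z - z') * \<theta> z) - \<theta> z'\<bar> \<le> \<bar>\<rho> z'\<bar> * s"
      by (intro mult_left_mono) auto
    moreover have "(LINT z|lborel. \<rho> z' * \<eta> (z - z') * \<theta> z) - \<rho> z' * \<theta> z'
        = \<rho> z' * ((LINT z|lborel. \<eta> (z - z') * \<theta> z) - \<theta> z')"
      by (simp add: mult.assoc right_diff_distrib)
    ultimately show ?thesis by (simp add: abs_mult mult.commute)
  qed
  have int2: "integrable lborel (\<lambda>z. \<rho> z * \<theta> z)"
  proof (rule Bochner_Integration.integrable_bound)
    show "integrable lborel (\<lambda>z. \<bar>LINT z'|lborel. \<rho> z * \<eta> (z' - z) * \<theta> z'\<bar> + s * \<bar>\<rho> z\<bar>)"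
      using int1 \<rho> by (intro Bochner_Integration.integrable_add integrable_abs integrable_mult_right) auto
    have "\<bar>\<rho> z * \<theta> z\<bar> \<le> \<bar>LINT z'|lborel. \<rho> z * \<eta> (z' - z) * \<theta> z'\<bar> + s * \<bar>\<rho> z\<bar>" for z
      using pt[of z] by linarith
    then show "AE z in lborel. norm (\<rho> z * \<theta> z) \<le> norm (\<bar>LINT z'|lborel. \<rho> z * \<eta> (z' - z) * \<theta> z'\<bar> + s * \<bar>\<rho> z\<bar>)"
      unfolding real_norm_def by (intro AE_I2 order_trans[OF _ abs_ge_self])
  qed measurable
  have "\<bar>(LINT z|lborel. convol \<rho> \<eta> z * \<theta> z) - (LINT z|lborel. \<rho> z * \<theta> z)\<bar>
      = \<bar>LINT z'|lborel. (LINT z|lborel. \<rho> z' * \<eta> (z - z') * \<theta> z) - \<rho> z' * \<theta> z'\<bar>"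
    unfolding 1 using int1 int2 by simp
  also have "\<dots> \<le> (LINT z'|lborel. s * \<bar>\<rho> z'\<bar>)"
    by (rule order_trans[OF integral_abs_bound], rule integral_mono_AE) (use int1 int2 \<rho> pt in auto)
  finally show ?thesis by simp
qed

section \<open>The energy estimate\<close>

locale kinetic =
  fixes U :: "real^'d \<Rightarrow> real" and lam :: real
  assumes lam_pos: "0 < lam" and smooth_U: "smooth U"
begin

definition force :: "'d \<Rightarrow> 'd phase \<Rightarrow> real" where
  "force i z = dd (axis i 1) U (fst z)"

definition energy :: "'d phase \<Rightarrow> real" where
  "energy z = (norm (snd z))\<^sup>2 / 2 + U (fst z)"

definition maxwell :: "'d phase \<Rightarrow> real" where
  "maxwell z = exp (- (energy z / lam))"

abbreviation gen_term :: "'d \<Rightarrow> ('d phase \<Rightarrow> real) \<Rightarrow> 'd phase \<Rightarrow> real" where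
  "gen_term i \<phi> z \<equiv> snd z $ i * dd (qdir i) \<phi> z - (force i z + snd z $ i) * dd (pdir i) \<phi> z
      + lam * dd (pdir i) (dd (pdir i) \<phi>) z"

text \<open>The operator dual to \<open>K\<close>: for a density \<open>\<rho>\<close> and a test function \<open>\<phi>\<close>, the pairing of \<open>K(\<rho>)\<close> with \<open>\<phi>\<close> is the
integral of \<open>\<rho>\<close> times \<open>gen \<phi>\<close> (\<open>vfp_op_eq_integral_gen\<close>). It is the generator of the underdamped Langevin
dynamics.\<close>
definition gen :: "('d phase \<Rightarrow> real) \<Rightarrow> 'd phase \<Rightarrow> real" where
  "gen \<phi> z = (\<Sum>i\<in>UNIV. gen_term i \<phi> z)"

text \<open>The \<open>i\<close>-th summand of \<open>K(u)\<close> for smooth \<open>u\<close>, with the divergences expanded; the summand \<open>u\<close> comes from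
\<open>div_p (u p)\<close>.\<close>
abbreviation dual_term :: "'d \<Rightarrow> ('d phase \<Rightarrow> real) \<Rightarrow> 'd phase \<Rightarrow> real" where
  "dual_term i u z \<equiv> - snd z $ i * dd (qdir i) u z + (force i z + snd z $ i) * dd (pdir i) u z + u z
      + lam * dd (pdir i) (dd (pdir i) u) z"

lemma smooth_force [smooth_intros]: "smooth (force i)"
  unfolding force_def[abs_def] by (intro smooth_compose_fst smooth_dd smooth_U)

lemma smooth_energy [smooth_intros]: "smooth energy"
  unfolding energy_def[abs_def]
  by (intro smooth_add smooth_divide_const smooth_compose_fst smooth_U
      smooth_compose_snd[where f="\<lambda>p. (norm p)\<^sup>2"] smooth_norm_square)

lemma smooth_maxwell [smooth_intros]: "smooth maxwell"
  unfolding maxwell_def[abs_def] by (intro smooth_intros)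

lemma maxwell_pos: "0 < maxwell z" by (simp add: maxwell_def)

lemma dd_energy: "dd v energy z = snd z \<bullet> snd v + dd (fst v) U (fst z)"
proof -
  have "((\<lambda>x. U (fst x)) has_derivative (\<lambda>v. dd (fst v) U (fst z))) (at z)"
    by (rule has_derivative_compose[OF has_derivative_fst[OF has_derivative_ident] smooth_has_derivative[OF smooth_U]])
  then have "(energy has_derivative (\<lambda>v. snd z \<bullet> snd v + dd (fst v) U (fst z))) (at z)"
    unfolding energy_def[abs_def] power2_norm_eq_inner
    by (auto intro!: derivative_eq_intros simp: inner_commute)
  then show ?thesis by (rule dd_eqI)
qed

lemma dd_0: "smooth f \<Longrightarrow> dd 0 f x = 0"
  using dd_scaleR[of f 0 0 x] by simp

lemma dd_pdir_energy: "dd (pdir i) energy z = snd z $ i"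
  by (simp add: dd_energy dd_0[OF smooth_U] inner_axis)
lemma dd_qdir_energy: "dd (qdir i) energy z = force i z"
  by (simp add: dd_energy force_def)
lemma dd_pdir_force: "dd (pdir i) (force j) z = 0"
  unfolding force_def[abs_def] by (simp add: dd_compose_fst smooth_dd smooth_U dd_0)
lemma dd_momentum: "dd v (\<lambda>z. snd z $ i) z = snd v $ i"
  by (rule dd_bounded_linear) (intro bounded_linear_compose[OF bounded_linear_vec_nth bounded_linear_snd])
lemma dd_pdir_maxwell: "dd (pdir i) maxwell z = - (snd z $ i / lam) * maxwell z"
  unfolding maxwell_def[abs_def]
  by (simp add: dd_exp dd_minus dd_divide_const dd_pdir_energy smooth_intros)
lemma dd_qdir_maxwell: "dd (qdir i) maxwell z = - (force i z / lam) * maxwell z"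
  unfolding maxwell_def[abs_def]
  by (simp add: dd_exp dd_minus dd_divide_const dd_qdir_energy smooth_intros)

text \<open>With \<open>u = M f\<close>, one momentum and position coordinate of the product of \<open>K(u) - div_p g\<close> with \<open>\<beta>'(f) \<zeta>\<close>, written as
the dissipation, the cutoff error, the contribution of \<open>g\<close> and a divergence. Here \<open>\<beta>(s) = s^2/(1+s)\<close>, which in
terms of \<open>v = 1/(1+f)\<close> reads \<open>\<beta>(f) = f - 1 + v\<close>, \<open>\<beta>'(f) = w = 1 - v^2\<close> and \<open>\<beta>''(f) = 2 v^3\<close>. The assumption
\<open>transport\<close> holds for functions of the energy.\<close>
lemma energy_identity_pointwise:
  fixes i :: 'd and f \<zeta> g :: "'d phase \<Rightarrow> real"
  assumes f: "smooth f" and f0: "\<And>z. 0 \<le> f z" and \<zeta>: "smooth \<zeta>" and g: "smooth g"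
    and transport: "\<And>z. snd z $ i * dd (qdir i) \<zeta> z = force i z * dd (pdir i) \<zeta> z"
  defines "u \<equiv> \<lambda>z. maxwell z * f z" and "v \<equiv> \<lambda>z. inverse (1 + f z)"
  defines "w \<equiv> \<lambda>z. 1 - v z * v z" and "\<beta> \<equiv> \<lambda>z. f z - 1 + v z"
  shows "(dual_term i u z - dd (pdir i) g z) * (w z * \<zeta> z)
      = - lam * (maxwell z * (dd (pdir i) f z)\<^sup>2 * (2 * v z ^ 3) * \<zeta> z)
        + maxwell z * \<beta> z * (gen_term i \<zeta> z)
        + g z * (2 * v z ^ 3 * dd (pdir i) f z * \<zeta> z + w z * dd (pdir i) \<zeta> z)
        + (- dd (qdir i) (\<lambda>z. snd z $ i * (maxwell z * \<beta> z * \<zeta> z)) z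
           + dd (pdir i) (\<lambda>z. force i z * (maxwell z * \<beta> z * \<zeta> z)) z
           + lam * dd (pdir i) (\<lambda>z. maxwell z * (dd (pdir i) f z * (w z * \<zeta> z))) z
           - lam * dd (pdir i) (\<lambda>z. maxwell z * (\<beta> z * dd (pdir i) \<zeta> z)) z
           - dd (pdir i) (\<lambda>z. g z * (w z * \<zeta> z)) z)"
proof -
  have nz: "1 + f z \<noteq> 0" for z using f0[of z] by linarith
  have sv: "smooth v" unfolding v_def by (intro smooth_inverse smooth_add smooth_const f nz)
  have sw: "smooth w" unfolding w_def by (intro smooth_diff smooth_mult smooth_const sv)
  have sb: "smooth \<beta>" unfolding \<beta>_def by (intro smooth_diff smooth_add smooth_const sv f)
  have dv: "dd a v z = - (v z * v z * dd a f z)" for a z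
    unfolding v_def using f nz by (simp add: dd_inverse dd_add smooth_add smooth_const)
  have dw: "dd a w z = 2 * (v z * v z * v z) * dd a f z" for a z
    unfolding w_def by (simp add: dd_diff dd_mult sv smooth_mult smooth_const dv)
  have db: "dd a \<beta> z = w z * dd a f z" for a z
    unfolding \<beta>_def by (simp add: dd_diff dd_add sv f smooth_diff smooth_add smooth_const dv w_def algebra_simps)
  note sm = f \<zeta> g sw sb smooth_maxwell smooth_force smooth_snd_component smooth_mult smooth_dd
    smooth_diff smooth_divide_const smooth_minus
  have du: "dd (pdir i) u = (\<lambda>z. maxwell z * dd (pdir i) f z - snd z $ i / lam * (maxwell z * f z))"
    unfolding u_def by (rule ext) (simp add: dd_mult sm dd_pdir_maxwell)
  have ddu: "dd (pdir i) (dd (pdir i) u) z = maxwell z * dd (pdir i) (dd (pdir i) f) z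
      - 2 * (snd z $ i / lam * maxwell z * dd (pdir i) f z) - maxwell z * f z / lam
      + snd z $ i / lam * (snd z $ i / lam) * maxwell z * f z"
    unfolding du
    using lam_pos
    by (simp add: dd_diff dd_mult dd_divide_const sm dd_pdir_maxwell dd_momentum) (simp add: field_simps)
  have duq: "dd (qdir i) u z = maxwell z * dd (qdir i) f z - force i z / lam * (maxwell z * f z)"
    unfolding u_def by (simp add: dd_mult sm dd_qdir_maxwell)
  have t1: "dd (qdir i) (\<lambda>z. snd z $ i * (maxwell z * \<beta> z * \<zeta> z)) z
      = snd z $ i * (- (force i z / lam) * maxwell z * \<beta> z * \<zeta> z + maxwell z * (w z * dd (qdir i) f z) * \<zeta> z
          + maxwell z * \<beta> z * dd (qdir i) \<zeta> z)"
    by (simp add: dd_mult sm dd_qdir_maxwell dd_momentum db) (simp add: algebra_simps)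
  have t2: "dd (pdir i) (\<lambda>z. force i z * (maxwell z * \<beta> z * \<zeta> z)) z
      = force i z * (- (snd z $ i / lam) * maxwell z * \<beta> z * \<zeta> z + maxwell z * (w z * dd (pdir i) f z) * \<zeta> z
          + maxwell z * \<beta> z * dd (pdir i) \<zeta> z)"
    by (simp add: dd_mult sm dd_pdir_maxwell dd_pdir_force db) (simp add: algebra_simps)
  have t3: "dd (pdir i) (\<lambda>z. maxwell z * (dd (pdir i) f z * (w z * \<zeta> z))) z
      = - (snd z $ i / lam) * maxwell z * dd (pdir i) f z * w z * \<zeta> z
        + maxwell z * dd (pdir i) (dd (pdir i) f) z * w z * \<zeta> z
        + maxwell z * dd (pdir i) f z * (2 * (v z * v z * v z) * dd (pdir i) f z) * \<zeta> z
        + maxwell z * dd (pdir i) f z * w z * dd (pdir i) \<zeta> z"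
    by (simp add: dd_mult sm dd_pdir_maxwell dw) (simp add: algebra_simps)
  have t4: "dd (pdir i) (\<lambda>z. maxwell z * (\<beta> z * dd (pdir i) \<zeta> z)) z
      = - (snd z $ i / lam) * maxwell z * \<beta> z * dd (pdir i) \<zeta> z
        + maxwell z * (w z * dd (pdir i) f z) * dd (pdir i) \<zeta> z
        + maxwell z * \<beta> z * dd (pdir i) (dd (pdir i) \<zeta>) z"
    by (simp add: dd_mult sm dd_pdir_maxwell db) (simp add: algebra_simps)
  have t5: "dd (pdir i) (\<lambda>z. g z * (w z * \<zeta> z)) z
      = dd (pdir i) g z * (w z * \<zeta> z) + g z * (2 * (v z * v z * v z) * dd (pdir i) f z * \<zeta> z + w z * dd (pdir i) \<zeta> z)"
    by (simp add: dd_mult sm dw algebra_simps)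
  have uz: "u z = maxwell z * f z" by (simp add: u_def)
  show ?thesis
    unfolding t1 t2 t3 t4 t5 ddu duq uz fun_cong[OF du, of z]
    using lam_pos transport[of z]
    by (simp add: field_simps power2_eq_square power3_eq_cube)
qed

lemma Cc_smooth_gen: "Cc_smooth \<phi> \<Longrightarrow> Cc_smooth (gen \<phi>)"
  unfolding gen_def[abs_def]
  by (intro Cc_smooth_sum Cc_smooth_add Cc_smooth_diff Cc_smooth_mult_left Cc_smooth_dd smooth_add
      smooth_force smooth_snd_component smooth_const)

lemma energy_identity:
  fixes f \<zeta> r :: "'d phase \<Rightarrow> real" and g :: "'d \<Rightarrow> 'd phase \<Rightarrow> real"
  assumes f: "smooth f" and f0: "\<And>z. 0 \<le> f z" and \<zeta>: "Cc_smooth \<zeta>" and g: "\<And>i. smooth (g i)" and r: "smooth r"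
    and transport: "\<And>i z. snd z $ i * dd (qdir i) \<zeta> z = force i z * dd (pdir i) \<zeta> z"
  defines "u \<equiv> \<lambda>z. maxwell z * f z" and "v \<equiv> \<lambda>z. inverse (1 + f z)"
  defines "w \<equiv> \<lambda>z. 1 - v z * v z" and "\<beta> \<equiv> \<lambda>z. f z - 1 + v z"
  assumes eq: "\<And>z. \<zeta> z \<noteq> 0 \<Longrightarrow> (\<Sum>i\<in>UNIV. dual_term i u z - dd (pdir i) (g i) z) = r z"
  shows "lam * (LINT z|lborel. (\<Sum>i\<in>UNIV. maxwell z * (dd (pdir i) f z)\<^sup>2 * (2 * v z ^ 3) * \<zeta> z))
    = (LINT z|lborel. maxwell z * \<beta> z * gen \<zeta> z
        + (\<Sum>i\<in>UNIV. g i z * (2 * v z ^ 3 * dd (pdir i) f z * \<zeta> z + w z * dd (pdir i) \<zeta> z))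
        - r z * (w z * \<zeta> z))"
proof -
  have nz: "1 + f z \<noteq> 0" for z using f0[of z] by linarith
  have sv: "smooth v" unfolding v_def by (intro smooth_inverse smooth_add smooth_const f nz)
  have sw: "smooth w" unfolding w_def by (intro smooth_diff smooth_mult smooth_const sv)
  have sb: "smooth \<beta>" unfolding \<beta>_def by (intro smooth_diff smooth_add smooth_const sv f)
  note sm = f g r sw sb sv smooth_maxwell smooth_force smooth_snd_component smooth_mult smooth_dd smooth_power smooth_const
  note cc = Cc_smooth_mult_left Cc_smooth_add Cc_smooth_dd Cc_smooth_sum \<zeta>
  define A where "A i z = maxwell z * (dd (pdir i) f z)\<^sup>2 * (2 * v z ^ 3) * \<zeta> z" for i z
  define B where "B z = maxwell z * \<beta> z * gen \<zeta> z" for z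
  define C where "C i z = g i z * (2 * v z ^ 3 * dd (pdir i) f z * \<zeta> z + w z * dd (pdir i) \<zeta> z)" for i z
  define D where "D z = r z * (w z * \<zeta> z)" for z
  define X where "X i = (\<lambda>z. snd z $ i * (maxwell z * \<beta> z * \<zeta> z))" for i
  define Y1 where "Y1 i = (\<lambda>z. force i z * (maxwell z * \<beta> z * \<zeta> z))" for i
  define Y2 where "Y2 i = (\<lambda>z. maxwell z * (dd (pdir i) f z * (w z * \<zeta> z)))" for i
  define Y3 where "Y3 i = (\<lambda>z. maxwell z * (\<beta> z * dd (pdir i) \<zeta> z))" for i
  define Y4 where "Y4 i = (\<lambda>z. g i z * (w z * \<zeta> z))" for i
  have iA: "integrable lborel (A i)" for i
    unfolding A_def by (intro Cc_smooth_integrable cc sm)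
  have iB: "integrable lborel B" unfolding B_def[abs_def] by (intro Cc_smooth_integrable Cc_smooth_gen cc sm)
  have iC: "integrable lborel (C i)" for i unfolding C_def by (intro Cc_smooth_integrable cc sm)
  have iD: "integrable lborel D" unfolding D_def[abs_def] by (intro Cc_smooth_integrable cc sm)
  have cX: "Cc_smooth (X i)" "Cc_smooth (Y1 i)" "Cc_smooth (Y2 i)" "Cc_smooth (Y3 i)" "Cc_smooth (Y4 i)" for i
    unfolding X_def Y1_def Y2_def Y3_def Y4_def by (intro cc sm)+
  define Dv where "Dv i z = - dd (qdir i) (X i) z + dd (pdir i) (Y1 i) z + lam * dd (pdir i) (Y2 i) z
      - lam * dd (pdir i) (Y3 i) z - dd (pdir i) (Y4 i) z" for i z
  have iDv: "integrable lborel (Dv i)" "(LINT z|lborel. Dv i z) = 0" for i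
    unfolding Dv_def using cX[THEN Cc_smooth_dd, THEN Cc_smooth_integrable] cX[THEN integral_dd_eq_0]
    by simp_all
  have pw: "D z = - lam * (\<Sum>i\<in>UNIV. A i z) + B z + (\<Sum>i\<in>UNIV. C i z) + (\<Sum>i\<in>UNIV. Dv i z)" for z
  proof -
    have "D z = (\<Sum>i\<in>UNIV. dual_term i u z - dd (pdir i) (g i) z) * (w z * \<zeta> z)"
      using eq[of z] by (cases "\<zeta> z = 0") (simp_all add: D_def)
    also have "\<dots> = (\<Sum>i\<in>UNIV. - lam * A i z + maxwell z * \<beta> z * (gen_term i \<zeta> z) + C i z + Dv i z)"
      unfolding sum_distrib_right A_def C_def Dv_def X_def Y1_def Y2_def Y3_def Y4_def u_def v_def w_def \<beta>_def
      by (intro sum.cong refl energy_identity_pointwise f f0 Cc_smoothD[OF \<zeta>] g transport)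
    also have "\<dots> = - lam * (\<Sum>i\<in>UNIV. A i z) + B z + (\<Sum>i\<in>UNIV. C i z) + (\<Sum>i\<in>UNIV. Dv i z)"
      by (simp add: sum.distrib sum_subtractf sum_negf sum_distrib_left B_def gen_def algebra_simps)
    finally show ?thesis .
  qed
  have "(LINT z|lborel. lam * (\<Sum>i\<in>UNIV. A i z)) = (LINT z|lborel. (B z + (\<Sum>i\<in>UNIV. C i z) - D z) + (\<Sum>i\<in>UNIV. Dv i z))"
    by (intro Bochner_Integration.integral_cong refl) (use pw in \<open>simp add: algebra_simps\<close>)
  also have "\<dots> = (LINT z|lborel. B z + (\<Sum>i\<in>UNIV. C i z) - D z) + (LINT z|lborel. (\<Sum>i\<in>UNIV. Dv i z))"
    by (intro Bochner_Integration.integral_add Bochner_Integration.integrable_diff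
        Bochner_Integration.integrable_add Bochner_Integration.integrable_sum iB iC iD iDv)
  also have "(LINT z|lborel. (\<Sum>i\<in>UNIV. Dv i z)) = 0"
    by (simp add: Bochner_Integration.integral_sum iDv)
  finally show ?thesis by (simp add: A_def B_def C_def D_def)
qed

lemma young_bound:
  fixes a x y m :: real
  assumes "0 < m" shows "x * y \<le> m / 2 * y\<^sup>2 + x\<^sup>2 / (2 * m)"
proof -
  have "0 \<le> (m * y - x)\<^sup>2 / (2 * m)" using assms by simp
  also have "\<dots> = m / 2 * y\<^sup>2 + x\<^sup>2 / (2 * m) - x * y"
    using assms by (simp add: power2_eq_square field_simps)
  finally show ?thesis by simp
qed

lemma double_half_cancel: "2 * x * (k / (2 * m)) = k * (inverse m * x)" for x k m :: real
  by (simp add: field_simps)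

text \<open>Young's inequality bounds \<open>g \<cdot> \<nabla>_p f\<close> by half of the dissipation density plus \<open>|g|^2/(2 lam M)\<close>; half of the
dissipation survives on the left. Apart from the cutoff term, the right-hand side is small with \<open>\<kappa>\<close>.\<close>
lemma energy_inequality:
  fixes f \<zeta> r :: "'d phase \<Rightarrow> real" and g :: "'d \<Rightarrow> 'd phase \<Rightarrow> real"
  assumes f: "smooth f" and f0: "\<And>z. 0 \<le> f z" and \<zeta>: "Cc_smooth \<zeta>" "\<And>z. 0 \<le> \<zeta> z"
    and R: "\<And>z. R < norm z \<Longrightarrow> \<zeta> z = 0" and g: "\<And>i. smooth (g i)" and r: "smooth r"
    and transport: "\<And>i z. snd z $ i * dd (qdir i) \<zeta> z = force i z * dd (pdir i) \<zeta> z"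
    and eq: "\<And>z. norm z \<le> R \<Longrightarrow> (\<Sum>i\<in>UNIV. dual_term i (\<lambda>z. maxwell z * f z) z - dd (pdir i) (g i) z) = r z"
    and small: "\<And>i z. norm z \<le> R \<Longrightarrow> \<bar>g i z\<bar> \<le> \<kappa>" "\<And>z. norm z \<le> R \<Longrightarrow> \<bar>r z\<bar> \<le> \<kappa>"
  shows "lam / 2 * (LINT z|lborel. (\<Sum>i\<in>UNIV. maxwell z * (dd (pdir i) f z)\<^sup>2 * (2 * inverse (1 + f z) ^ 3) * \<zeta> z))
    \<le> (LINT z|lborel. maxwell z * f z * \<bar>gen \<zeta> z\<bar>)
      + \<kappa>\<^sup>2 * (LINT z|lborel. (\<Sum>i\<in>(UNIV::'d set). inverse (lam * maxwell z) * \<zeta> z))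
      + \<kappa> * (LINT z|lborel. (\<Sum>i\<in>UNIV. \<bar>dd (pdir i) \<zeta> z\<bar>)) + \<kappa> * (LINT z|lborel. \<zeta> z)"
proof -
  define v where "v z = inverse (1 + f z)" for z
  define w where "w z = 1 - v z * v z" for z
  define \<beta> where "\<beta> z = f z - 1 + v z" for z
  have nz: "1 + f z \<noteq> 0" for z using f0[of z] by linarith
  have sv: "smooth v" unfolding v_def[abs_def] by (intro smooth_inverse smooth_add smooth_const f nz)
  have sw: "smooth w" unfolding w_def[abs_def] by (intro smooth_diff smooth_mult smooth_const sv)
  have sb: "smooth \<beta>" unfolding \<beta>_def[abs_def] by (intro smooth_diff smooth_add smooth_const sv f)
  have v: "0 < v z" "v z \<le> 1" for z using f0[of z] by (auto simp: v_def field_simps)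
  have w: "0 \<le> w z" "w z \<le> 1" for z using v[of z] mult_le_one[of "v z" "v z"] by (auto simp: w_def)
  have \<beta>: "0 \<le> \<beta> z" "\<beta> z \<le> f z" for z
    using f0[of z] v[of z] by (auto simp: \<beta>_def v_def field_simps)
  have lm: "0 < lam * maxwell z" for z using lam_pos maxwell_pos by simp
  note sm = f g r sw sb sv smooth_maxwell smooth_force smooth_snd_component smooth_mult smooth_dd smooth_power smooth_const
  note cc = Cc_smooth_mult_left Cc_smooth_add Cc_smooth_diff Cc_smooth_dd Cc_smooth_sum \<zeta>(1)
  let ?A = "\<lambda>z. \<Sum>i\<in>UNIV. maxwell z * (dd (pdir i) f z)\<^sup>2 * (2 * v z ^ 3) * \<zeta> z"
  let ?B = "\<lambda>z. maxwell z * f z * \<bar>gen \<zeta> z\<bar>"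
  let ?I = "\<lambda>z. maxwell z * \<beta> z * gen \<zeta> z
        + (\<Sum>i\<in>UNIV. g i z * (2 * v z ^ 3 * dd (pdir i) f z * \<zeta> z + w z * dd (pdir i) \<zeta> z))
        - r z * (w z * \<zeta> z)"
  let ?P = "\<lambda>z. \<Sum>i\<in>(UNIV::'d set). inverse (lam * maxwell z) * \<zeta> z"
  let ?Q = "\<lambda>z. \<Sum>i\<in>UNIV. \<bar>dd (pdir i) \<zeta> z\<bar>"
  have iA: "integrable lborel ?A" by (intro Cc_smooth_integrable cc sm)
  have iB: "integrable lborel ?B"
  proof -
    have "integrable lborel (\<lambda>z. \<bar>maxwell z * f z * gen \<zeta> z\<bar>)"
      by (intro integrable_abs Cc_smooth_integrable Cc_smooth_gen cc sm)
    then show ?thesis by (simp add: abs_mult f0 less_imp_le[OF maxwell_pos])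
  qed
  have iI: "integrable lborel ?I"
    by (intro Cc_smooth_integrable Cc_smooth_gen cc sm)
  have iP: "integrable lborel ?P"
  proof -
    have "lam * maxwell z \<noteq> 0" for z using lm[of z] by linarith
    then show ?thesis by (intro Cc_smooth_integrable cc smooth_inverse sm)
  qed
  have iQ: "integrable lborel ?Q"
    by (intro Bochner_Integration.integrable_sum integrable_abs Cc_smooth_integrable cc)
  have iz: "integrable lborel \<zeta>" by (intro Cc_smooth_integrable cc)
  have pw: "?I z \<le> lam / 2 * ?A z + (?B z + \<kappa>\<^sup>2 * ?P z + \<kappa> * ?Q z + \<kappa> * \<zeta> z)" for z
  proof (cases "norm z \<le> R")
    case False
    then have "\<zeta> z = 0" "dd a \<zeta> z = 0" "dd b (dd a \<zeta>) z = 0" for a b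
      using R dd_eq_0_outside[of R \<zeta>, OF R] dd_eq_0_outside[of R "dd a \<zeta>", OF dd_eq_0_outside[of R \<zeta>, OF R]]
      by auto
    then show ?thesis by (simp add: gen_def)
  next
    case True
    have \<kappa>: "0 \<le> \<kappa>" using small(2)[OF True] by linarith
    have "maxwell z * \<beta> z * gen \<zeta> z \<le> maxwell z * \<beta> z * \<bar>gen \<zeta> z\<bar>"
      using maxwell_pos[of z] \<beta>[of z] by (intro mult_left_mono) auto
    also have "\<dots> \<le> ?B z"
      using maxwell_pos[of z] \<beta>[of z] by (intro mult_right_mono mult_left_mono) auto
    finally have 1: "maxwell z * \<beta> z * gen \<zeta> z \<le> ?B z" .
    have 2: "g i z * (2 * v z ^ 3 * dd (pdir i) f z * \<zeta> z + w z * dd (pdir i) \<zeta> z)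
        \<le> lam / 2 * (maxwell z * (dd (pdir i) f z)\<^sup>2 * (2 * v z ^ 3) * \<zeta> z)
          + (\<kappa>\<^sup>2 * (inverse (lam * maxwell z) * \<zeta> z) + \<kappa> * \<bar>dd (pdir i) \<zeta> z\<bar>)" for i
    proof -
      let ?c = "2 * v z ^ 3 * \<zeta> z"
      have c: "0 \<le> ?c" "?c \<le> 2 * \<zeta> z"
        using v[of z] \<zeta>(2)[of z] by (auto simp: power_le_one mult_left_le_one_le)
      have gk: "(g i z)\<^sup>2 \<le> \<kappa>\<^sup>2" using small(1)[OF True, of i] \<kappa> by (simp add: abs_le_square_iff[symmetric])
      have "g i z * dd (pdir i) f z \<le> lam * maxwell z / 2 * (dd (pdir i) f z)\<^sup>2 + (g i z)\<^sup>2 / (2 * (lam * maxwell z))"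
        by (rule young_bound[OF lm])
      also have "\<dots> \<le> lam * maxwell z / 2 * (dd (pdir i) f z)\<^sup>2 + \<kappa>\<^sup>2 / (2 * (lam * maxwell z))"
        using lm[of z] gk by (intro add_left_mono divide_right_mono) auto
      finally have s1: "?c * (g i z * dd (pdir i) f z)
          \<le> ?c * (lam * maxwell z / 2 * (dd (pdir i) f z)\<^sup>2) + ?c * (\<kappa>\<^sup>2 / (2 * (lam * maxwell z)))"
        unfolding distrib_left[symmetric] using c(1) by (rule mult_left_mono)
      have s2: "?c * (\<kappa>\<^sup>2 / (2 * (lam * maxwell z))) \<le> 2 * \<zeta> z * (\<kappa>\<^sup>2 / (2 * (lam * maxwell z)))"
        by (rule mult_right_mono[OF c(2)]) (use lm[of z] in simp)
      have s3: "2 * \<zeta> z * (\<kappa>\<^sup>2 / (2 * (lam * maxwell z))) = \<kappa>\<^sup>2 * (inverse (lam * maxwell z) * \<zeta> z)"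
        by (rule double_half_cancel)
      have s4: "?c * (lam * maxwell z / 2 * (dd (pdir i) f z)\<^sup>2)
          = lam / 2 * (maxwell z * (dd (pdir i) f z)\<^sup>2 * (2 * v z ^ 3) * \<zeta> z)" by simp
      note c1 = order_trans[OF s1 add_left_mono[OF s2], unfolded s3 s4]
      have "g i z * (w z * dd (pdir i) \<zeta> z) \<le> \<bar>g i z\<bar> * (w z * \<bar>dd (pdir i) \<zeta> z\<bar>)"
        using w(1)[of z] abs_ge_self[of "g i z * (w z * dd (pdir i) \<zeta> z)"] by (simp add: abs_mult)
      also have "\<dots> \<le> \<kappa> * (1 * \<bar>dd (pdir i) \<zeta> z\<bar>)"
        using w[of z] small(1)[OF True, of i] \<kappa> by (intro mult_mono) auto
      finally have c2: "g i z * (w z * dd (pdir i) \<zeta> z) \<le> \<kappa> * \<bar>dd (pdir i) \<zeta> z\<bar>" by simp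
      have "g i z * (2 * v z ^ 3 * dd (pdir i) f z * \<zeta> z + w z * dd (pdir i) \<zeta> z)
          = ?c * (g i z * dd (pdir i) f z) + g i z * (w z * dd (pdir i) \<zeta> z)" by (simp add: algebra_simps)
      with add_mono[OF c1 c2] show ?thesis by (simp only: add.assoc)
    qed
    have 3: "- (r z * (w z * \<zeta> z)) \<le> \<kappa> * \<zeta> z"
    proof -
      have "- (r z * (w z * \<zeta> z)) \<le> \<bar>r z\<bar> * (w z * \<zeta> z)"
        using w(1)[of z] \<zeta>(2)[of z] abs_ge_minus_self[of "r z"] mult_right_mono[of "- r z" "\<bar>r z\<bar>" "w z * \<zeta> z"] by simp
      also have "\<dots> \<le> \<kappa> * (1 * \<zeta> z)"
        using w[of z] \<zeta>(2)[of z] small(2)[OF True] \<kappa> by (intro mult_mono) auto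
      finally show ?thesis by simp
    qed
    have "(\<Sum>i\<in>UNIV. g i z * (2 * v z ^ 3 * dd (pdir i) f z * \<zeta> z + w z * dd (pdir i) \<zeta> z))
        \<le> lam / 2 * ?A z + (\<kappa>\<^sup>2 * ?P z + \<kappa> * ?Q z)"
      unfolding sum_distrib_left sum.distrib[symmetric] by (rule sum_mono) (rule 2)
    with 1 3 show ?thesis by linarith
  qed
  have "lam * (LINT z|lborel. ?A z) = (LINT z|lborel. ?I z)"
    unfolding v_def w_def \<beta>_def
    by (rule energy_identity[OF f f0 \<zeta>(1) g r transport eq]) (use R in \<open>auto simp: not_less[symmetric]\<close>)
  also have "\<dots> \<le> (LINT z|lborel. lam / 2 * ?A z + (?B z + \<kappa>\<^sup>2 * ?P z + \<kappa> * ?Q z + \<kappa> * \<zeta> z))"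
    by (intro integral_mono_AE AE_I2 pw iI Bochner_Integration.integrable_add integrable_mult_right iA iB iP iQ iz)
  also have "\<dots> = lam / 2 * (LINT z|lborel. ?A z) + ((LINT z|lborel. ?B z) + \<kappa>\<^sup>2 * (LINT z|lborel. ?P z)
      + \<kappa> * (LINT z|lborel. ?Q z) + \<kappa> * (LINT z|lborel. \<zeta> z))"
    using iA iB iP iQ iz by simp
  finally show ?thesis by (simp add: v_def)
qed

end

lemma smooth_lipschitz_cball:
  fixes F :: "'a::euclidean_space \<Rightarrow> real"
  assumes "smooth F"
  shows "\<exists>L\<ge>0. \<forall>x y. norm x \<le> R \<longrightarrow> norm (x - y) \<le> 1 \<longrightarrow> \<bar>F x - F y\<bar> \<le> L * norm (x - y)"
proof -
  have "\<exists>C. \<forall>x. norm x \<le> R + 1 \<longrightarrow> \<bar>dd b F x\<bar> \<le> C" for b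
    by (intro continuous_bounded_on_cball smooth_continuous_on smooth_dd assms)
  then obtain C where C: "\<And>b x. norm x \<le> R + 1 \<Longrightarrow> \<bar>dd b F x\<bar> \<le> C b" by metis
  define K where "K = (\<Sum>b\<in>(Basis::'a set). \<bar>C b\<bar>)"
  have K: "\<bar>dd b F x\<bar> \<le> K" if "b \<in> Basis" "norm x \<le> R + 1" for b x
  proof -
    have "\<bar>C b\<bar> \<le> K" unfolding K_def by (rule member_le_sum) (use that in auto)
    with C[OF that(2), of b] show ?thesis by linarith
  qed
  have "\<bar>F x - F y\<bar> \<le> (DIM('a) * K) * norm (x - y)" if xy: "norm x \<le> R" "norm (x - y) \<le> 1" for x y
  proof -
    have "\<bar>F (x + (y - x)) - F x\<bar> \<le> DIM('a) * K * norm (y - x)"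
    proof (rule mean_value_bound(1))
      show "F differentiable at z" for z by (rule differentiableI[OF smooth_has_derivative[OF assms]])
      fix b z assume "b \<in> (Basis :: 'a set)" "norm (z - x) \<le> norm (y - x)"
      then show "\<bar>dd b F z\<bar> \<le> K"
        using xy norm_triangle_ineq2[of z x] by (intro K) (auto simp: norm_minus_commute)
    qed
    then show ?thesis by (simp add: norm_minus_commute abs_minus_commute)
  qed
  moreover have "0 \<le> DIM('a) * K" by (simp add: K_def sum_nonneg)
  ultimately show ?thesis by blast
qed

lemma integrable_imp_locally_integrable:
  assumes "integrable lborel F" shows "locally_integrable F"
  unfolding locally_integrable_def
proof (intro conjI allI)
  show "F \<in> borel_measurable borel" using assms by auto
  show "integrable lborel (\<lambda>z. indicator (cball 0 R) z * F z)" for R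
    using integrable_mult_indicator[OF _ assms, of "cball 0 R"] by simp
qed

lemma abs_momentum_le: "\<bar>snd z $ i\<bar> \<le> norm z" for z :: "'d::finite phase"
  by (cases z) (metis component_le_norm_cart norm_snd_le order_trans snd_conv)

section \<open>The mollified stationary equation\<close>

locale kinetic_solution = kinetic U lam for U :: "real^'d \<Rightarrow> real" and lam :: real +
  fixes \<rho> :: "'d phase \<Rightarrow> real" and C B :: real
  assumes integrable_\<rho>: "integrable lborel \<rho>"
    and \<rho>_nonneg: "\<And>z. 0 \<le> \<rho> z" and \<rho>_le: "\<And>z. \<rho> z \<le> C"
    and weak: "\<And>\<phi>. Cc_smooth \<phi> \<Longrightarrow> (LINT z|lborel. \<rho> z * gen \<phi> z) = 0"
    and U_ge: "\<And>q. B \<le> U q" and U_proper: "\<And>R. bounded {q. U q \<le> R}"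
begin

lemma \<rho>_measurable [measurable]: "\<rho> \<in> borel_measurable borel"
  using integrable_\<rho> by auto

lemma locally_integrable_\<rho>: "locally_integrable \<rho>"
  by (rule integrable_imp_locally_integrable[OF integrable_\<rho>])

lemma C_nonneg: "0 \<le> C" using \<rho>_nonneg \<rho>_le order_trans by blast

text \<open>The vector field \<open>\<integral> \<rho>(z') (\<nabla>U(q) - \<nabla>U(q') + p - p') \<eta>(z - z') dz'\<close>, whose \<open>p\<close>-divergence is the commutator of
mollification with the force and the friction.\<close>
definition flux :: "('d phase \<Rightarrow> real) \<Rightarrow> 'd \<Rightarrow> 'd phase \<Rightarrow> real" where
  "flux \<eta> i z = force i z * convol \<rho> \<eta> z - convol (\<lambda>z. \<rho> z * force i z) \<eta> z
     + convol \<rho> (\<lambda>y. snd y $ i * \<eta> y) z"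

text \<open>The commutator of mollification with the free transport.\<close>
definition remainder :: "('d phase \<Rightarrow> real) \<Rightarrow> 'd phase \<Rightarrow> real" where
  "remainder \<eta> z = - (\<Sum>i\<in>UNIV. convol \<rho> (\<lambda>y. snd y $ i * dd (qdir i) \<eta> y) z)"

lemma locally_integrable_\<rho>_force: "locally_integrable (\<lambda>z. \<rho> z * force i z)"
  by (intro locally_integrable_mult_continuous locally_integrable_\<rho> smooth_continuous_on smooth_force)

lemma Cc_smooth_momentum_mult:
  "Cc_smooth k \<Longrightarrow> Cc_smooth (\<lambda>y. snd y $ i * k y)" for k :: "'d phase \<Rightarrow> real"
  by (intro Cc_smooth_mult_left smooth_snd_component)

context
  fixes \<eta> :: "'d phase \<Rightarrow> real"
  assumes \<eta>: "Cc_smooth \<eta>"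
begin

lemma smooth_flux: "smooth (flux \<eta> i)"
  unfolding flux_def[abs_def]
  by (intro smooth_add smooth_diff smooth_mult smooth_force smooth_convolution locally_integrable_\<rho>
      locally_integrable_\<rho>_force Cc_smooth_momentum_mult \<eta>)

lemma smooth_remainder: "smooth (remainder \<eta>)"
  unfolding remainder_def[abs_def]
  by (intro smooth_minus smooth_sum smooth_convolution locally_integrable_\<rho> Cc_smooth_momentum_mult Cc_smooth_dd \<eta>)

text \<open>The weak equation tested with \<open>z' \<mapsto> \<eta>(z - z')\<close>. It has the coefficients of the operator at \<open>z'\<close>; replacing them by
their values at \<open>z\<close> produces the two commutators.\<close>
lemma mollified_equation:
  "(\<Sum>i\<in>UNIV. dual_term i (convol \<rho> \<eta>) z - dd (pdir i) (flux \<eta> i) z) = remainder \<eta> z"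
proof -
  note li = locally_integrable_\<rho> locally_integrable_\<rho>_force
  note cc = \<eta> Cc_smooth_dd Cc_smooth_momentum_mult
  have dconv: "dd v (convol \<rho> \<eta>) = convol \<rho> (dd v \<eta>)"
    "dd w (convol \<rho> (dd v \<eta>)) = convol \<rho> (dd w (dd v \<eta>))" for v w
    by (simp_all add: dd_convolution locally_integrable_\<rho> \<eta> Cc_smooth_dd)
  have dp: "dd (pdir i) (\<lambda>y. snd y $ i * \<eta> y) = (\<lambda>y. \<eta> y + snd y $ i * dd (pdir i) \<eta> y)" for i
    by (rule ext) (simp add: dd_mult smooth_snd_component Cc_smoothD[OF \<eta>] dd_momentum)
  have dflux: "dd (pdir i) (flux \<eta> i) z = force i z * convol \<rho> (dd (pdir i) \<eta>) z
      - convol (\<lambda>z. \<rho> z * force i z) (dd (pdir i) \<eta>) z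
      + convol \<rho> (\<lambda>y. \<eta> y + snd y $ i * dd (pdir i) \<eta> y) z" for i
  proof -
    have s: "smooth (convol \<rho> \<eta>)" "smooth (convol (\<lambda>z. \<rho> z * force i z) \<eta>)"
      "smooth (convol \<rho> (\<lambda>y. snd y $ i * \<eta> y))"
      by (intro smooth_convolution li cc)+
    show ?thesis
      unfolding flux_def[abs_def]
      by (simp add: dd_add dd_diff dd_mult s smooth_mult smooth_diff smooth_force dd_pdir_force
          dd_convolution li cc dp)
  qed
  define \<phi> where "\<phi> = (\<lambda>z'. \<eta> (z - z'))"
  have \<phi>: "Cc_smooth \<phi>" unfolding \<phi>_def by (rule Cc_smooth_reflect[OF \<eta>])
  have d\<phi>: "dd v \<phi> = (\<lambda>z'. - dd v \<eta> (z - z'))" for v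
    unfolding \<phi>_def by (rule ext) (rule dd_reflect[OF Cc_smoothD[OF \<eta>]])
  have dd\<phi>: "dd w (dd v \<phi>) = (\<lambda>z'. dd w (dd v \<eta>) (z - z'))" for v w
    unfolding d\<phi> using Cc_smoothD[OF \<eta>]
    by (intro ext) (simp add: dd_minus dd_reflect smooth_dd smooth_reflect)
  have I: "integrable lborel (\<lambda>z'. F z' * k (z - z'))" if "locally_integrable F" "Cc_smooth k" for F k
    using locally_integrable_Cc_mult[OF that(1) Cc_smooth_reflect[OF that(2)]] .
  define J where "J i = (\<lambda>z'. \<rho> z' * (- snd z' $ i * dd (qdir i) \<eta> (z - z')
      + (force i z' + snd z' $ i) * dd (pdir i) \<eta> (z - z') + lam * dd (pdir i) (dd (pdir i) \<eta>) (z - z')))" for i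
  have each: "integrable lborel (J i) \<and> - snd z $ i * convol \<rho> (dd (qdir i) \<eta>) z + (force i z + snd z $ i) * convol \<rho> (dd (pdir i) \<eta>) z
      + convol \<rho> \<eta> z + lam * convol \<rho> (dd (pdir i) (dd (pdir i) \<eta>)) z
      - (force i z * convol \<rho> (dd (pdir i) \<eta>) z - convol (\<lambda>z. \<rho> z * force i z) (dd (pdir i) \<eta>) z
         + convol \<rho> (\<lambda>y. \<eta> y + snd y $ i * dd (pdir i) \<eta> y) z)
      + convol \<rho> (\<lambda>y. snd y $ i * dd (qdir i) \<eta> y) z
      = (LINT z'|lborel. J i z')" (is "_ \<and> ?L = _") for i
  proof -
    define a1 where "a1 z' = \<rho> z' * dd (qdir i) \<eta> (z - z')" for z'
    define a2 where "a2 z' = \<rho> z' * dd (pdir i) \<eta> (z - z')" for z'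
    define a3 where "a3 z' = \<rho> z' * \<eta> (z - z')" for z'
    define a4 where "a4 z' = \<rho> z' * dd (pdir i) (dd (pdir i) \<eta>) (z - z')" for z'
    define a5 where "a5 z' = \<rho> z' * force i z' * dd (pdir i) \<eta> (z - z')" for z'
    define a6 where "a6 z' = \<rho> z' * (\<eta> (z - z') + snd (z - z') $ i * dd (pdir i) \<eta> (z - z'))" for z'
    define a7 where "a7 z' = \<rho> z' * (snd (z - z') $ i * dd (qdir i) \<eta> (z - z'))" for z'
    have Ia: "integrable lborel a1" "integrable lborel a2" "integrable lborel a3" "integrable lborel a4"
      "integrable lborel a5" "integrable lborel a6" "integrable lborel a7"
      unfolding a1_def[abs_def] a2_def[abs_def] a3_def[abs_def] a4_def[abs_def] a5_def[abs_def] a6_def[abs_def] a7_def[abs_def]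
      by (intro I li cc I[where k="\<lambda>y. \<eta> y + snd y $ i * dd (pdir i) \<eta> y"] Cc_smooth_add
          I[where k="\<lambda>y. snd y $ i * dd (qdir i) \<eta> y"])+
    have J: "J i = (\<lambda>z'. - snd z $ i * a1 z' + (force i z + snd z $ i) * a2 z' + a3 z' + lam * a4 z'
        - (force i z * a2 z' - a5 z' + a6 z') + a7 z')"
      unfolding J_def a1_def a2_def a3_def a4_def a5_def a6_def a7_def
      by (rule ext) (simp add: algebra_simps)
    have "?L = - snd z $ i * (LINT z'|lborel. a1 z') + (force i z + snd z $ i) * (LINT z'|lborel. a2 z')
      + (LINT z'|lborel. a3 z') + lam * (LINT z'|lborel. a4 z')
      - (force i z * (LINT z'|lborel. a2 z') - (LINT z'|lborel. a5 z') + (LINT z'|lborel. a6 z')) + (LINT z'|lborel. a7 z')"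
      unfolding convol_def a1_def a2_def a3_def a4_def a5_def a6_def a7_def by (rule refl)
    also have "\<dots> = (LINT z'|lborel. J i z')" unfolding J using Ia by simp
    finally show ?thesis using Ia unfolding J by simp
  qed
  have "(LINT z'|lborel. \<rho> z' * gen \<phi> z') = (LINT z'|lborel. (\<Sum>i\<in>UNIV. J i z'))"
    unfolding gen_def dd\<phi> unfolding d\<phi> J_def
    by (simp add: sum_distrib_left algebra_simps)
  also have "\<dots> = (\<Sum>i\<in>UNIV. LINT z'|lborel. J i z')"
    using each by (intro Bochner_Integration.integral_sum) blast
  finally have "0 = (\<Sum>i\<in>UNIV. LINT z'|lborel. J i z')" using weak[OF \<phi>] by simp
  also have "\<dots> = (\<Sum>i\<in>UNIV. dual_term i (convol \<rho> \<eta>) z - dd (pdir i) (flux \<eta> i) z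
      + convol \<rho> (\<lambda>y. snd y $ i * dd (qdir i) \<eta> y) z)"
    unfolding dconv dflux each[THEN conjunct2, symmetric] by (rule refl)
  finally show ?thesis unfolding remainder_def by (simp add: sum.distrib sum_subtractf)
qed

end

lemma abs_remainder_le:
  assumes "mollifier e \<eta>"
  shows "\<bar>remainder \<eta> z\<bar> \<le> CARD('d) * C * e"
proof -
  from assms have \<eta>: "Cc_smooth \<eta>" and le: "\<And>i. (LINT z|lborel. \<bar>snd z $ i * dd (qdir i) \<eta> z\<bar>) \<le> e"
    by (auto simp: mollifier_def)
  have "\<bar>convol \<rho> (\<lambda>y. snd y $ i * dd (qdir i) \<eta> y) z\<bar> \<le> C * e" for i
  proof -
    have "\<bar>convol \<rho> (\<lambda>y. snd y $ i * dd (qdir i) \<eta> y) z\<bar> \<le> C * (LINT z|lborel. \<bar>snd z $ i * dd (qdir i) \<eta> z\<bar>)"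
      using \<rho>_nonneg \<rho>_le by (intro abs_convol_le Cc_smooth_momentum_mult Cc_smooth_dd \<eta>) auto
    also have "\<dots> \<le> C * e" by (intro mult_left_mono le C_nonneg)
    finally show ?thesis .
  qed
  then have "(\<Sum>i\<in>UNIV. \<bar>convol \<rho> (\<lambda>y. snd y $ i * dd (qdir i) \<eta> y) z\<bar>) \<le> (\<Sum>i\<in>(UNIV::'d set). C * e)"
    by (intro sum_mono)
  from order_trans[OF sum_abs this] show ?thesis by (simp add: remainder_def mult.assoc)
qed

lemma abs_convol_mollifier_le:
  assumes "mollifier e \<eta>" shows "0 \<le> convol \<rho> \<eta> z" "convol \<rho> \<eta> z \<le> C"
proof -
  from assms have \<eta>: "Cc_smooth \<eta>" "\<And>z. 0 \<le> \<eta> z" "(LINT z|lborel. \<eta> z) = 1" by (auto simp: mollifier_def)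
  have "\<bar>convol \<rho> \<eta> z\<bar> \<le> C * (LINT z|lborel. \<bar>\<eta> z\<bar>)"
    using \<rho>_nonneg \<rho>_le by (intro abs_convol_le \<eta>) auto
  then show "convol \<rho> \<eta> z \<le> C" using \<eta> by simp
  show "0 \<le> convol \<rho> \<eta> z"
    unfolding convol_def by (intro integral_nonneg_AE AE_I2 mult_nonneg_nonneg \<rho>_nonneg \<eta>)
qed

text \<open>On the support of \<open>\<eta>(z - z')\<close> the coefficients at \<open>z\<close> and \<open>z'\<close> differ by at most \<open>(L + 1) e\<close>.\<close>
lemma abs_flux_le:
  assumes m: "mollifier e \<eta>" and e: "e \<le> 1" and z: "norm z \<le> R"
    and L: "\<And>x y. norm x \<le> R \<Longrightarrow> norm (x - y) \<le> 1 \<Longrightarrow> \<bar>force i x - force i y\<bar> \<le> L * norm (x - y)" "0 \<le> L"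
  shows "\<bar>flux \<eta> i z\<bar> \<le> C * ((L + 1) * e)"
proof -
  from m have \<eta>: "Cc_smooth \<eta>" "\<And>z. 0 \<le> \<eta> z" "\<And>z. \<eta> z \<noteq> 0 \<Longrightarrow> norm z \<le> e" "(LINT z|lborel. \<eta> z) = 1"
    by (auto simp: mollifier_def)
  have I: "integrable lborel (\<lambda>z'. F z' * k (z - z'))" if "locally_integrable F" "Cc_smooth k" for F k
    using locally_integrable_Cc_mult[OF that(1) Cc_smooth_reflect[OF that(2)]] .
  note Is = I[OF locally_integrable_\<rho> \<eta>(1)] I[OF locally_integrable_\<rho>_force[of i] \<eta>(1)]
    I[OF locally_integrable_\<rho> Cc_smooth_momentum_mult[OF \<eta>(1)], of i]
  let ?G = "\<lambda>z'. force i z * (\<rho> z' * \<eta> (z - z')) - \<rho> z' * force i z' * \<eta> (z - z')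
      + \<rho> z' * (snd (z - z') $ i * \<eta> (z - z'))"
  have iG: "integrable lborel ?G"
    by (intro Bochner_Integration.integrable_add Bochner_Integration.integrable_diff integrable_mult_right Is)
  have "flux \<eta> i z = (LINT z'|lborel. ?G z')"
    using Is unfolding flux_def convol_def by simp
  also have "\<bar>\<dots>\<bar> \<le> (LINT z'|lborel. (C * ((L + 1) * e)) * \<eta> (z - z'))"
  proof (rule order_trans[OF integral_abs_bound], rule integral_mono_AE)
    show "integrable lborel (\<lambda>z'. \<bar>?G z'\<bar>)" using iG by (rule integrable_abs)
    show "integrable lborel (\<lambda>z'. (C * ((L + 1) * e)) * \<eta> (z - z'))"
      by (intro integrable_mult_right Cc_smooth_integrable Cc_smooth_reflect \<eta>)
    have "\<bar>?G z'\<bar> \<le> (C * ((L + 1) * e)) * \<eta> (z - z')" for z'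
    proof (cases "\<eta> (z - z') = 0")
      case False
      then have n: "norm (z - z') \<le> e" by (rule \<eta>(3))
      have "\<bar>force i z - force i z'\<bar> \<le> L * norm (z - z')" using n e by (intro L z) auto
      also have "\<dots> \<le> L * e" by (intro mult_left_mono n L)
      finally have 1: "\<bar>force i z - force i z'\<bar> \<le> L * e" .
      have 2: "\<bar>snd (z - z') $ i\<bar> \<le> e" using n abs_momentum_le order_trans by blast
      have "\<bar>force i z - force i z' + snd (z - z') $ i\<bar> \<le> (L + 1) * e"
        using 1 2 abs_triangle_ineq[of "force i z - force i z'" "snd (z - z') $ i"] by (simp add: algebra_simps)
      then have "\<rho> z' * \<bar>force i z - force i z' + snd (z - z') $ i\<bar> * \<eta> (z - z') \<le> C * ((L + 1) * e) * \<eta> (z - z')"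
        using \<eta>(2) \<rho>_nonneg \<rho>_le C_nonneg by (intro mult_right_mono mult_mono) auto
      moreover have "?G z' = \<rho> z' * (force i z - force i z' + snd (z - z') $ i) * \<eta> (z - z')"
        by (simp add: algebra_simps)
      ultimately show ?thesis using \<eta>(2)[of "z - z'"] \<rho>_nonneg[of z'] by (simp add: abs_mult)
    qed simp
    then show "AE z' in lborel. \<bar>?G z'\<bar> \<le> (C * ((L + 1) * e)) * \<eta> (z - z')" by (intro AE_I2)
  qed
  also have "\<dots> = C * ((L + 1) * e)"
    using lborel_integral_reflect[OF smooth_measurable[OF Cc_smoothD[OF \<eta>(1)]], of z] \<eta>(4) by simp
  finally show ?thesis .
qed

end

section \<open>Removing the mollification and the cutoff\<close>
context kinetic
begin

lemma smooth_inverse_maxwell: "smooth (\<lambda>z. inverse (maxwell z))"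
  by (intro smooth_inverse smooth_maxwell) (use maxwell_pos in \<open>metis less_irrefl\<close>)

lemma dd_bump_energy:
  "dd v (\<lambda>z. bump n (1 - energy z / N)) z
   = - ((bump (n + 2) (1 - energy z / N) - real n * bump (Suc n) (1 - energy z / N)) * dd v energy z / N)"
  by (simp add: dd_bump_compose dd_diff dd_divide_const smooth_diff smooth_divide_const smooth_const smooth_energy)

lemma smooth_bump_energy: "smooth (\<lambda>z. bump n (1 - energy z / N))"
  by (intro smooth_bump_compose smooth_diff smooth_divide_const smooth_const smooth_energy)

text \<open>The transport part of the generator vanishes on functions of the energy; only friction and diffusion contribute.\<close>
lemma gen_bump_energy:
  fixes N :: real
  defines "t \<equiv> \<lambda>z. 1 - energy z / N"
  shows "gen (\<lambda>z. bump 0 (t z)) z = (\<Sum>i\<in>UNIV. bump 2 (t z) * (snd z $ i)\<^sup>2 / N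
     + lam * ((bump 4 (t z) - 2 * bump 3 (t z)) * (snd z $ i)\<^sup>2 / N\<^sup>2 - bump 2 (t z) / N))"
proof -
  have d: "dd v (\<lambda>z. bump 0 (t z)) = (\<lambda>z. - (bump 2 (t z) * dd v energy z / N))" for v
    unfolding t_def by (rule ext) (simp add: dd_bump_energy numeral_2_eq_2)
  have dp: "dd (pdir i) (\<lambda>z. bump 0 (t z)) = (\<lambda>z. - (bump 2 (t z) * snd z $ i / N))" for i
    by (simp add: d dd_pdir_energy)
  have d2: "dd v (\<lambda>z. bump 2 (t z)) z = - ((bump 4 (t z) - 2 * bump 3 (t z)) * dd v energy z / N)" for v
    unfolding t_def using dd_bump_energy[of v 2 N z] by simp
  have s2: "smooth (\<lambda>z. bump 2 (t z))" unfolding t_def by (rule smooth_bump_energy)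
  have dpp: "dd (pdir i) (dd (pdir i) (\<lambda>z. bump 0 (t z))) z
      = (bump 4 (t z) - 2 * bump 3 (t z)) * (snd z $ i)\<^sup>2 / N\<^sup>2 - bump 2 (t z) / N" for i
    unfolding dp
    by (simp add: dd_minus dd_divide_const dd_mult s2 smooth_mult smooth_divide_const smooth_snd_component d2
        dd_pdir_energy dd_momentum power2_eq_square add_divide_distrib diff_divide_distrib)
  show ?thesis
    unfolding gen_def dpp unfolding dp d dd_qdir_energy
    by (intro sum.cong refl) (simp add: dd_pdir_energy power2_eq_square add_divide_distrib algebra_simps)
qed

end

context kinetic_solution
begin

lemma energy_ge: "B \<le> energy z"
  using U_ge[of "fst z"] by (simp add: energy_def add_increasing)

lemma momentum_square_le: "(norm (snd z))\<^sup>2 \<le> 2 * (energy z - B)"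
  using U_ge[of "fst z"] by (simp add: energy_def)

lemma energy_sublevel_bounded: "bounded {z. energy z \<le> S}"
proof -
  have "norm (snd z) \<le> sqrt (2 * (S - B))" if "energy z \<le> S" for z
    by (rule real_le_rsqrt, rule order_trans[OF momentum_square_le]) (use that in simp)
  moreover have "U (fst z) \<le> S" if "energy z \<le> S" for z
    using that zero_le_power2[of "norm (snd z)"] unfolding energy_def by linarith
  ultimately have "{z. energy z \<le> S} \<subseteq> {q. U q \<le> S} \<times> cball 0 (sqrt (2 * (S - B)))" by auto
  then show ?thesis by (rule bounded_subset[OF bounded_Times[OF U_proper bounded_cball]])
qed

definition cutoff :: "nat \<Rightarrow> 'd phase \<Rightarrow> real" where
  "cutoff k z = bump 0 (1 - energy z / real (Suc k))"

lemma Cc_smooth_cutoff: "Cc_smooth (cutoff k)"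
  unfolding Cc_smooth_def
proof
  show "smooth (cutoff k)" unfolding cutoff_def[abs_def] by (rule smooth_bump_energy)
  have "{z. cutoff k z \<noteq> 0} \<subseteq> {z. energy z \<le> real (Suc k)}"
    by (auto simp: cutoff_def bump_eq_0_iff field_simps)
  then show "bounded {z. cutoff k z \<noteq> 0}" by (rule bounded_subset[OF energy_sublevel_bounded])
qed

lemma cutoff_nonneg: "0 \<le> cutoff k z" by (simp add: cutoff_def bump_nonneg)

lemma cutoff_transport: "snd z $ i * dd (qdir i) (cutoff k) z = force i z * dd (pdir i) (cutoff k) z"
  unfolding cutoff_def[abs_def] by (simp add: dd_bump_energy dd_qdir_energy dd_pdir_energy)

text \<open>Where the energy is at most half of the cutoff level, the argument of \<open>exp (- 1/t)\<close> is at least \<open>1/2\<close>.\<close>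
lemma cutoff_eventually_ge: "\<exists>k0. \<forall>k\<ge>k0. \<forall>z. norm z \<le> R \<longrightarrow> exp (-2) \<le> cutoff k z"
proof -
  obtain E where E: "\<And>z. norm z \<le> R \<Longrightarrow> energy z \<le> E"
    using continuous_bounded_on_cball[OF smooth_continuous_on[OF smooth_energy]] by (meson abs_le_D1)
  obtain k0 :: nat where k0: "2 * E \<le> real k0" using real_arch_simple by blast
  have "exp (-2) \<le> cutoff k z" if "k0 \<le> k" "norm z \<le> R" for k z
  proof -
    have "energy z \<le> real (Suc k) / 2" using E[OF that(2)] k0 that(1) by simp
    then have t: "1 / 2 \<le> 1 - energy z / real (Suc k)" by (simp add: field_simps)
    then have "inverse (1 - energy z / real (Suc k)) \<le> inverse (1 / 2)" by (intro le_imp_inverse_le) auto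
    with t show ?thesis by (simp add: cutoff_def bump_def)
  qed
  then show ?thesis by blast
qed

lemma gen_cutoff_bound:
  "\<exists>S\<ge>0. \<forall>k z. \<bar>gen (cutoff k) z\<bar> \<le> (\<Sum>i\<in>UNIV. S * (snd z $ i)\<^sup>2 / real (Suc k)
     + lam * (3 * S * (snd z $ i)\<^sup>2 / (real (Suc k))\<^sup>2 + S / real (Suc k)))
     \<and> (gen (cutoff k) z \<noteq> 0 \<longrightarrow> energy z < real (Suc k))"
proof -
  let ?T = "1 + \<bar>B\<bar>"
  obtain S2 S3 S4 where S: "0 \<le> S2" "0 \<le> S3" "0 \<le> S4" "\<And>t. t \<le> ?T \<Longrightarrow> bump 2 t \<le> S2"
    "\<And>t. t \<le> ?T \<Longrightarrow> bump 3 t \<le> S3" "\<And>t. t \<le> ?T \<Longrightarrow> bump 4 t \<le> S4"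
    using bump_bounded[of ?T 2] bump_bounded[of ?T 3] bump_bounded[of ?T 4] by metis
  define S where "S = S2 + S3 + S4"
  have S0: "0 \<le> S" using S by (simp add: S_def)
  have bS: "bump 2 t \<le> S" "bump 3 t \<le> S" "bump 4 t \<le> S" if "t \<le> ?T" for t
    using S(1-3) S(4-6)[OF that] by (auto simp: S_def)
  show ?thesis
  proof (intro exI[of _ S] conjI S0 allI impI)
    fix k z
    let ?N = "real (Suc k)"
    let ?t = "1 - energy z / ?N"
    have N: "1 \<le> ?N" by simp
    have "- energy z / ?N \<le> \<bar>B\<bar> / ?N" using energy_ge[of z] by (intro divide_right_mono) auto
    also have "\<bar>B\<bar> / ?N \<le> \<bar>B\<bar> / 1" by (intro divide_left_mono) auto
    finally have t: "?t \<le> ?T" by simp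
    have g: "gen (cutoff k) z = (\<Sum>i\<in>UNIV. bump 2 ?t * (snd z $ i)\<^sup>2 / ?N
     + lam * ((bump 4 ?t - 2 * bump 3 ?t) * (snd z $ i)\<^sup>2 / ?N\<^sup>2 - bump 2 ?t / ?N))"
      unfolding cutoff_def[abs_def] by (rule gen_bump_energy)
    have "\<bar>bump 2 ?t * (snd z $ i)\<^sup>2 / ?N + lam * ((bump 4 ?t - 2 * bump 3 ?t) * (snd z $ i)\<^sup>2 / ?N\<^sup>2 - bump 2 ?t / ?N)\<bar>
        \<le> S * (snd z $ i)\<^sup>2 / ?N + lam * (3 * S * (snd z $ i)\<^sup>2 / ?N\<^sup>2 + S / ?N)" for i
    proof -
      let ?p = "(snd z $ i)\<^sup>2"
      have b: "0 \<le> bump 2 ?t" "0 \<le> bump 3 ?t" "0 \<le> bump 4 ?t" by (simp_all add: bump_nonneg)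
      have 1: "\<bar>bump 2 ?t * ?p / ?N\<bar> \<le> S * ?p / ?N"
        using b bS[OF t] by (simp add: abs_mult divide_right_mono mult_right_mono del: of_nat_Suc)
      have "\<bar>bump 4 ?t - 2 * bump 3 ?t\<bar> \<le> 3 * S" using b bS[OF t] by linarith
      then have 2: "\<bar>(bump 4 ?t - 2 * bump 3 ?t) * ?p / ?N\<^sup>2\<bar> \<le> 3 * S * ?p / ?N\<^sup>2"
        by (simp add: abs_mult divide_right_mono mult_right_mono del: of_nat_Suc)
      have 3: "\<bar>bump 2 ?t / ?N\<bar> \<le> S / ?N"
        using b bS[OF t] by (simp add: divide_right_mono del: of_nat_Suc)
      have "\<bar>(bump 4 ?t - 2 * bump 3 ?t) * ?p / ?N\<^sup>2 - bump 2 ?t / ?N\<bar> \<le> 3 * S * ?p / ?N\<^sup>2 + S / ?N"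
        using 2 3 by linarith
      then have "\<bar>lam * ((bump 4 ?t - 2 * bump 3 ?t) * ?p / ?N\<^sup>2 - bump 2 ?t / ?N)\<bar> \<le> lam * (3 * S * ?p / ?N\<^sup>2 + S / ?N)"
        unfolding abs_mult using lam_pos by (simp add: mult_left_mono del: of_nat_Suc)
      with 1 show ?thesis by linarith
    qed
    then show "\<bar>gen (cutoff k) z\<bar> \<le> (\<Sum>i\<in>UNIV. S * (snd z $ i)\<^sup>2 / ?N + lam * (3 * S * (snd z $ i)\<^sup>2 / ?N\<^sup>2 + S / ?N))"
      unfolding g by (intro order_trans[OF sum_abs] sum_mono)
    assume "gen (cutoff k) z \<noteq> 0"
    then have "\<not> ?t \<le> 0" unfolding g using bump_eq_0_iff[of 2 ?t] bump_eq_0_iff[of 3 ?t] bump_eq_0_iff[of 4 ?t]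
      by auto
    then show "energy z < ?N" by (simp add: field_simps)
  qed
qed

text \<open>Dominated convergence: for fixed \<open>z\<close> the bound of \<open>gen_cutoff_bound\<close> tends to \<open>0\<close>, and on the support of the cutoff
\<open>|p|^2 \<le> 2 (H - B)\<close> is at most a fixed multiple \<open>T\<close> of the cutoff level, which bounds it uniformly.\<close>
lemma gen_cutoff_integral_tendsto_0:
  "(\<lambda>k. LINT z|lborel. \<rho> z * \<bar>gen (cutoff k) z\<bar>) \<longlonglongrightarrow> 0"
proof -
  obtain S where S0: "0 \<le> S" and S: "\<And>k z. \<bar>gen (cutoff k) z\<bar> \<le> (\<Sum>i\<in>UNIV. S * (snd z $ i)\<^sup>2 / real (Suc k)
     + lam * (3 * S * (snd z $ i)\<^sup>2 / (real (Suc k))\<^sup>2 + S / real (Suc k)))"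
     "\<And>k z. gen (cutoff k) z \<noteq> 0 \<Longrightarrow> energy z < real (Suc k)"
    using gen_cutoff_bound by blast
  define T where "T = 2 * (1 + \<bar>B\<bar>)"
  define D where "D = CARD('d) * (S * T + lam * (3 * S * T + S))"
  have T0: "0 \<le> T" by (simp add: T_def)
  have D0: "0 \<le> D" using S0 T0 lam_pos by (simp add: D_def)
  have bound: "\<bar>gen (cutoff k) z\<bar> \<le> D" for k z
  proof (cases "gen (cutoff k) z = 0")
    case False
    let ?N = "real (Suc k)"
    have N: "1 \<le> ?N" by simp
    have p: "(snd z $ i)\<^sup>2 \<le> T * ?N" for i
    proof -
      have "(snd z $ i)\<^sup>2 \<le> (norm (snd z))\<^sup>2"
        using component_le_norm_cart[of "snd z" i] by (simp add: abs_le_square_iff[symmetric])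
      also have "\<dots> \<le> 2 * (?N - B)" 
        by (rule order_trans[OF momentum_square_le]) (use S(2)[OF False] in simp)
      also have "\<dots> \<le> 2 * (?N + \<bar>B\<bar> * ?N)"
        using N mult_left_mono[of 1 ?N "\<bar>B\<bar>"] by (simp del: of_nat_Suc)
      finally show ?thesis by (simp add: T_def algebra_simps)
    qed
    have "S * (snd z $ i)\<^sup>2 / ?N + lam * (3 * S * (snd z $ i)\<^sup>2 / ?N\<^sup>2 + S / ?N) \<le> S * T + lam * (3 * S * T + S)" for i
    proof -
      have "(snd z $ i)\<^sup>2 / ?N \<le> T" using p[of i] by (simp add: pos_divide_le_eq del: of_nat_Suc)
      then have 1: "S * ((snd z $ i)\<^sup>2 / ?N) \<le> S * T" by (intro mult_left_mono S0)
      have "(snd z $ i)\<^sup>2 / ?N / ?N \<le> T / 1"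
        using \<open>(snd z $ i)\<^sup>2 / ?N \<le> T\<close> N T0 by (intro frac_le) (auto simp del: of_nat_Suc)
      then have 2: "3 * S * ((snd z $ i)\<^sup>2 / ?N\<^sup>2) \<le> 3 * S * T"
        using S0 by (intro mult_left_mono) (auto simp: power2_eq_square simp del: of_nat_Suc)
      have 3: "S / ?N \<le> S" using S0 N by (simp add: divide_le_eq mult_le_cancel_left1 del: of_nat_Suc)
      have "lam * (3 * S * ((snd z $ i)\<^sup>2 / ?N\<^sup>2) + S / ?N) \<le> lam * (3 * S * T + S)"
        by (rule mult_left_mono[OF add_mono[OF 2 3]]) (use lam_pos in simp)
      with 1 show ?thesis by simp
    qed
    then have "(\<Sum>i\<in>UNIV. S * (snd z $ i)\<^sup>2 / ?N + lam * (3 * S * (snd z $ i)\<^sup>2 / ?N\<^sup>2 + S / ?N))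
        \<le> (\<Sum>i\<in>(UNIV::'d set). S * T + lam * (3 * S * T + S))" by (intro sum_mono)
    also have "\<dots> = D" by (simp add: D_def)
    finally show ?thesis using S(1)[of k z] by linarith
  qed (use D0 in simp)
  have [measurable]: "gen (cutoff k) \<in> borel_measurable borel" for k
    by (intro smooth_measurable Cc_smoothD Cc_smooth_gen Cc_smooth_cutoff)
  have "(\<lambda>k. LINT z|lborel. \<rho> z * \<bar>gen (cutoff k) z\<bar>) \<longlonglongrightarrow> (LINT z|(lborel :: 'd phase measure). (0 :: real))"
  proof (rule integral_dominated_convergence[where w="\<lambda>z. D * \<rho> z"])
    show "integrable lborel (\<lambda>z. D * \<rho> z)" using integrable_\<rho> by simp
    show "AE z in lborel. norm (\<rho> z * \<bar>gen (cutoff k) z\<bar>) \<le> D * \<rho> z" for k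
      using mult_left_mono[OF bound \<rho>_nonneg] by (intro AE_I2) (simp add: abs_mult \<rho>_nonneg mult.commute)
    show "AE z in lborel. (\<lambda>k. \<rho> z * \<bar>gen (cutoff k) z\<bar>) \<longlonglongrightarrow> 0"
    proof (rule AE_I2)
      fix z :: "'d phase"
      have N: "(\<lambda>k. c / real (Suc k)) \<longlonglongrightarrow> 0" for c
        using LIMSEQ_Suc[OF lim_const_over_n[of c]] .
      have N2: "(\<lambda>k. c / (real (Suc k))\<^sup>2) \<longlonglongrightarrow> 0" for c
        using tendsto_mult[OF N[of c] N[of 1]] by (simp add: power2_eq_square)
      have "(\<lambda>k. \<Sum>i\<in>UNIV. S * (snd z $ i)\<^sup>2 / real (Suc k)
         + lam * (3 * S * (snd z $ i)\<^sup>2 / (real (Suc k))\<^sup>2 + S / real (Suc k))) \<longlonglongrightarrow> (\<Sum>i\<in>(UNIV::'d set). 0 + lam * (0 + 0))"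
        by (intro tendsto_sum tendsto_add tendsto_mult_left N N2)
      then have "(\<lambda>k. \<Sum>i\<in>UNIV. S * (snd z $ i)\<^sup>2 / real (Suc k)
         + lam * (3 * S * (snd z $ i)\<^sup>2 / (real (Suc k))\<^sup>2 + S / real (Suc k))) \<longlonglongrightarrow> 0" by simp
      then have "(\<lambda>k. \<bar>gen (cutoff k) z\<bar>) \<longlonglongrightarrow> 0"
        by (rule Lim_null_comparison[rotated]) (use S(1) in auto)
      then show "(\<lambda>k. \<rho> z * \<bar>gen (cutoff k) z\<bar>) \<longlonglongrightarrow> 0" by (rule tendsto_mult_right_zero)
    qed
  qed measurable
  then show ?thesis by simp
qed

context
  fixes \<eta> :: "nat \<Rightarrow> 'd phase \<Rightarrow> real"
  assumes mol: "\<And>n. mollifier (1 / real (Suc n)) (\<eta> n)"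
begin

lemma mol_Cc: "Cc_smooth (\<eta> n)" using mol[of n] by (simp add: mollifier_def)

lemma convol_weak_tendsto:
  assumes \<theta>: "continuous_on UNIV \<theta>" "\<And>z. R < norm z \<Longrightarrow> \<theta> z = 0"
  shows "(\<lambda>n. LINT z|lborel. convol \<rho> (\<eta> n) z * \<theta> z) \<longlonglongrightarrow> (LINT z|lborel. \<rho> z * \<theta> z)"
proof (rule LIMSEQ_I)
  fix s :: real assume "0 < s"
  define J where "J = (LINT z|lborel. \<bar>\<rho> z\<bar>)"
  have J: "0 \<le> J" unfolding J_def by (intro integral_nonneg_AE AE_I2) simp
  define s' where "s' = s / (J + 1)"
  have s': "0 < s'" "s' * J < s" using \<open>0 < s\<close> J by (auto simp: s'_def field_simps)
  obtain e where e: "0 < e" "\<And>z z'. norm (z - z') \<le> e \<Longrightarrow> \<bar>\<theta> z - \<theta> z'\<bar> \<le> s'"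
    using uniformly_continuous_compact_support[OF \<theta> s'(1)] by blast
  obtain n0 where n0: "1 / real (Suc n0) < e" using reals_Archimedean[OF e(1)] by (auto simp: inverse_eq_divide)
  have "norm ((LINT z|lborel. convol \<rho> (\<eta> n) z * \<theta> z) - (LINT z|lborel. \<rho> z * \<theta> z)) < s" if "n0 \<le> n" for n
  proof -
    have "1 / real (Suc n) \<le> 1 / real (Suc n0)" using that by (intro divide_left_mono) auto
    then have "1 / real (Suc n) \<le> e" using n0 by linarith
    then have "\<bar>(LINT z|lborel. convol \<rho> (\<eta> n) z * \<theta> z) - (LINT z|lborel. \<rho> z * \<theta> z)\<bar> \<le> s' * J"
      unfolding J_def by (intro convol_weak_approx[OF integrable_\<rho> \<theta> _ mol] e(2)) auto
    with s' show ?thesis by simp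
  qed
  then show "\<exists>n0. \<forall>n\<ge>n0. norm ((LINT z|lborel. convol \<rho> (\<eta> n) z * \<theta> z) - (LINT z|lborel. \<rho> z * \<theta> z)) < s" by blast
qed

text \<open>The function \<open>f = u/M\<close> of the energy estimate for the mollified density \<open>u\<close>; in \<open>dissipation\<close> below, the factor
\<open>2 (1 + f)^(-3)\<close> is \<open>\<beta>''(f)\<close>.\<close>
definition ratio :: "nat \<Rightarrow> 'd phase \<Rightarrow> real" where
  "ratio n z = inverse (maxwell z) * convol \<rho> (\<eta> n) z"

lemma maxwell_ratio: "maxwell z * ratio n z = convol \<rho> (\<eta> n) z"
  using maxwell_pos[of z] by (simp add: ratio_def)

lemma smooth_ratio: "smooth (ratio n)"
  unfolding ratio_def[abs_def]
  by (intro smooth_mult smooth_inverse_maxwell smooth_convolution locally_integrable_\<rho> mol_Cc)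

lemma ratio_nonneg: "0 \<le> ratio n z"
  using maxwell_pos[of z] abs_convol_mollifier_le(1)[OF mol, of n z] by (simp add: ratio_def)

definition dissipation :: "nat \<Rightarrow> ('d phase \<Rightarrow> real) \<Rightarrow> real" where
  "dissipation n \<zeta> = (LINT z|lborel. (\<Sum>i\<in>UNIV. maxwell z * (dd (pdir i) (ratio n) z)\<^sup>2
     * (2 * inverse (1 + ratio n z) ^ 3) * \<zeta> z))"

text \<open>\<open>energy_inequality\<close> for the mollified density, with \<open>\<kappa>\<close> proportional to the mollification parameter.\<close>
lemma dissipation_bound:
  assumes \<zeta>: "Cc_smooth \<zeta>" "\<And>z. 0 \<le> \<zeta> z"
    and transport: "\<And>i z. snd z $ i * dd (qdir i) \<zeta> z = force i z * dd (pdir i) \<zeta> z"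
  obtains T where "\<And>n. lam / 2 * dissipation n \<zeta> \<le> T n" "T \<longlonglongrightarrow> (LINT z|lborel. \<rho> z * \<bar>gen \<zeta> z\<bar>)"
proof -
  obtain R where R: "\<And>z. R < norm z \<Longrightarrow> \<zeta> z = 0"
    using Cc_smooth_support[OF \<zeta>(1)] by blast
  have "\<exists>L\<ge>0. \<forall>x y. norm x \<le> R \<longrightarrow> norm (x - y) \<le> 1 \<longrightarrow> \<bar>force i x - force i y\<bar> \<le> L * norm (x - y)" for i
    by (rule smooth_lipschitz_cball[OF smooth_force])
  then obtain L where L: "\<And>i. 0 \<le> L i" "\<And>i x y. norm x \<le> R \<Longrightarrow> norm (x - y) \<le> 1 \<Longrightarrow> \<bar>force i x - force i y\<bar> \<le> L i * norm (x - y)"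
    by metis
  define K where "K = C * ((\<Sum>i\<in>UNIV. L i) + 1) + CARD('d) * C"
  define \<kappa> where "\<kappa> n = K * (1 / real (Suc n))" for n
  have flux: "\<bar>flux (\<eta> n) i z\<bar> \<le> \<kappa> n" if "norm z \<le> R" for n i z
  proof -
    have "\<bar>flux (\<eta> n) i z\<bar> \<le> C * ((L i + 1) * (1 / real (Suc n)))"
      by (rule abs_flux_le[OF mol _ that]) (use L in auto)
    also have "\<dots> = (C * (L i + 1)) * (1 / real (Suc n))" by simp
    also have "\<dots> \<le> \<kappa> n"
    proof -
      have "L i \<le> (\<Sum>i\<in>UNIV. L i)" by (rule member_le_sum) (use L in auto)
      then have "C * (L i + 1) \<le> C * ((\<Sum>i\<in>UNIV. L i) + 1)" using C_nonneg by (intro mult_left_mono) auto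
      moreover have "0 \<le> CARD('d) * C" using C_nonneg by simp
      ultimately have "C * (L i + 1) \<le> K" unfolding K_def by linarith
      then show ?thesis unfolding \<kappa>_def by (intro mult_right_mono) auto
    qed
    finally show ?thesis .
  qed
  have rem: "\<bar>remainder (\<eta> n) z\<bar> \<le> \<kappa> n" for n z
  proof -
    have "\<bar>remainder (\<eta> n) z\<bar> \<le> CARD('d) * C * (1 / real (Suc n))" by (rule abs_remainder_le[OF mol])
    also have "\<dots> \<le> \<kappa> n" unfolding \<kappa>_def K_def using C_nonneg L(1)
      by (intro mult_right_mono) (auto intro!: mult_nonneg_nonneg add_nonneg_nonneg sum_nonneg)
    finally show ?thesis .
  qed
  define T where "T n = (LINT z|lborel. convol \<rho> (\<eta> n) z * \<bar>gen \<zeta> z\<bar>)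
      + (\<kappa> n)\<^sup>2 * (LINT z|lborel. (\<Sum>i\<in>(UNIV::'d set). inverse (lam * maxwell z) * \<zeta> z))
      + \<kappa> n * (LINT z|lborel. (\<Sum>i\<in>UNIV. \<bar>dd (pdir i) \<zeta> z\<bar>)) + \<kappa> n * (LINT z|lborel. \<zeta> z)" for n
  show ?thesis
  proof
    fix n
    have mr: "(\<lambda>z. maxwell z * ratio n z) = convol \<rho> (\<eta> n)"
      by (rule ext) (rule maxwell_ratio)
    show "lam / 2 * dissipation n \<zeta> \<le> T n"
      unfolding dissipation_def T_def maxwell_ratio[symmetric]
    proof (rule energy_inequality[where R=R and g="flux (\<eta> n)" and r="remainder (\<eta> n)"])
      show "(\<Sum>i\<in>UNIV. dual_term i (\<lambda>z. maxwell z * ratio n z) z - dd (pdir i) (flux (\<eta> n) i) z)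
          = remainder (\<eta> n) z" for z
        unfolding mr maxwell_ratio by (rule mollified_equation[OF mol_Cc])
    qed (rule smooth_ratio ratio_nonneg \<zeta> R smooth_flux[OF mol_Cc]
        smooth_remainder[OF mol_Cc] transport flux rem; assumption)+
  next
    have "(\<lambda>n. 1 / real (Suc n)) \<longlonglongrightarrow> 0" using LIMSEQ_Suc[OF lim_const_over_n[of 1]] by simp
    then have \<kappa>: "\<kappa> \<longlonglongrightarrow> 0" unfolding \<kappa>_def[abs_def] by (rule tendsto_mult_right_zero)
    have "gen \<zeta> z = 0" if "R < norm z" for z
      using dd_eq_0_outside[of R \<zeta>, OF R that] dd_eq_0_outside[of R "dd a \<zeta>" for a, OF dd_eq_0_outside[of R \<zeta>, OF R] that]
      by (simp add: gen_def)
    then have "(\<lambda>n. LINT z|lborel. convol \<rho> (\<eta> n) z * \<bar>gen \<zeta> z\<bar>) \<longlonglongrightarrow> (LINT z|lborel. \<rho> z * \<bar>gen \<zeta> z\<bar>)"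
      by (intro convol_weak_tendsto[where R=R] continuous_on_rabs smooth_continuous_on Cc_smoothD Cc_smooth_gen \<zeta>) auto
    moreover have "(\<lambda>n. (\<kappa> n)\<^sup>2) \<longlonglongrightarrow> 0" using tendsto_power[OF \<kappa>, of 2] by simp
    ultimately have "T \<longlonglongrightarrow> (LINT z|lborel. \<rho> z * \<bar>gen \<zeta> z\<bar>) + 0 + 0 + 0"
      unfolding T_def[abs_def] by (intro tendsto_add tendsto_mult_left_zero \<kappa>)
    then show "T \<longlonglongrightarrow> (LINT z|lborel. \<rho> z * \<bar>gen \<zeta> z\<bar>)" by simp
  qed
qed

text \<open>After integration by parts, Young's inequality with weight \<open>s\<close> compares the integral with \<open>\<integral> |\<partial>f/\<partial>p_i|^2\<close> over the
support of \<open>\<psi>\<close>. There \<open>M\<close>, \<open>\<beta>''(f)\<close> and the cutoff are bounded below, uniformly in the mollification and in the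
cutoff level \<open>k\<close>, so this integral is controlled by the dissipation.\<close>
lemma momentum_derivative_bound:
  assumes \<psi>: "Cc_smooth \<psi>"
  obtains c k0 where "0 < c" "\<And>s n k. 0 < s \<Longrightarrow> k0 \<le> k \<Longrightarrow>
    \<bar>LINT z|lborel. ratio n z * dd (pdir i) \<psi> z\<bar>
      \<le> c / s * dissipation n (cutoff k) + s * (LINT z|lborel. (\<psi> z)\<^sup>2)"
proof -
  obtain R where R: "\<And>z. R < norm z \<Longrightarrow> \<psi> z = 0"
    using Cc_smooth_support[OF \<psi>] by blast
  obtain k0 where k0: "\<And>k z. k0 \<le> k \<Longrightarrow> norm z \<le> R \<Longrightarrow> exp (-2) \<le> cutoff k z"
    using cutoff_eventually_ge[of R] by blast
  obtain W where W: "\<And>z. norm z \<le> R \<Longrightarrow> inverse (maxwell z) \<le> W"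
    using continuous_bounded_on_cball[OF smooth_continuous_on[OF smooth_inverse_maxwell]] by (meson abs_le_D1)
  define W' where "W' = max W 1"
  have W': "1 \<le> W'" "\<And>z. norm z \<le> R \<Longrightarrow> inverse (maxwell z) \<le> W'" using W by (auto simp: W'_def le_max_iff_disj)
  \<comment> \<open>The three factors are the inverses of the lower bounds for \<open>M\<close>, \<open>\<beta>''(f)/2\<close> and the cutoff.\<close>
  define c where "c = W' * (1 + W' * C) ^ 3 * exp 2"
  have f: "ratio n z \<le> W' * C" if "norm z \<le> R" for n z
    unfolding ratio_def
    using W'(2)[OF that] abs_convol_mollifier_le[OF mol, of n z] maxwell_pos[of z] W'(1) by (intro mult_mono) auto
  have c: "0 < c" using W'(1) C_nonneg by (simp add: c_def add_pos_nonneg)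
  have key: "(dd (pdir i) (ratio n) z)\<^sup>2
      \<le> c * (\<Sum>i\<in>UNIV. maxwell z * (dd (pdir i) (ratio n) z)\<^sup>2
         * (2 * inverse (1 + ratio n z) ^ 3) * cutoff k z)" if k: "k0 \<le> k" and z: "norm z \<le> R" for n k z
  proof -
    let ?f = "ratio n z"
    let ?A = "\<lambda>i. maxwell z * (dd (pdir i) (ratio n) z)\<^sup>2 * (2 * inverse (1 + ?f) ^ 3) * cutoff k z"
    have f0: "0 \<le> ?f" by (rule ratio_nonneg)
    have "1 \<le> W' * maxwell z" using W'(2)[OF z] maxwell_pos[of z] by (simp add: field_simps)
    moreover have "1 \<le> (1 + W' * C) ^ 3 * inverse (1 + ?f) ^ 3"
    proof -
      have "1 \<le> (1 + W' * C) * inverse (1 + ?f)" using f[OF z, of n] f0 by (simp add: field_simps)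
      then have "1 \<le> ((1 + W' * C) * inverse (1 + ?f)) ^ 3" by (rule one_le_power)
      then show ?thesis by (simp add: power_mult_distrib)
    qed
    moreover have "1 \<le> exp 2 * cutoff k z"
      using mult_left_mono[OF k0[OF k z], of "exp 2"] by (simp flip: exp_add)
    ultimately have "1 * (1 * 1) \<le> (W' * maxwell z) * (((1 + W' * C) ^ 3 * inverse (1 + ?f) ^ 3) * (exp 2 * cutoff k z))"
      by (intro mult_mono) auto
    then have "1 \<le> 2 * ((W' * maxwell z) * (((1 + W' * C) ^ 3 * inverse (1 + ?f) ^ 3) * (exp 2 * cutoff k z)))"
      by linarith
    then have "(dd (pdir i) (ratio n) z)\<^sup>2 * 1 \<le> (dd (pdir i) (ratio n) z)\<^sup>2
      * (2 * ((W' * maxwell z) * (((1 + W' * C) ^ 3 * inverse (1 + ?f) ^ 3) * (exp 2 * cutoff k z))))"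
      by (intro mult_left_mono) auto
    then have "(dd (pdir i) (ratio n) z)\<^sup>2 \<le> c * ?A i"
      by (simp add: c_def mult_ac)
    also have "\<dots> \<le> c * (\<Sum>i\<in>UNIV. ?A i)"
      using c f0 maxwell_pos[of z] cutoff_nonneg[of k z]
      by (intro mult_left_mono member_le_sum) (auto intro!: mult_nonneg_nonneg)
    finally show ?thesis .
  qed
  show ?thesis
  proof
    show "0 < c" by fact
    fix s :: real and n k assume s: "0 < s" and k: "k0 \<le> k"
    let ?A = "\<lambda>z. \<Sum>i\<in>UNIV. maxwell z * (dd (pdir i) (ratio n) z)\<^sup>2
         * (2 * inverse (1 + ratio n z) ^ 3) * cutoff k z"
    have nz: "1 + ratio n z \<noteq> 0" for z using ratio_nonneg[of n z] by linarith
    have iA: "integrable lborel ?A"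
      by (intro Cc_smooth_integrable Cc_smooth_sum Cc_smooth_mult_left Cc_smooth_cutoff smooth_mult smooth_maxwell
          smooth_power smooth_dd smooth_ratio smooth_inverse smooth_add smooth_const nz)
    have A0: "0 \<le> ?A z" for z
      using maxwell_pos[of z] cutoff_nonneg[of k z] ratio_nonneg[of n z]
      by (intro sum_nonneg mult_nonneg_nonneg) auto
    have i2: "integrable lborel (\<lambda>z. (\<psi> z)\<^sup>2)"
      unfolding power2_eq_square by (intro Cc_smooth_integrable Cc_smooth_mult_left \<psi> Cc_smoothD[OF \<psi>])
    have iP: "integrable lborel (\<lambda>z. dd (pdir i) (ratio n) z * \<psi> z)"
      by (intro Cc_smooth_integrable Cc_smooth_mult_left smooth_dd smooth_ratio \<psi>)
    have iP': "integrable lborel (\<lambda>z. ratio n z * dd (pdir i) \<psi> z)"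
      by (intro Cc_smooth_integrable Cc_smooth_mult_left Cc_smooth_dd smooth_ratio \<psi>)
    have "(LINT z|lborel. dd (pdir i) (\<lambda>z. ratio n z * \<psi> z) z) = 0"
      by (intro integral_dd_eq_0 Cc_smooth_mult_left smooth_ratio \<psi>)
    then have "(LINT z|lborel. ratio n z * dd (pdir i) \<psi> z)
        = - (LINT z|lborel. dd (pdir i) (ratio n) z * \<psi> z)"
      using iP iP' by (simp add: dd_mult smooth_ratio Cc_smoothD[OF \<psi>])
    then have "\<bar>LINT z|lborel. ratio n z * dd (pdir i) \<psi> z\<bar>
        = \<bar>LINT z|lborel. dd (pdir i) (ratio n) z * \<psi> z\<bar>" by simp
    also have "\<dots> \<le> (LINT z|lborel. c / s * ?A z + s * (\<psi> z)\<^sup>2)"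
    proof (rule order_trans[OF integral_abs_bound], rule integral_mono_AE)
      have "\<bar>dd (pdir i) (ratio n) z * \<psi> z\<bar> \<le> c / s * ?A z + s * (\<psi> z)\<^sup>2" for z
      proof (cases "norm z \<le> R")
        case True
        let ?a = "dd (pdir i) (ratio n) z"
        have "\<bar>?a * \<psi> z\<bar> \<le> ?a\<^sup>2 / s + s * (\<psi> z)\<^sup>2"
        proof -
          have "\<bar>\<psi> z\<bar> * \<bar>?a\<bar> \<le> inverse s / 2 * \<bar>?a\<bar>\<^sup>2 + \<bar>\<psi> z\<bar>\<^sup>2 / (2 * inverse s)"
            using s by (intro young_bound) simp
          also have "\<dots> = (?a\<^sup>2 / s + s * (\<psi> z)\<^sup>2) / 2" by (simp add: field_simps)
          also have "\<dots> \<le> ?a\<^sup>2 / s + s * (\<psi> z)\<^sup>2"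
          proof -
            have half: "x / 2 \<le> x" if "0 \<le> x" for x :: real using that by simp
            show ?thesis by (rule half) (use s in simp)
          qed
          finally show ?thesis by (simp add: abs_mult mult.commute)
        qed
        also have "?a\<^sup>2 / s \<le> c * ?A z / s" using key[OF k True, of n] s by (intro divide_right_mono) auto
        finally show ?thesis by simp
      next
        case False
        then show ?thesis using R[of z] A0[of z] c s by simp
      qed
      then show "AE z in lborel. \<bar>dd (pdir i) (ratio n) z * \<psi> z\<bar> \<le> c / s * ?A z + s * (\<psi> z)\<^sup>2"
        by (intro AE_I2)
    qed (intro integrable_abs iP Bochner_Integration.integrable_add integrable_mult_right iA i2)+
    also have "\<dots> = c / s * dissipation n (cutoff k) + s * (LINT z|lborel. (\<psi> z)\<^sup>2)"
      unfolding dissipation_def using iA i2 by simp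
    finally show "\<bar>LINT z|lborel. ratio n z * dd (pdir i) \<psi> z\<bar>
      \<le> c / s * dissipation n (cutoff k) + s * (LINT z|lborel. (\<psi> z)\<^sup>2)" .
  qed
qed

end

text \<open>Three limits in this order: the mollification is removed for a fixed cutoff and a fixed weight \<open>s\<close>, then the cutoff,
which makes the dissipation vanish, and finally \<open>s\<close> tends to \<open>0\<close>.\<close>
lemma weak_momentum_derivative_zero:
  assumes \<psi>: "Cc_smooth \<psi>"
  shows "(LINT z|lborel. (\<rho> z * inverse (maxwell z)) * dd (pdir i) \<psi> z) = 0"
proof -
  have "\<forall>n. \<exists>\<eta> :: 'd phase \<Rightarrow> real. mollifier (1 / real (Suc n)) \<eta>"
    by (intro allI mollifier_exists) simp
  then obtain \<eta> :: "nat \<Rightarrow> 'd phase \<Rightarrow> real" where mol: "\<And>n. mollifier (1 / real (Suc n)) (\<eta> n)" by metis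
  let ?a = "\<lambda>n. LINT z|lborel. ratio \<eta> n z * dd (pdir i) \<psi> z"
  let ?l = "LINT z|lborel. (\<rho> z * inverse (maxwell z)) * dd (pdir i) \<psi> z"
  define N where "N = (LINT z|lborel. (\<psi> z)\<^sup>2)"
  let ?\<tau> = "\<lambda>k. LINT z|lborel. \<rho> z * \<bar>gen (cutoff k) z\<bar>"
  obtain R where R: "\<And>z. R < norm z \<Longrightarrow> \<psi> z = 0"
    using Cc_smooth_support[OF \<psi>] by blast
  have "(\<lambda>n. LINT z|lborel. convol \<rho> (\<eta> n) z * (inverse (maxwell z) * dd (pdir i) \<psi> z))
      \<longlonglongrightarrow> (LINT z|lborel. \<rho> z * (inverse (maxwell z) * dd (pdir i) \<psi> z))"
    using dd_eq_0_outside[of R \<psi>, OF R]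
    by (intro convol_weak_tendsto[OF mol, where R=R] smooth_continuous_on smooth_mult smooth_inverse_maxwell
        smooth_dd Cc_smoothD[OF \<psi>]) auto
  then have lim: "?a \<longlonglongrightarrow> ?l" by (simp add: ratio_def[OF mol] mult_ac)
  obtain c k0 where c: "0 < c" and bound: "\<And>s n k. 0 < s \<Longrightarrow> k0 \<le> k \<Longrightarrow>
      \<bar>?a n\<bar> \<le> c / s * dissipation \<eta> n (cutoff k) + s * N"
    using momentum_derivative_bound[OF mol \<psi>, of i] unfolding N_def by blast
  have le1: "\<bar>?l\<bar> \<le> c / s * (2 / lam * ?\<tau> k) + s * N" if s: "0 < s" and k: "k0 \<le> k" for s k
  proof -
    obtain T where T: "\<And>n. lam / 2 * dissipation \<eta> n (cutoff k) \<le> T n" "T \<longlonglongrightarrow> ?\<tau> k"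
      using dissipation_bound[OF mol Cc_smooth_cutoff cutoff_nonneg cutoff_transport] by blast
    have "dissipation \<eta> n (cutoff k) \<le> 2 / lam * T n" for n
      using T(1)[of n] lam_pos by (simp add: field_simps)
    then have "\<bar>?a n\<bar> \<le> c / s * (2 / lam * T n) + s * N" for n
      using bound[OF s k, of n] mult_left_mono[of "dissipation \<eta> n (cutoff k)" "2 / lam * T n" "c / s"] c s
      by simp
    moreover have "(\<lambda>n. c / s * (2 / lam * T n) + s * N) \<longlonglongrightarrow> c / s * (2 / lam * ?\<tau> k) + s * N"
      by (intro tendsto_intros T)
    ultimately show ?thesis using tendsto_rabs[OF lim] by (intro LIMSEQ_le) auto
  qed
  have le2: "\<bar>?l\<bar> \<le> s * N" if s: "0 < s" for s
  proof -
    have "(\<lambda>k. c / s * (2 / lam * ?\<tau> k) + s * N) \<longlonglongrightarrow> c / s * (2 / lam * 0) + s * N"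
      by (intro tendsto_intros gen_cutoff_integral_tendsto_0)
    then have "\<bar>?l\<bar> \<le> c / s * (2 / lam * 0) + s * N"
      by (rule LIMSEQ_le_const) (use le1[OF s] in blast)
    then show ?thesis by simp
  qed
  have N: "0 \<le> N" unfolding N_def by (intro integral_nonneg_AE AE_I2) simp
  have "\<bar>?l\<bar> \<le> 0 + e" if "0 < e" for e
  proof -
    have "\<bar>?l\<bar> \<le> e / (N + 1) * N" using N that by (intro le2) simp
    also have "\<dots> \<le> e" using N that by (simp add: field_simps)
    finally show ?thesis by simp
  qed
  then have "\<bar>?l\<bar> \<le> 0" by (rule field_le_epsilon)
  then show ?thesis by simp
qed

end

section \<open>Functions with vanishing distributional gradient\<close>

text \<open>Fubini for \<open>F(z) \<phi>(z) \<omega>(z + v)\<close>: integrating first over \<open>v\<close> gives \<open>\<integral> F \<phi>\<close>; integrating first over \<open>z\<close>, invariance moves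
the translation from \<open>\<omega>\<close> to \<open>\<phi>\<close>, and the integral splits.\<close>
lemma translation_invariant_functional:
  fixes F :: "'a::euclidean_space \<Rightarrow> real"
  assumes F: "locally_integrable F"
    and inv: "\<And>\<psi> v. Cc_smooth \<psi> \<Longrightarrow> (LINT z|lborel. F z * \<psi> (z + v)) = (LINT z|lborel. F z * \<psi> z)"
    and \<omega>: "Cc_smooth \<omega>" "(LINT z|lborel. \<omega> z) = 1" and \<phi>: "Cc_smooth \<phi>"
  shows "(LINT z|lborel. F z * \<phi> z) = (LINT z|lborel. F z * \<omega> z) * (LINT z|lborel. \<phi> z)"
proof -
  have [measurable]: "F \<in> borel_measurable borel" using F by (simp add: locally_integrable_def)
  note [measurable] = smooth_measurable[OF Cc_smoothD[OF \<phi>]] smooth_measurable[OF Cc_smoothD[OF \<omega>(1)]]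
  have F\<phi>: "integrable lborel (\<lambda>z. F z * \<phi> z)" by (rule locally_integrable_Cc_mult[OF F \<phi>])
  have F\<omega>: "integrable lborel (\<lambda>z. F z * \<omega> z)" by (rule locally_integrable_Cc_mult[OF F \<omega>(1)])
  obtain W where W: "\<And>z. \<bar>\<omega> z\<bar> \<le> W" using Cc_smooth_bounded[OF \<omega>(1)] by blast
  have shift\<omega>: "integrable lborel (\<lambda>v. \<omega> (z + v))" "(LINT v|lborel. \<omega> (z + v)) = 1" for z
    using Cc_smooth_integrable[OF Cc_smooth_translate[OF \<omega>(1), of z]] lborel_integral_shift[of \<omega> z] \<omega>(2)
    by (simp_all add: add.commute)
  have joint: "integrable (lborel \<Otimes>\<^sub>M lborel) (\<lambda>(z, v). F z * \<phi> z * \<omega> (z + v))"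
  proof (rule lborel_pair.Fubini_integrable)
    have "(LINT v|lborel. norm (F z * \<phi> z * \<omega> (z + v))) = \<bar>F z * \<phi> z\<bar> * (LINT v|lborel. \<bar>\<omega> v\<bar>)" for z
      using lborel_integral_shift[of "\<lambda>v. \<bar>\<omega> v\<bar>" z] by (simp add: abs_mult add.commute)
    then show "integrable lborel (\<lambda>z. LINT v|lborel. norm (case (z, v) of (z, v) \<Rightarrow> F z * \<phi> z * \<omega> (z + v)))"
      using F\<phi> by simp
  qed (use shift\<omega> in auto)
  have "(LINT z|lborel. F z * \<phi> z) = (LINT z|lborel. LINT v|lborel. F z * \<phi> z * \<omega> (z + v))"
    by (simp add: shift\<omega>)
  also have "\<dots> = (LINT v|lborel. LINT z|lborel. F z * \<phi> z * \<omega> (z + v))"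
    using lborel_pair.Fubini_integral[OF joint] by simp
  also have "\<dots> = (LINT v|lborel. LINT z|lborel. F z * \<omega> z * \<phi> (z - v))"
  proof (rule Bochner_Integration.integral_cong[OF refl])
    fix v :: 'a
    have "Cc_smooth (\<lambda>z. \<phi> z * \<omega> (z + v))"
      by (intro Cc_smooth_mult_right \<phi> smooth_translate Cc_smoothD \<omega>)
    from inv[OF this, of "- v"]
    show "(LINT z|lborel. F z * \<phi> z * \<omega> (z + v)) = (LINT z|lborel. F z * \<omega> z * \<phi> (z - v))"
      by (simp add: mult_ac)
  qed
  also have "\<dots> = (LINT z|lborel. LINT v|lborel. F z * \<omega> z * \<phi> (z - v))"
  proof -
    have int\<phi>: "integrable lborel (\<lambda>v. \<phi> (z - v))" for z
      by (intro Cc_smooth_integrable Cc_smooth_reflect \<phi>)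
    have "integrable (lborel \<Otimes>\<^sub>M lborel) (\<lambda>(z, v). F z * \<omega> z * \<phi> (z - v))"
    proof (rule lborel_pair.Fubini_integrable)
      have "(LINT v|lborel. norm (F z * \<omega> z * \<phi> (z - v))) = \<bar>F z * \<omega> z\<bar> * (LINT v|lborel. \<bar>\<phi> v\<bar>)" for z
        using lborel_integral_reflect[of "\<lambda>v. \<bar>\<phi> v\<bar>" z] by (simp add: abs_mult)
      then show "integrable lborel (\<lambda>z. LINT v|lborel. norm (case (z, v) of (z, v) \<Rightarrow> F z * \<omega> z * \<phi> (z - v)))"
        using F\<omega> by simp
    qed (use int\<phi> in auto)
    from lborel_pair.Fubini_integral[OF this] show ?thesis by simp
  qed
  also have "\<dots> = (LINT z|lborel. F z * \<omega> z) * (LINT z|lborel. \<phi> z)"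
    using lborel_integral_reflect[of \<phi>] by simp
  finally show ?thesis .
qed

text \<open>The functions \<open>1 - exp (- n b)\<close>, where \<open>b\<close> is a product of bumps that is positive exactly on the box.\<close>
lemma box_indicator_approximation:
  fixes l u :: "'a::euclidean_space"
  obtains \<phi> :: "nat \<Rightarrow> 'a \<Rightarrow> real" where "\<And>n. Cc_smooth (\<phi> n)" "\<And>n z. 0 \<le> \<phi> n z" "\<And>n z. \<phi> n z \<le> indicator (box l u) z"
    "\<And>z. (\<lambda>n. \<phi> n z) \<longlonglongrightarrow> indicator (box l u) z"
proof -
  define b where "b z = (\<Prod>i\<in>Basis. bump 0 ((z - l) \<bullet> i) * bump 0 ((u - z) \<bullet> i))" for z :: 'a
  have b0: "0 \<le> b z" for z by (simp add: b_def prod_nonneg bump_nonneg)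
  have bz: "b z = 0 \<longleftrightarrow> z \<notin> box l u" for z
    by (auto simp: b_def bump_eq_0_iff mem_box inner_diff_left not_le not_less intro: less_imp_le)
  have sb: "smooth b"
  proof -
    have "smooth (\<lambda>z. bump 0 (z \<bullet> i - l \<bullet> i) * bump 0 (u \<bullet> i - z \<bullet> i))" for i
      by (intro smooth_intros)
    then show ?thesis unfolding b_def[abs_def] inner_diff_left by (intro smooth_prod)
  qed
  define \<phi> where "\<phi> n z = 1 - exp (- (real n * b z))" for n z
  have le: "\<phi> n z \<le> indicator (box l u) z" for n z
    using bz[of z] by (auto simp: \<phi>_def indicator_def)
  have ge: "0 \<le> \<phi> n z" for n z using b0[of z] by (simp add: \<phi>_def)
  show ?thesis
  proof
    fix n
    have "bounded {z. \<phi> n z \<noteq> 0}"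
      by (rule bounded_subset[OF bounded_box[of l u]]) (use bz in \<open>auto simp: \<phi>_def\<close>)
    then show "Cc_smooth (\<phi> n)" unfolding Cc_smooth_def
      by (simp add: \<phi>_def[abs_def]) (intro smooth_intros sb)
  next
    fix z
    show "(\<lambda>n. \<phi> n z) \<longlonglongrightarrow> indicator (box l u) z"
    proof (cases "z \<in> box l u")
      case False
      then show ?thesis using bz[of z] by (simp add: \<phi>_def)
    next
      case True
      then have "0 < b z" using b0[of z] bz[of z] by (simp add: less_le)
      then have "0 < 1 - exp (- b z)" "exp (- b z) < 1" by auto
      then have "(\<lambda>n. 1 - exp (- b z) ^ n) \<longlonglongrightarrow> 1 - 0"
        by (intro tendsto_diff tendsto_const LIMSEQ_power_zero) auto
      then show ?thesis using True by (simp add: \<phi>_def exp_of_nat_mult[symmetric])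
    qed
  qed (use le ge in auto)
qed

text \<open>Testing with approximations of indicators of boxes shows that \<open>F\<close> times Lebesgue measure agrees with \<open>c\<close> times Lebesgue
measure on boxes, hence everywhere.\<close>
lemma constant_if_proportional_functional:
  fixes F :: "'a::euclidean_space \<Rightarrow> real"
  assumes F: "locally_integrable F" and F0: "\<And>z. 0 \<le> F z" and c: "0 \<le> c"
    and proportional: "\<And>\<phi>. Cc_smooth \<phi> \<Longrightarrow> (LINT z|lborel. F z * \<phi> z) = c * (LINT z|lborel. \<phi> z)"
  shows "AE z in lborel. F z = c"
proof -
  have [measurable]: "F \<in> borel_measurable borel" using F by (simp add: locally_integrable_def)
  \<comment> \<open>Adding \<open>1\<close> to both \<open>F\<close> and \<open>c\<close> allows for \<open>c = 0\<close> when normalising to Lebesgue measure.\<close>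
  define G where "G z = (F z + 1) / (c + 1)" for z
  have G0: "0 \<le> G z" for z using F0[of z] c by (simp add: G_def)
  have [measurable]: "G \<in> borel_measurable borel" by (simp add: G_def[abs_def])
  have ibox: "integrable lborel (indicat_real (box l u))" for l u :: 'a
    by (intro integrable_real_indicator emeasure_bounded_finite bounded_box) simp
  have Fbox: "integrable lborel (\<lambda>z. F z * indicator (box l u) z)" for l u
  proof -
    obtain R where R: "box l u \<subseteq> cball 0 R"
      using bounded_box[of l u] unfolding bounded_iff by (meson mem_cball_0 subsetI)
    show ?thesis
    proof (rule Bochner_Integration.integrable_bound)
      show "integrable lborel (\<lambda>z. indicator (cball 0 R) z * F z)" using F by (simp add: locally_integrable_def)
      show "AE z in lborel. norm (F z * indicator (box l u) z) \<le> norm (indicator (cball 0 R) z * F z)"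
        using R by (intro AE_I2) (auto simp: indicator_def)
    qed measurable
  qed
  have box: "(LINT z|lborel. F z * indicator (box l u) z) = c * measure lborel (box l u)" for l u
  proof -
    obtain \<phi> where \<phi>: "\<And>n. Cc_smooth (\<phi> n)" "\<And>n z. 0 \<le> \<phi> n z" "\<And>n z. \<phi> n z \<le> indicator (box l u) z"
      "\<And>z. (\<lambda>n. \<phi> n z) \<longlonglongrightarrow> indicator (box l u) z"
      using box_indicator_approximation[of l u] by blast
    note [measurable] = smooth_measurable[OF Cc_smoothD[OF \<phi>(1)]]
    have lim: "(\<lambda>n. LINT z|lborel. F z * \<phi> n z) \<longlonglongrightarrow> (LINT z|lborel. F z * indicator (box l u) z)"
    proof (rule integral_dominated_convergence[OF _ _ Fbox[of l u]])
      show "AE z in lborel. (\<lambda>n. F z * \<phi> n z) \<longlonglongrightarrow> F z * indicator (box l u) z"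
        by (intro AE_I2 tendsto_mult_left \<phi>)
      show "AE z in lborel. norm (F z * \<phi> n z) \<le> F z * indicator (box l u) z" for n
        using F0 \<phi> by (intro AE_I2) (auto simp: abs_mult intro!: mult_left_mono)
    qed measurable
    have "(\<lambda>n. LINT z|lborel. \<phi> n z) \<longlonglongrightarrow> (LINT z|lborel. indicat_real (box l u) z)"
    proof (rule integral_dominated_convergence[OF _ _ ibox])
      show "AE z in lborel. (\<lambda>n. \<phi> n z) \<longlonglongrightarrow> indicator (box l u) z"
        by (intro AE_I2 \<phi>)
      show "AE z in lborel. norm (\<phi> n z) \<le> indicator (box l u) z" for n
        using \<phi> by (intro AE_I2) (auto simp: abs_of_nonneg)
    qed measurable
    from tendsto_mult_left[OF this, of c]
    have "(\<lambda>n. LINT z|lborel. F z * \<phi> n z) \<longlonglongrightarrow> c * measure lborel (box l u)"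
      by (simp add: proportional[OF \<phi>(1)])
    with lim show ?thesis using LIMSEQ_unique by blast
  qed
  have "lborel = density lborel (\<lambda>z. ennreal (G z))"
  proof (rule lborel_eqI)
    fix l u :: 'a assume lu: "\<And>b. b \<in> Basis \<Longrightarrow> l \<bullet> b \<le> u \<bullet> b"
    have GI: "(\<lambda>z. G z * indicator (box l u) z) = (\<lambda>z. (F z * indicator (box l u) z + indicator (box l u) z) / (c + 1))"
      by (auto simp: G_def indicator_def)
    have "emeasure (density lborel (\<lambda>z. ennreal (G z))) (box l u) = (\<integral>\<^sup>+ z. ennreal (G z) * indicator (box l u) z \<partial>lborel)"
      by (simp add: emeasure_density)
    also have "\<dots> = (\<integral>\<^sup>+ z. ennreal (G z * indicator (box l u) z) \<partial>lborel)"
      by (intro nn_integral_cong) (simp add: indicator_def)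
    also have "\<dots> = ennreal (LINT z|lborel. G z * indicator (box l u) z)"
    proof (rule nn_integral_eq_integral)
      show "integrable lborel (\<lambda>z. G z * indicator (box l u) z)"
        using Fbox[of l u] ibox[of l u] unfolding GI by simp
    qed (use G0 in simp)
    also have "(LINT z|lborel. G z * indicator (box l u) z) = (c * measure lborel (box l u) + measure lborel (box l u)) / (c + 1)"
      using Fbox[of l u] ibox[of l u] box[of l u] unfolding GI by simp
    also have "\<dots> = measure lborel (box l u)" using c by (simp add: field_simps)
    also have "ennreal (measure lborel (box l u)) = (\<Prod>b\<in>Basis. (u - l) \<bullet> b)"
      using lu by (simp add: measure_lborel_box)
    finally show "emeasure (density lborel (\<lambda>z. ennreal (G z))) (box l u) = (\<Prod>b\<in>Basis. (u - l) \<bullet> b)" .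
  qed simp
  then have "density lborel (\<lambda>z. ennreal (G z)) = density lborel (\<lambda>_::'a. 1)" by (simp add: density_1)
  then have "AE z in lborel. ennreal (G z) = 1"
    by (subst (asm) sigma_finite_measure.density_unique_iff[OF sigma_finite_lborel]) auto
  then show ?thesis
    by (rule AE_mp[OF _ AE_I2]) (use c G0 in \<open>auto simp: G_def ennreal_eq_1 field_simps\<close>)
qed

lemma weak_gradient_zero_imp_constant:
  fixes F :: "'a::euclidean_space \<Rightarrow> real"
  assumes F: "locally_integrable F" and F0: "\<And>z. 0 \<le> F z"
    and zero: "\<And>b \<psi>. b \<in> Basis \<Longrightarrow> Cc_smooth \<psi> \<Longrightarrow> (LINT z|lborel. F z * dd b \<psi> z) = 0"
  obtains c where "0 \<le> c" "AE z in lborel. F z = c"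
proof -
  have zero': "(LINT z|lborel. F z * dd v \<psi> z) = 0" if \<psi>: "Cc_smooth \<psi>" for v \<psi>
  proof -
    have lin: "linear (\<lambda>v. dd v \<psi> z)" for z
      by (rule has_derivative_linear[OF smooth_has_derivative[OF Cc_smoothD[OF \<psi>]]])
    have "dd v \<psi> z = dd (\<Sum>b\<in>Basis. (v \<bullet> b) *\<^sub>R b) \<psi> z" for z
      by (simp add: euclidean_representation)
    also have "\<dots> z = (\<Sum>b\<in>Basis. (v \<bullet> b) * dd b \<psi> z)" for z
      by (simp add: linear_sum[OF lin] linear_cmul[OF lin])
    finally have eq: "dd v \<psi> z = (\<Sum>b\<in>Basis. (v \<bullet> b) * dd b \<psi> z)" for z .
    have "(LINT z|lborel. F z * dd v \<psi> z) = (LINT z|lborel. (\<Sum>b\<in>Basis. (v \<bullet> b) * (F z * dd b \<psi> z)))"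
      unfolding eq sum_distrib_left by (simp add: mult_ac)
    also have "\<dots> = (\<Sum>b\<in>Basis. LINT z|lborel. (v \<bullet> b) * (F z * dd b \<psi> z))"
      by (intro Bochner_Integration.integral_sum integrable_mult_right locally_integrable_Cc_mult F Cc_smooth_dd \<psi>)
    also have "\<dots> = 0" by (simp add: zero \<psi>)
    finally show ?thesis .
  qed
  obtain \<omega> :: "'a \<Rightarrow> real" where \<omega>: "Cc_smooth \<omega>" "\<And>x. 0 \<le> \<omega> x" "(LINT x|lborel. \<omega> x) = 1"
    using normalized_bump[of 1] by (metis zero_less_one)
  define c where "c = (LINT z|lborel. F z * \<omega> z)"
  have "0 \<le> c" unfolding c_def by (intro integral_nonneg_AE AE_I2 mult_nonneg_nonneg F0 \<omega>)
  moreover have "AE z in lborel. F z = c"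
  proof (rule constant_if_proportional_functional[OF F F0 \<open>0 \<le> c\<close>])
    fix \<phi> :: "'a \<Rightarrow> real" assume \<phi>: "Cc_smooth \<phi>"
    show "(LINT z|lborel. F z * \<phi> z) = c * (LINT z|lborel. \<phi> z)"
      unfolding c_def
    proof (rule translation_invariant_functional[OF F _ \<omega>(1,3) \<phi>])
      fix \<psi> :: "'a \<Rightarrow> real" and v assume "Cc_smooth \<psi>"
      from weak_derivative_zero_translate[OF F zero' this, where v=v and t=1]
      show "(LINT z|lborel. F z * \<psi> (z + v)) = (LINT z|lborel. F z * \<psi> z)" by simp
    qed
  qed
  ultimately show ?thesis by (rule that)
qed

section \<open>Stationary densities are multiples of the Maxwellian\<close>
context kinetic_solution
begin

lemma Cc_smooth_transport: "Cc_smooth \<psi> \<Longrightarrow> Cc_smooth (\<lambda>z. \<Sum>j\<in>UNIV. snd z $ j * dd (qdir j) \<psi> z)"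
  for \<psi> :: "'d phase \<Rightarrow> real"
  by (intro Cc_smooth_sum Cc_smooth_momentum_mult Cc_smooth_dd)

lemma locally_integrable_ratio: "locally_integrable (\<lambda>z. \<rho> z * inverse (maxwell z))"
  by (intro locally_integrable_mult_continuous locally_integrable_\<rho> smooth_continuous_on smooth_inverse_maxwell)

text \<open>The weak equation tested with \<open>\<psi>/M\<close>. Since \<open>T\<close> annihilates \<open>M\<close>, \<open>M L(\<psi>/M)\<close> is \<open>p \<cdot> \<nabla>_q \<psi>\<close> plus a \<open>p\<close>-divergence, and the
latter does not contribute because \<open>\<rho>/M\<close> has no momentum derivative.\<close>
lemma weak_transport_zero:
  assumes \<psi>: "Cc_smooth \<psi>"
  shows "(LINT z|lborel. (\<rho> z * inverse (maxwell z)) * (\<Sum>j\<in>UNIV. snd z $ j * dd (qdir j) \<psi> z)) = 0"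
proof -
  let ?F = "\<lambda>z. \<rho> z * inverse (maxwell z)"
  define \<phi> where "\<phi> = (\<lambda>z. inverse (maxwell z) * \<psi> z)"
  have \<phi>: "Cc_smooth \<phi>" unfolding \<phi>_def by (intro Cc_smooth_mult_left smooth_inverse_maxwell \<psi>)
  note s = Cc_smoothD[OF \<psi>] smooth_inverse_maxwell
  have mnz: "maxwell z \<noteq> 0" for z using maxwell_pos[of z] by simp
  have dW: "dd (pdir i) (\<lambda>z. inverse (maxwell z)) z = snd z $ i / lam * inverse (maxwell z)"
    "dd (qdir i) (\<lambda>z. inverse (maxwell z)) z = force i z / lam * inverse (maxwell z)" for i z
    using mnz[of z] by (simp_all add: dd_inverse smooth_maxwell dd_pdir_maxwell dd_qdir_maxwell)
  have dp: "dd (pdir i) \<phi> = (\<lambda>z. inverse (maxwell z) * (dd (pdir i) \<psi> z + snd z $ i / lam * \<psi> z))" for i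
    unfolding \<phi>_def by (rule ext) (simp add: dd_mult s dW algebra_simps)
  have dq: "dd (qdir i) \<phi> z = inverse (maxwell z) * (dd (qdir i) \<psi> z + force i z / lam * \<psi> z)" for i z
    unfolding \<phi>_def by (simp add: dd_mult s dW algebra_simps)
  define k where "k i z = lam * dd (pdir i) \<psi> z + snd z $ i * \<psi> z - force i z * \<psi> z" for i z
  have k: "Cc_smooth (k i)" for i
    unfolding k_def[abs_def]
    by (intro Cc_smooth_add Cc_smooth_diff Cc_smooth_mult_left Cc_smooth_dd \<psi> smooth_const smooth_snd_component smooth_force)
  have dk: "dd (pdir i) (k i) z = lam * dd (pdir i) (dd (pdir i) \<psi>) z + \<psi> z + snd z $ i * dd (pdir i) \<psi> z
      - force i z * dd (pdir i) \<psi> z" for i z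
    unfolding k_def[abs_def]
    by (simp add: dd_diff dd_add dd_mult s smooth_mult smooth_add smooth_dd smooth_const smooth_snd_component
        smooth_force dd_momentum dd_pdir_force)
  have ddp: "dd (pdir i) (dd (pdir i) \<phi>) z = inverse (maxwell z) * (dd (pdir i) (dd (pdir i) \<psi>) z
      + 2 * (snd z $ i / lam * dd (pdir i) \<psi> z) + \<psi> z / lam + snd z $ i / lam * (snd z $ i / lam) * \<psi> z)" for i z
    unfolding dp
    by (simp add: dd_mult dd_add dd_divide_const s smooth_mult smooth_add smooth_dd smooth_divide_const smooth_snd_component
        dW dd_momentum) (use lam_pos mnz[of z] in \<open>simp add: field_simps\<close>)
  have each: "gen_term i \<phi> z
      = inverse (maxwell z) * (snd z $ i * dd (qdir i) \<psi> z + dd (pdir i) (k i) z)" for i z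
    unfolding dq ddp unfolding dp dk using lam_pos mnz[of z] by (simp add: field_simps)
  have "gen \<phi> z = inverse (maxwell z) * ((\<Sum>j\<in>UNIV. snd z $ j * dd (qdir j) \<psi> z) + (\<Sum>i\<in>UNIV. dd (pdir i) (k i) z))" for z
    unfolding gen_def each by (simp add: sum.distrib flip: sum_distrib_left)
  then have "0 = (LINT z|lborel. ?F z * (\<Sum>j\<in>UNIV. snd z $ j * dd (qdir j) \<psi> z) + (\<Sum>i\<in>UNIV. ?F z * dd (pdir i) (k i) z))"
    using weak[OF \<phi>] by (simp add: sum_distrib_left[symmetric] algebra_simps)
  also have "\<dots> = (LINT z|lborel. ?F z * (\<Sum>j\<in>UNIV. snd z $ j * dd (qdir j) \<psi> z))
      + (\<Sum>i\<in>UNIV. LINT z|lborel. ?F z * dd (pdir i) (k i) z)"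
    by (subst Bochner_Integration.integral_add)
       (auto intro!: Bochner_Integration.integral_sum Bochner_Integration.integrable_sum
         locally_integrable_Cc_mult[OF locally_integrable_ratio] Cc_smooth_transport \<psi> Cc_smooth_dd k)
  also have "(\<Sum>i\<in>UNIV. LINT z|lborel. ?F z * dd (pdir i) (k i) z) = 0"
    by (simp add: weak_momentum_derivative_zero k)
  finally show ?thesis by simp
qed

text \<open>Translating \<open>\<psi>\<close> by the \<open>i\<close>-th momentum unit vector replaces \<open>p \<cdot> \<nabla>_q \<psi>\<close> by \<open>p \<cdot> \<nabla>_q \<psi> + \<partial>\<psi>/\<partial>q_i\<close>, by translation invariance of
\<open>\<rho>/M\<close> in \<open>p\<close>. Both transport integrals vanish.\<close>
lemma weak_position_derivative_zero:
  assumes \<psi>: "Cc_smooth \<psi>"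
  shows "(LINT z|lborel. (\<rho> z * inverse (maxwell z)) * dd (qdir i) \<psi> z) = 0"
proof -
  let ?F = "\<lambda>z. \<rho> z * inverse (maxwell z)"
  let ?S = "\<lambda>\<psi> z. \<Sum>j\<in>UNIV. snd z $ j * dd (qdir j) \<psi> z"
  define \<psi>' where "\<psi>' = (\<lambda>z. \<psi> (z + - pdir i))"
  have \<psi>': "Cc_smooth \<psi>'" unfolding \<psi>'_def by (rule Cc_smooth_translate[OF \<psi>])
  have "?S \<psi>' (z + 1 *\<^sub>R pdir i) = ?S \<psi> z + dd (qdir i) \<psi> z" for z
  proof -
    have "dd v \<psi>' (z + pdir i) = dd v \<psi> z" for v
      unfolding \<psi>'_def by (subst dd_translate[OF Cc_smoothD[OF \<psi>]]) (simp add: add.assoc zero_prod_def[symmetric])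
    then have "?S \<psi>' (z + 1 *\<^sub>R pdir i) = (\<Sum>j\<in>UNIV. (snd z $ j + axis i 1 $ j) * dd (qdir j) \<psi> z)" by simp
    also have "\<dots> = ?S \<psi> z + (\<Sum>j\<in>UNIV. axis i 1 $ j * dd (qdir j) \<psi> z)"
      by (simp add: distrib_right sum.distrib)
    also have "(\<Sum>j\<in>UNIV. axis i 1 $ j * dd (qdir j) \<psi> z) = (\<Sum>j\<in>UNIV. if j = i then dd (qdir j) \<psi> z else 0)"
      by (intro sum.cong refl) (auto simp: axis_def)
    finally show ?thesis by simp
  qed
  then have "(LINT z|lborel. ?F z * (?S \<psi> z + dd (qdir i) \<psi> z)) = (LINT z|lborel. ?F z * ?S \<psi>' (z + 1 *\<^sub>R pdir i))"
    by simp
  also have "\<dots> = (LINT z|lborel. ?F z * ?S \<psi>' z)"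
    by (rule weak_derivative_zero_translate[OF locally_integrable_ratio weak_momentum_derivative_zero Cc_smooth_transport[OF \<psi>']])
  also have "\<dots> = 0" by (rule weak_transport_zero[OF \<psi>'])
  finally have "(LINT z|lborel. ?F z * ?S \<psi> z + ?F z * dd (qdir i) \<psi> z) = 0" by (simp add: distrib_left)
  moreover have "integrable lborel (\<lambda>z. ?F z * ?S \<psi> z)" "integrable lborel (\<lambda>z. ?F z * dd (qdir i) \<psi> z)"
    by (intro locally_integrable_Cc_mult locally_integrable_ratio Cc_smooth_transport Cc_smooth_dd \<psi>)+
  ultimately show ?thesis using weak_transport_zero[OF \<psi>] by simp
qed

theorem stationary_is_maxwellian:
  obtains c where "0 \<le> c" "AE z in lborel. \<rho> z = c * maxwell z"
proof -
  let ?F = "\<lambda>z. \<rho> z * inverse (maxwell z)"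
  have "(LINT z|lborel. ?F z * dd b \<psi> z) = 0" if b: "b \<in> Basis" and \<psi>: "Cc_smooth \<psi>" for b \<psi>
    using b weak_momentum_derivative_zero[OF \<psi>] weak_position_derivative_zero[OF \<psi>]
    by (auto simp: Basis_prod_def Basis_vec_def)
  note zero = this
  have F0: "0 \<le> ?F z" for z using \<rho>_nonneg[of z] maxwell_pos[of z] by simp
  obtain c where c: "0 \<le> c" "AE z in lborel. ?F z = c"
    by (rule weak_gradient_zero_imp_constant[OF locally_integrable_ratio F0 zero])
  have "\<rho> z = c * maxwell z" if "?F z = c" for z
    using that maxwell_pos[of z] by (auto simp: field_simps)
  then have "AE z in lborel. \<rho> z = c * maxwell z"
    by (intro AE_mp[OF c(2) AE_I2]) auto
  with c(1) show ?thesis by (rule that)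
qed

end

section \<open>The effective potential\<close>

lemma tame_mono: "tame N k f \<Longrightarrow> N \<le> L \<Longrightarrow> tame L k f"
proof (induction k arbitrary: f)
  have bound: "\<exists>C. \<forall>x. \<bar>f x\<bar> \<le> C * (1 + norm x) ^ L" if f: "tame N k f" and "N \<le> L" for f :: "'a \<Rightarrow> real" and k
  proof -
    from tame_bound[OF f] obtain C where C: "\<And>x. \<bar>f x\<bar> \<le> C * (1 + norm x) ^ N" by blast
    have "0 \<le> C" using C[of 0] by simp
    then have "C * (1 + norm x) ^ N \<le> C * (1 + norm x) ^ L" for x :: 'a
      using \<open>N \<le> L\<close> by (intro mult_left_mono power_increasing) auto
    with C show ?thesis by (meson order_trans)
  qed
  {
    case 0
    with bound[OF this] show ?case by simp
  next
    case (Suc k)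
    with bound[OF Suc.prems] show ?case unfolding tame.simps(2) by blast
  }
qed

lemma tame_sum: "(\<And>i. i \<in> I \<Longrightarrow> tame N k (f i)) \<Longrightarrow> tame N k (\<lambda>x. \<Sum>i\<in>I. f i x)"
  by (induction I rule: infinite_finite_induct) (auto intro!: tame_const tame_add)

lemma tame_inner: "tame 1 k (\<lambda>x :: 'a::euclidean_space. x \<bullet> b)"
proof -
  have bound: "\<exists>C. \<forall>x :: 'a. \<bar>x \<bullet> b\<bar> \<le> C * (1 + norm x) ^ 1"
  proof (intro exI allI)
    fix x :: 'a
    have "\<bar>x \<bullet> b\<bar> \<le> norm b * norm x" using Cauchy_Schwarz_ineq2[of x b] by (simp add: mult.commute)
    also have "\<dots> \<le> norm b * (1 + norm x) ^ 1" by (intro mult_left_mono) auto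
    finally show "\<bar>x \<bullet> b\<bar> \<le> norm b * (1 + norm x) ^ 1" .
  qed
  show ?thesis
  proof (cases k)
    case 0
    with bound show ?thesis by (auto intro!: continuous_intros)
  next
    case (Suc j)
    have "dd v (\<lambda>x :: 'a. x \<bullet> b) = (\<lambda>_. v \<bullet> b)" for v
      by (rule ext) (rule dd_bounded_linear[OF bounded_linear_inner_left])
    with bound show ?thesis unfolding Suc tame.simps(2)
      by (auto intro!: tame_const differentiableI[OF smooth_has_derivative[OF smooth_inner]])
  qed
qed

lemma tame_norm_square: "tame 2 k (\<lambda>x :: 'a::euclidean_space. (norm x)\<^sup>2)"
proof -
  have "(\<lambda>x :: 'a. (norm x)\<^sup>2) = (\<lambda>x. \<Sum>b\<in>Basis. (x \<bullet> b) * (x \<bullet> b))"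
    by (simp add: power2_norm_eq_inner flip: euclidean_inner)
  moreover have "tame (1 + 1) k (\<lambda>x :: 'a. \<Sum>b\<in>Basis. (x \<bullet> b) * (x \<bullet> b))"
    by (intro tame_sum tame_mult tame_inner)
  ultimately show ?thesis by (simp add: numeral_2_eq_2)
qed

lemma tame_power: "tame N k f \<Longrightarrow> tame (N * j) k (\<lambda>x. f x ^ j)"
proof (induction j)
  case (Suc j)
  then show ?case using tame_mult[of N k f "N * j" "\<lambda>x. f x ^ j"] by simp
qed (simp add: tame_const)

text \<open>Averaging \<open>G(r)\<close> and \<open>G(-r)\<close> leaves the even powers of \<open>r = norm x\<close>, which are powers of the smooth function \<open>|x|^2\<close>.\<close>
lemma tame_even_polynomial:
  assumes even: "\<And>r. poly G (- r) = poly G r"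
  shows "tame (degree G) k (\<lambda>x :: 'a::euclidean_space. poly G (norm x))"
proof -
  have eq: "poly G (norm x) = (\<Sum>j\<le>degree G. (if even j then coeff G j else 0) * ((norm x)\<^sup>2) ^ (j div 2))" for x :: 'a
  proof -
    have "poly G (norm x) = (poly G (norm x) + poly G (- norm x)) / 2" by (simp add: even)
    also have "\<dots> = (\<Sum>j\<le>degree G. coeff G j * (norm x ^ j + (- norm x) ^ j) / 2)"
      by (simp add: poly_altdef sum.distrib distrib_left add_divide_distrib sum_divide_distrib)
    also have "\<dots> = (\<Sum>j\<le>degree G. (if even j then coeff G j else 0) * ((norm x)\<^sup>2) ^ (j div 2))"
      by (intro sum.cong refl) (auto simp flip: power_mult)
    finally show ?thesis .
  qed
  have "tame (degree G) k (\<lambda>x :: 'a. c * ((norm x)\<^sup>2) ^ (j div 2))" if "j \<le> degree G" for c j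
  proof -
    have "tame (0 + 2 * (j div 2)) k (\<lambda>x :: 'a. c * ((norm x)\<^sup>2) ^ (j div 2))"
      by (intro tame_mult tame_const tame_power tame_norm_square)
    then show ?thesis by (rule tame_mono) (use that in presburger)
  qed
  then show ?thesis unfolding eq by (intro tame_sum) auto
qed

lemma even_convex_nonneg:
  assumes "convex_on UNIV g" "\<And>r. g (- r) = g r" "g 0 = 0"
  shows "0 \<le> g (r :: real)"
proof -
  have "g ((1 - 1/2) *\<^sub>R r + (1/2) *\<^sub>R (- r)) \<le> (1 - 1/2) * g r + (1/2) * g (- r)"
    by (rule convex_onD[OF assms(1)]) auto
  then show ?thesis using assms by simp
qed

text \<open>Beyond \<open>r1\<close> the leading term is at least twice the sum of the others; below \<open>r1\<close> the left-hand side is bounded.\<close>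
lemma polynomial_growth_lower:
  fixes G :: "real poly"
  assumes "1 \<le> degree G"
  shows "\<exists>A\<ge>0. \<forall>r\<ge>0. (1 + r) ^ degree G \<le> A * (1 + \<bar>poly G r\<bar>)"
proof -
  let ?m = "degree G" and ?c = "\<bar>lead_coeff G\<bar>"
  have c: "0 < ?c" using assms by auto
  define S where "S = (\<Sum>j<?m. \<bar>coeff G j\<bar>)"
  have S0: "0 \<le> S" by (simp add: S_def sum_nonneg)
  define r1 where "r1 = max 1 (2 * S / ?c)"
  have large: "?c / 2 * r ^ ?m \<le> \<bar>poly G r\<bar>" if r: "r1 \<le> r" for r
  proof -
    have r': "1 \<le> r" "2 * S / ?c \<le> r" using r by (auto simp: r1_def)
    then have "2 * S \<le> ?c * r" using c by (simp add: pos_divide_le_eq mult.commute)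
    have "poly G r = lead_coeff G * r ^ ?m + (\<Sum>j<?m. coeff G j * r ^ j)"
      unfolding poly_altdef lessThan_Suc_atMost[symmetric] by simp
    moreover have "\<bar>\<Sum>j<?m. coeff G j * r ^ j\<bar> \<le> (\<Sum>j<?m. \<bar>coeff G j\<bar> * r ^ (?m - 1))"
      using r' by (intro order_trans[OF sum_abs] sum_mono) (auto simp: abs_mult intro!: mult_left_mono power_increasing)
    moreover have "(\<Sum>j<?m. \<bar>coeff G j\<bar> * r ^ (?m - 1)) = S * r ^ (?m - 1)"
      by (simp add: S_def sum_distrib_right)
    moreover have "2 * (S * r ^ (?m - 1)) \<le> ?c * r ^ ?m"
      using mult_right_mono[OF \<open>2 * S \<le> ?c * r\<close>, of "r ^ (?m - 1)"] r' assms
      by (simp add: mult.assoc power_eq_if[of r ?m] split: if_splits)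
    moreover have "\<bar>lead_coeff G * r ^ ?m\<bar> = ?c * r ^ ?m" using r' by (simp add: abs_mult)
    ultimately show ?thesis by linarith
  qed
  define A where "A = (1 + r1) ^ ?m + 2 ^ ?m * (2 / ?c)"
  have r1: "1 \<le> r1" by (simp add: r1_def)
  have A0: "0 \<le> 2 ^ ?m * (2 / ?c)" "0 \<le> (1 + r1) ^ ?m" using c r1 by auto
  show ?thesis
  proof (intro exI[of _ A] conjI allI impI)
    show "0 \<le> A" using A0 by (simp add: A_def)
    fix r :: real assume "0 \<le> r"
    show "(1 + r) ^ ?m \<le> A * (1 + \<bar>poly G r\<bar>)"
    proof (cases "r1 \<le> r")
      case True
      have "(1 + r) ^ ?m \<le> (2 * r) ^ ?m" using r1 True by (intro power_mono) auto
      also have "\<dots> = 2 ^ ?m * (2 / ?c) * (?c / 2 * r ^ ?m)" using c by (simp add: power_mult_distrib)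
      also have "\<dots> \<le> A * (1 + \<bar>poly G r\<bar>)"
        using large[OF True] A0 c r1 True by (intro mult_mono) (auto simp: A_def)
      finally show ?thesis .
    next
      case False
      have "(1 + r) ^ ?m \<le> (1 + r1) ^ ?m" using False \<open>0 \<le> r\<close> by (intro power_mono) auto
      also have "\<dots> \<le> A * 1" using A0 by (simp add: A_def)
      also have "\<dots> \<le> A * (1 + \<bar>poly G r\<bar>)" using A0 by (intro mult_left_mono) (auto simp: A_def)
      finally show ?thesis .
    qed
  qed
qed

lemma grad_component: "grad f x $ i = dd (axis i 1) f x"
  by (simp add: grad_def dd_def)

text \<open>Integrability of \<open>\<psi>(- q')\<close> against \<open>\<rho>\<close> yields all moments up to the degree of the polynomial, since \<open>\<psi>\<close> is
nonnegative and grows like \<open>|q|\<close> to that degree. Differentiation under the integral sign does the rest.\<close>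
lemma
  fixes \<psi> :: "real^'d \<Rightarrow> real" and \<rho> :: "'d phase \<Rightarrow> real"
  assumes \<psi>: "interaction_potential \<psi>" and \<rho>: "prob_density \<rho>" and conv: "conv_defined \<psi> \<rho>"
  shows smooth_conv: "smooth (conv \<psi> \<rho>)" and conv_nonneg: "0 \<le> conv \<psi> \<rho> q"
    and conv_defined_grad: "conv_defined (grad \<psi>) \<rho>"
    and conv_grad: "conv (grad \<psi>) \<rho> q = grad (conv \<psi> \<rho>) q"
proof -
  obtain G where G: "\<And>x. \<psi> x = poly G (norm x)" "\<And>r. poly G (- r) = poly G r" "1 \<le> degree G"
      "convex_on UNIV (poly G)" "poly G 0 = 0"
    using \<psi> unfolding interaction_potential_def psi1_def psi2_def psi3_def by force
  have \<rho>i: "integrable lborel \<rho>" and \<rho>0: "AE z in lborel. 0 \<le> \<rho> z"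
    using \<rho> by (auto simp: prob_density_def has_bochner_integral_iff)
  have \<psi>0: "0 \<le> \<psi> x" for x unfolding G(1) by (rule even_convex_nonneg[OF G(4,2,5)])
  have tame: "tame (degree G) k \<psi>" for k
    using tame_even_polynomial[OF G(2), where ?'a="real^'d"] G(1) by (metis (no_types) ext)
  have \<psi>c: "continuous_on UNIV \<psi>" using tame[of 0] by simp
  have "(\<lambda>z :: 'd phase. fst z) \<in> borel_measurable borel"
    by (intro borel_measurable_continuous_onI continuous_intros)
  with \<rho>i have m: "\<rho> \<in> borel_measurable lborel" "(\<lambda>z :: 'd phase. fst z) \<in> borel_measurable lborel"
    by auto
  have moment: "integrable lborel (\<lambda>z. \<rho> z * (1 + norm (fst z)) ^ degree G)"
  proof -
    obtain A where A: "0 \<le> A" "\<And>r. 0 \<le> r \<Longrightarrow> (1 + r) ^ degree G \<le> A * (1 + \<bar>poly G r\<bar>)"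
      using polynomial_growth_lower[OF G(3)] by blast
    have "integrable lborel (\<lambda>z. \<rho> z * \<psi> (0 - fst z))"
      using conv unfolding conv_defined_def by (auto dest: spec[of _ 0])
    then have "integrable lborel (\<lambda>z. \<rho> z * \<psi> (fst z))" by (simp add: G(1))
    then have i: "integrable lborel (\<lambda>z. A * (\<rho> z + \<rho> z * \<psi> (fst z)))" using \<rho>i by simp
    show ?thesis
    proof (rule Bochner_Integration.integrable_bound[OF i])
      have "\<bar>\<rho> z * (1 + norm (fst z)) ^ degree G\<bar> \<le> \<bar>A * (\<rho> z + \<rho> z * \<psi> (fst z))\<bar>" for z
      proof -
        have "(1 + norm (fst z)) ^ degree G \<le> A * (1 + \<psi> (fst z))"
          using A(2)[of "norm (fst z)"] \<psi>0[of "fst z"] by (simp add: G(1))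
        then have "\<bar>\<rho> z\<bar> * (1 + norm (fst z)) ^ degree G \<le> \<bar>\<rho> z\<bar> * (A * (1 + \<psi> (fst z)))"
          by (intro mult_left_mono) auto
        also have "\<dots> = \<bar>A * (\<rho> z * (1 + \<psi> (fst z)))\<bar>"
          using A(1) \<psi>0[of "fst z"] by (simp add: abs_mult)
        finally show ?thesis by (simp add: abs_mult distrib_left)
      qed
      then show "AE z in lborel. norm (\<rho> z * (1 + norm (fst z)) ^ degree G) \<le> norm (A * (\<rho> z + \<rho> z * \<psi> (fst z)))"
        by (intro AE_I2) simp
    qed (use m in measurable)
  qed
  have cv: "conv \<psi> \<rho> = (\<lambda>q. LINT z|lborel. \<rho> z * \<psi> (q - fst z))" by (simp add: conv_def fun_eq_iff)
  show "smooth (conv \<psi> \<rho>)" unfolding cv by (rule smooth_shifted_kernel(1)[OF m(2,1) moment tame])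
  show "0 \<le> conv \<psi> \<rho> q" unfolding cv
    by (rule integral_nonneg_AE) (rule AE_mp[OF \<rho>0 AE_I2], use \<psi>0 in simp)
  have "tame (degree G) 0 (dd v \<psi>)" for v using tame[of "Suc 0"] by (simp add: tame.simps(2))
  from integrable_shifted_kernel[OF m(2,1) moment this]
  have int: "integrable lborel (\<lambda>z. \<rho> z * dd (axis i 1) \<psi> (q - fst z))" for i q .
  have gr: "grad \<psi> x = (\<Sum>i\<in>UNIV. dd (axis i 1) \<psi> x *\<^sub>R axis i 1)" for x
    by (simp add: vec_eq_iff grad_component axis_def if_distrib cong: if_cong)
  have intv: "integrable lborel (\<lambda>z. \<rho> z *\<^sub>R grad \<psi> (q - fst z))" for q
    unfolding gr scaleR_sum_right scaleR_scaleR
    by (intro Bochner_Integration.integrable_sum integrable_scaleR_left) (rule int)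
  then show "conv_defined (grad \<psi>) \<rho>" by (simp add: conv_defined_def)
  show "conv (grad \<psi>) \<rho> q = grad (conv \<psi> \<rho>) q"
  proof (rule vec_eq_iff[THEN iffD2], rule allI)
    fix i
    have "conv (grad \<psi>) \<rho> q $ i = (LINT z|lborel. (\<rho> z *\<^sub>R grad \<psi> (q - fst z)) $ i)"
      unfolding conv_def by (rule integral_bounded_linear[OF bounded_linear_vec_nth intv, symmetric])
    also have "\<dots> = dd (axis i 1) (conv \<psi> \<rho>) q"
      unfolding cv smooth_shifted_kernel(2)[OF m(2,1) moment tame] by (simp add: grad_component)
    finally show "conv (grad \<psi>) \<rho> q $ i = grad (conv \<psi> \<rho>) q $ i" by (simp add: grad_component)
  qed
qed

text \<open>With \<open>t = |x|^2\<close>, \<open>V\<close> is bounded below by the quadratic polynomial \<open>C4 t^2 - C2 t\<close>.\<close>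
lemma V3_coercive:
  assumes "V3 V"
  shows "\<exists>B. \<forall>x. B \<le> V x" and "bounded {x. V x \<le> R}"
proof -
  obtain C2 C4 where C: "0 < C2" "0 < C4" "\<And>x. C4 * norm x ^ 4 - C2 * norm x ^ 2 \<le> V x"
    using assms unfolding V3_def by blast
  have p4: "norm x ^ 4 = (norm x)\<^sup>2 * (norm x)\<^sup>2" for x :: "real^'a"
    by (simp flip: power_add)
  have "- (C2\<^sup>2 / (4 * C4)) \<le> V x" for x
  proof -
    have "0 \<le> (2 * C4 * (norm x)\<^sup>2 - C2)\<^sup>2 / (4 * C4)" using C(2) by simp
    also have "\<dots> = C4 * norm x ^ 4 - C2 * norm x ^ 2 + C2\<^sup>2 / (4 * C4)"
      using C(2) unfolding p4 by (simp add: power2_eq_square field_simps)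
    finally show ?thesis using C(3)[of x] by linarith
  qed
  then show "\<exists>B. \<forall>x. B \<le> V x" by blast
  have "norm x \<le> sqrt (1 + (\<bar>R\<bar> + C2) / C4)" if x: "V x \<le> R" for x
  proof (rule real_le_rsqrt, rule ccontr)
    let ?t = "(norm x)\<^sup>2"
    assume "\<not> ?t \<le> 1 + (\<bar>R\<bar> + C2) / C4"
    moreover have "0 \<le> (\<bar>R\<bar> + C2) / C4" using C by simp
    ultimately have "1 \<le> ?t" "(\<bar>R\<bar> + C2) / C4 < ?t" by linarith+
    then have "\<bar>R\<bar> + C2 < C4 * ?t" using C(2) by (simp add: pos_divide_less_eq mult.commute)
    then have "(\<bar>R\<bar> + C2) * ?t < C4 * ?t * ?t" using \<open>1 \<le> ?t\<close> by (intro mult_strict_right_mono) auto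
    moreover have "\<bar>R\<bar> * 1 \<le> \<bar>R\<bar> * ?t" using \<open>1 \<le> ?t\<close> by (intro mult_left_mono) auto
    moreover have "C4 * (?t * ?t) - C2 * ?t \<le> R" using C(3)[of x] x unfolding p4 by linarith
    ultimately show False by (simp add: algebra_simps)
  qed
  then show "bounded {x. V x \<le> R}" unfolding bounded_iff by blast
qed

section \<open>The weak formulation in coordinates\<close>

lemma grad_q_component:
  fixes \<phi> :: "'d::finite phase \<Rightarrow> real"
  assumes "smooth \<phi>" shows "grad_q \<phi> z $ i = dd (qdir i) \<phi> z"
proof (cases z)
  case (Pair q p)
  have "bounded_linear (\<lambda>x :: real^'d. (x, 0 :: real^'d))"
    by (intro bounded_linear_Pair bounded_linear_ident bounded_linear_zero)
  from dd_compose_affine[OF this assms, of "axis i 1" "(0, p)" q] show ?thesis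
    by (simp add: Pair grad_q_def grad_component)
qed

lemma
  fixes \<phi> :: "'d::finite phase \<Rightarrow> real"
  assumes "smooth \<phi>"
  shows grad_p_component: "grad_p \<phi> z $ i = dd (pdir i) \<phi> z"
    and laplacian_p_eq: "laplacian_p \<phi> z = (\<Sum>i\<in>UNIV. dd (pdir i) (dd (pdir i) \<phi>) z)"
proof -
  obtain q p where z: "z = (q, p)" by fastforce
  have bl: "bounded_linear (\<lambda>x :: real^'d. (0 :: real^'d, x))"
    by (intro bounded_linear_Pair bounded_linear_ident bounded_linear_zero)
  have d: "dd v (\<lambda>y. \<theta> (q, y)) y = dd (0, v) \<theta> (q, y)" if "smooth \<theta>" for \<theta> :: "'d phase \<Rightarrow> real" and v y
    using dd_compose_affine[OF bl that, of v "(q, 0)" y] by simp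
  show "grad_p \<phi> z $ i = dd (pdir i) \<phi> z"
    using d[OF assms] by (simp add: z grad_p_def grad_component)
  have sm: "smooth (\<lambda>y. \<theta> (q, y))" if "smooth \<theta>" for \<theta> :: "'d phase \<Rightarrow> real"
    using smooth_compose_affine[OF bl that, of "(q, 0)"] by simp
  let ?f = "\<lambda>y. \<phi> (q, y)"
  have g: "grad ?f = (\<lambda>y. \<chi> i. dd (pdir i) \<phi> (q, y))"
    using d[OF assms] by (intro ext) (simp add: vec_eq_iff grad_component)
  have "((\<lambda>y. \<chi> i. dd (pdir i) \<phi> (q, y)) has_derivative (\<lambda>v. \<chi> i. dd v (\<lambda>y. dd (pdir i) \<phi> (q, y)) p)) (at p)"
    by (subst has_derivative_componentwise_within)
       (auto simp: Basis_vec_def inner_axis intro!: smooth_has_derivative sm smooth_dd assms)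
  from frechet_derivative_at[OF this, symmetric]
  have "hess ?f p $ i $ j = dd (axis j 1) (\<lambda>y. dd (pdir i) \<phi> (q, y)) p" for i j
    by (simp add: hess_def jacobian_def matrix_def g)
  then show "laplacian_p \<phi> z = (\<Sum>i\<in>UNIV. dd (pdir i) (dd (pdir i) \<phi>) z)"
    by (simp add: z laplacian_p_def laplacian_def trace_def d smooth_dd assms)
qed

context kinetic
begin

lemma vfp_op_eq_integral_gen:
  assumes \<rho>: "integrable lborel \<rho>" and \<phi>: "Cc_smooth \<phi>"
    and U: "\<And>q. grad V q + conv (grad \<psi>) \<rho> q = grad U q"
  shows "vfp_op lam V \<psi> \<rho> \<rho> \<phi> = (LINT z|lborel. \<rho> z * gen \<phi> z)"
proof -
  note s = Cc_smoothD[OF \<phi>]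
  define a where "a z = (\<Sum>i\<in>UNIV. snd z $ i * dd (qdir i) \<phi> z)" for z
  define b where "b z = (\<Sum>i\<in>UNIV. (force i z + snd z $ i) * dd (pdir i) \<phi> z)" for z
  define c where "c z = (\<Sum>i\<in>UNIV. dd (pdir i) (dd (pdir i) \<phi>) z)" for z
  have cc: "Cc_smooth a" "Cc_smooth b" "Cc_smooth c"
    unfolding a_def[abs_def] b_def[abs_def] c_def[abs_def]
    by (intro Cc_smooth_sum Cc_smooth_mult_left Cc_smooth_dd \<phi> smooth_add smooth_force smooth_snd_component)+
  note i = cc[THEN locally_integrable_Cc_mult[OF integrable_imp_locally_integrable[OF \<rho>]]]
  have A: "(case z of (q, p) \<Rightarrow> \<rho> (q, p) *\<^sub>R p) \<bullet> grad_q \<phi> z = \<rho> z * a z" for z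
    by (cases z) (simp add: a_def inner_vec_def grad_q_component[OF s] sum_distrib_left mult.assoc)
  have B: "(case z of (q, p) \<Rightarrow> \<rho> (q, p) *\<^sub>R (grad V q + conv (grad \<psi>) \<rho> q + p)) \<bullet> grad_p \<phi> z = \<rho> z * b z" for z
    by (cases z) (simp add: b_def U inner_vec_def grad_p_component[OF s] grad_component force_def sum_distrib_left mult.assoc)
  have C: "laplacian_p \<phi> z = c z" for z by (simp add: laplacian_p_eq[OF s] c_def)
  have "vfp_op lam V \<psi> \<rho> \<rho> \<phi> = (LINT z|lborel. \<rho> z * a z) - (LINT z|lborel. \<rho> z * b z) + lam * (LINT z|lborel. \<rho> z * c z)"
    unfolding vfp_op_def distr_div_q_def distr_div_p_def distr_laplacian_p_def A B C by simp
  also have "\<dots> = (LINT z|lborel. \<rho> z * a z - \<rho> z * b z + lam * (\<rho> z * c z))"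
    using i by simp
  also have "\<dots> = (LINT z|lborel. \<rho> z * gen \<phi> z)"
    by (simp add: gen_def a_def b_def c_def sum.distrib sum_subtractf sum_distrib_left algebra_simps)
  finally show ?thesis .
qed

text \<open>\<open>M L\<phi>\<close> is a divergence: \<open>M T\<phi> = div_q (p M \<phi>) - div_p (\<nabla>U M \<phi>)\<close> and \<open>M (lam \<Delta>_p \<phi> - p \<cdot> \<nabla>_p \<phi>) = lam div_p (M \<nabla>_p \<phi>)\<close>.\<close>
lemma integral_maxwell_gen:
  assumes \<phi>: "Cc_smooth \<phi>" shows "(LINT z|lborel. maxwell z * gen \<phi> z) = 0"
proof -
  note s = Cc_smoothD[OF \<phi>]
  define X where "X i = (\<lambda>z. snd z $ i * (maxwell z * \<phi> z))" for i
  define Y where "Y i = (\<lambda>z. force i z * (maxwell z * \<phi> z))" for i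
  define Z where "Z i = (\<lambda>z. maxwell z * dd (pdir i) \<phi> z)" for i
  have cc: "Cc_smooth (X i)" "Cc_smooth (Y i)" "Cc_smooth (Z i)" for i
    unfolding X_def Y_def Z_def
    by (intro Cc_smooth_mult_left Cc_smooth_dd \<phi> smooth_force smooth_snd_component smooth_maxwell)+
  define E where "E i z = dd (qdir i) (X i) z - dd (pdir i) (Y i) z + lam * dd (pdir i) (Z i) z" for i z
  have E: "integrable lborel (E i)" "(LINT z|lborel. E i z) = 0" for i
    unfolding E_def using cc[THEN Cc_smooth_dd, THEN Cc_smooth_integrable] cc[THEN integral_dd_eq_0]
    by simp_all
  have "maxwell z * (gen_term i \<phi> z) = E i z" for i z
    unfolding E_def X_def Y_def Z_def using lam_pos
    by (simp add: dd_mult s smooth_mult smooth_dd smooth_force smooth_snd_component smooth_maxwell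
        dd_momentum dd_pdir_force dd_pdir_maxwell dd_qdir_maxwell) (simp add: field_simps)
  then have "(LINT z|lborel. maxwell z * gen \<phi> z) = (LINT z|lborel. (\<Sum>i\<in>UNIV. E i z))"
    by (simp add: gen_def sum_distrib_left)
  also have "\<dots> = 0" by (simp add: Bochner_Integration.integral_sum E)
  finally show ?thesis .
qed

end

section \<open>Stationary states and the self-consistency equation\<close>
theorem proposition1:
  fixes V \<psi> :: "real^'d \<Rightarrow> real" and lam :: real
  assumes "lam > 0"
    and "V1 V" and "V2 V" and "V3 V" and "V4 V"
    and "interaction_potential \<psi>"
  shows "(\<forall>\<rho>. in_L1 \<rho> \<and> in_Linfty \<rho> \<and> vfp_stationary lam V \<psi> \<rho> \<longrightarrow> self_consistent lam V \<psi> \<rho>) \<and>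
         (\<forall>\<rho>. prob_density \<rho> \<and> self_consistent lam V \<psi> \<rho> \<longrightarrow> vfp_stationary lam V \<psi> \<rho>)"
proof -
  have V: "smooth V" using \<open>V1 V\<close> by (simp add: V1_def)
  define U where "U \<rho> q = V q + conv \<psi> \<rho> q" for \<rho> :: "'d phase \<Rightarrow> real" and q
  have kinetic: "kinetic (U \<rho>) lam" and gradU: "grad V q + conv (grad \<psi>) \<rho> q = grad (U \<rho>) q"
    if "prob_density \<rho>" "conv_defined \<psi> \<rho>" for \<rho> q
  proof -
    note sc = smooth_conv[OF \<open>interaction_potential \<psi>\<close> that]
    show "kinetic (U \<rho>) lam"
      using \<open>lam > 0\<close> V sc unfolding U_def[abs_def] by unfold_locales (auto intro: smooth_add)
    show "grad V q + conv (grad \<psi>) \<rho> q = grad (U \<rho>) q"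
      unfolding conv_grad[OF \<open>interaction_potential \<psi>\<close> that] U_def[abs_def]
      by (simp add: vec_eq_iff grad_component dd_add V sc)
  qed
  have gibbs: "gibbs_weight lam V \<psi> \<rho> = kinetic.maxwell (U \<rho>) lam"
    if "prob_density \<rho>" "conv_defined \<psi> \<rho>" for \<rho>
    using kinetic[OF that]
    by (auto simp: gibbs_weight_def kinetic.maxwell_def kinetic.energy_def U_def fun_eq_iff add.assoc)
  show ?thesis
  proof (intro conjI allI impI)
    fix \<rho> :: "'d phase \<Rightarrow> real"
    assume "in_L1 \<rho> \<and> in_Linfty \<rho> \<and> vfp_stationary lam V \<psi> \<rho>"
    then have inf: "in_Linfty \<rho>" and pd: "prob_density \<rho>" and cd: "conv_defined \<psi> \<rho>"
      and weak: "\<And>\<phi>. test_function \<phi> \<Longrightarrow> vfp_op lam V \<psi> \<rho> \<rho> \<phi> = 0"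
      by (auto simp: vfp_stationary_def)
    have \<rho>: "integrable lborel \<rho>" "(LINT z|lborel. \<rho> z) = 1" "AE z in lborel. 0 \<le> \<rho> z"
      using pd by (auto simp: prob_density_def has_bochner_integral_iff)
    have [measurable]: "\<rho> \<in> borel_measurable borel" using \<rho>(1) by auto
    obtain C where C: "AE z in lborel. \<bar>\<rho> z\<bar> \<le> C" using inf by (auto simp: in_Linfty_def)
    interpret kinetic "U \<rho>" lam by (rule kinetic[OF pd cd])
    \<comment> \<open>The bounds on \<open>\<rho>\<close> hold almost everywhere; \<open>\<rho>'\<close> is a representative for which they hold everywhere.\<close>
    define \<rho>' where "\<rho>' z = min \<bar>C\<bar> (max 0 (\<rho> z))" for z
    have [measurable]: "\<rho>' \<in> borel_measurable borel" unfolding \<rho>'_def[abs_def] by measurable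
    have eq: "AE z in lborel. \<rho> z = \<rho>' z"
      using C \<rho>(3) by eventually_elim (auto simp: \<rho>'_def)
    obtain B where B: "\<And>q. B \<le> V q" using V3_coercive(1)[OF \<open>V3 V\<close>] by blast
    have V_le: "V q \<le> U \<rho> q" for q
      using conv_nonneg[OF \<open>interaction_potential \<psi>\<close> pd cd] by (simp add: U_def)
    interpret kinetic_solution "U \<rho>" lam \<rho>' "\<bar>C\<bar>" B
    proof
      have "integrable lborel \<rho> \<longleftrightarrow> integrable lborel \<rho>'"
        by (rule integrable_cong_AE) (use eq in auto)
      with \<rho>(1) show "integrable lborel \<rho>'" by simp
      show "0 \<le> \<rho>' z" "\<rho>' z \<le> \<bar>C\<bar>" for z by (auto simp: \<rho>'_def)
      show "B \<le> U \<rho> q" for q using B V_le order_trans by blast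
      show "bounded {q. U \<rho> q \<le> R}" for R
        by (rule bounded_subset[OF V3_coercive(2)[OF \<open>V3 V\<close>, of R]]) (use V_le order_trans in blast)
      fix \<phi> :: "'d phase \<Rightarrow> real" assume \<phi>: "Cc_smooth \<phi>"
      note [measurable] = smooth_measurable[OF Cc_smoothD[OF Cc_smooth_gen[OF \<phi>]]]
      have "(LINT z|lborel. \<rho>' z * gen \<phi> z) = (LINT z|lborel. \<rho> z * gen \<phi> z)"
        by (rule integral_cong_AE) (use eq in auto)
      also have "\<dots> = vfp_op lam V \<psi> \<rho> \<rho> \<phi>"
        by (rule vfp_op_eq_integral_gen[OF \<rho>(1) \<phi> gradU[OF pd cd], symmetric])
      also have "\<dots> = 0" using weak \<phi> by (simp add: test_function_iff_Cc_smooth)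
      finally show "(LINT z|lborel. \<rho>' z * gen \<phi> z) = 0" .
    qed
    obtain c where c: "AE z in lborel. \<rho>' z = c * maxwell z" by (rule stationary_is_maxwellian)
    have \<rho>c: "AE z in lborel. \<rho> z = c * maxwell z" using eq c by eventually_elim simp
    note [measurable] = smooth_measurable[OF smooth_maxwell]
    have "(LINT z|lborel. \<rho> z) = (LINT z|lborel. c * maxwell z)"
      by (rule integral_cong_AE) (use \<rho>c in auto)
    then have c1: "c * (LINT z|lborel. maxwell z) = 1" using \<rho>(2) by simp
    then have "c \<noteq> 0" by auto
    have "integrable lborel \<rho> \<longleftrightarrow> integrable lborel (\<lambda>z. c * maxwell z)"
      by (rule integrable_cong_AE) (use \<rho>c in auto)
    with \<rho>(1) \<open>c \<noteq> 0\<close> have "integrable lborel maxwell" by simp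
    moreover have "inverse (LINT z|lborel. maxwell z) = c"
      using c1 by (metis inverse_unique mult.commute)
    ultimately show "self_consistent lam V \<psi> \<rho>"
      using cd \<rho>c unfolding self_consistent_def partition_function_def gibbs[OF pd cd] by simp
  next
    fix \<rho> :: "'d phase \<Rightarrow> real"
    assume "prob_density \<rho> \<and> self_consistent lam V \<psi> \<rho>"
    then have pd: "prob_density \<rho>" and cd: "conv_defined \<psi> \<rho>"
      and sc: "AE z in lborel. \<rho> z = inverse (partition_function lam V \<psi> \<rho>) * gibbs_weight lam V \<psi> \<rho> z"
      by (auto simp: self_consistent_def)
    have \<rho>: "integrable lborel \<rho>" using pd by (auto simp: prob_density_def has_bochner_integral_iff)
    interpret kinetic "U \<rho>" lam by (rule kinetic[OF pd cd])
    obtain c where c: "AE z in lborel. \<rho> z = c * maxwell z" using sc unfolding gibbs[OF pd cd] by blast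
    have "vfp_op lam V \<psi> \<rho> \<rho> \<phi> = 0" if \<phi>: "Cc_smooth \<phi>" for \<phi>
    proof -
      note [measurable] = smooth_measurable[OF Cc_smoothD[OF Cc_smooth_gen[OF \<phi>]]] smooth_measurable[OF smooth_maxwell]
      have "vfp_op lam V \<psi> \<rho> \<rho> \<phi> = (LINT z|lborel. \<rho> z * gen \<phi> z)"
        by (rule vfp_op_eq_integral_gen[OF \<rho> \<phi> gradU[OF pd cd]])
      also have "\<dots> = (LINT z|lborel. c * (maxwell z * gen \<phi> z))"
        by (rule integral_cong_AE) (use \<rho> c in auto)
      also have "\<dots> = 0" by (simp add: integral_maxwell_gen[OF \<phi>])
      finally show ?thesis .
    qed
    then show "vfp_stationary lam V \<psi> \<rho>"
      using pd cd conv_defined_grad[OF \<open>interaction_potential \<psi>\<close> pd cd]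
      by (simp add: vfp_stationary_def test_function_iff_Cc_smooth)
  qed
qed

end
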